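(* Let $G$ be a unimodular locally compact group with Haar measure $\mu$ (also written $dg$). Let $\phi_1,\phi_2\colon G\to\mathbb{R}_{\ge 0}$ be measurable functions such that $$\mu(\mathrm{supp}\,\phi_1)+\mu(\mathrm{supp}\,\phi_2)\le m(G),$$ and such that $\phi_1*\phi_2(g)<\infty$ for almost every $g\in G$ and $\phi_1^**\phi_2^*(x)<\infty$ for almost every $x\in\mathbb{R}$. Let $f\colon\mathbb{R}_{\ge 0}\to\mathbb{R}$ be a convex function with $f(0)=0$. If both integrals $\int_G f\circ(\phi_1*\phi_2)(g)\,dg$ and $\int_{\mathbb{R}} f\circ(\phi_1^**\phi_2^* )(x)\,dx$ can be defined (as elements of $[-\infty,\infty]$), then $$\int_G f\circ(\phi_1*\phi_2)(g)\,dg\le\int_{\mathbb{R}} f\circ(\phi_1^**\phi_2^* )(x)\,dx .$$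
   Context: For a locally compact group $G$ with Haar measure $\mu$, $m(G)\in[0,\infty]$ denotes the infimum of $\mu(U)$ over all open subgroups $U\subset G$. For a function $\phi\colon G\to\mathbb{R}_{\ge0}$, $\mathrm{supp}\,\phi:=\{g\in G\mid\phi(g)\neq0\}$ (no closure is taken); by convention, "measurable function" includes the assumption that $\mathrm{supp}\,\phi$ is $\sigma$-finite. Convolution on $G$ is $\phi_1*\phi_2(g)=\int_G\phi_1(g')\phi_2(g'^{-1}g)\,dg'\in[0,\infty]$, and convolution on $\mathbb{R}$ is taken with respect to Lebesgue measure. The rearrangement of a measurable $\phi\colon G\to\mathbb{R}_{\ge0}$ is the function $\phi^*$ on $\mathbb{R}$ defined by $$\phi^*(x):=\inf\{t\ge0\mid\mu(\phi^{-1}(\mathbb{R}_{>t}))\le 2|x|\},\qquad \mathbb{R}_{>t}:=\{s\in\mathbb{R}\mid s>t\},$$ with $\inf\emptyset=\infty$. An integral "can be defined" if the integral of the positive part or of the negative part of the integrand is finite. *)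

theory Defs
  imports "HOL-Analysis.Analysis"
begin

text \<open>
  A Hausdorff locally compact group is a type of class \<open>topological_group_add\<close> and \<open>t2_space\<close> whose
  topology satisfies \<^const>\<open>locally_compact_space\<close>. The class \<open>group_add\<close> is not commutative: the
  product \<open>g h\<close> is written \<open>g + h\<close> and the inverse of \<open>g\<close> is written \<open>- g\<close>.
\<close>

definition open_subgroup :: "'a::topological_group_add set \<Rightarrow> bool" where
  "open_subgroup U \<longleftrightarrow>
     open U \<and> 0 \<in> U \<and> (\<forall>x\<in>U. \<forall>y\<in>U. x + y \<in> U) \<and> (\<forall>x\<in>U. - x \<in> U)"

definition left_invariant :: "'a::topological_group_add measure \<Rightarrow> bool" where
  "left_invariant M \<longleftrightarrow> (\<forall>g. \<forall>A\<in>sets M. emeasure M ((\<lambda>x. g + x) ` A) = emeasure M A)"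

definition right_invariant :: "'a::topological_group_add measure \<Rightarrow> bool" where
  "right_invariant M \<longleftrightarrow> (\<forall>g. \<forall>A\<in>sets M. emeasure M ((\<lambda>x. x + g) ` A) = emeasure M A)"

text \<open>Radon measures need not be \<open>\<sigma>\<close>-finite: inner regularity is required on open sets only.\<close>

definition radon_measure :: "'a::t2_space measure \<Rightarrow> bool" where
  "radon_measure M \<longleftrightarrow>
     sets M = sets borel \<and>
     (\<forall>K. compact K \<longrightarrow> emeasure M K < \<infinity>) \<and>
     (\<forall>A\<in>sets M. emeasure M A = (INF U\<in>{U. open U \<and> A \<subseteq> U}. emeasure M U)) \<and>
     (\<forall>U. open U \<longrightarrow> emeasure M U = (SUP K\<in>{K. compact K \<and> K \<subseteq> U}. emeasure M K))"

definition haar_measure :: "'a::{topological_group_add, t2_space} measure \<Rightarrow> bool" where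
  "haar_measure M \<longleftrightarrow> radon_measure M \<and> left_invariant M \<and> emeasure M UNIV \<noteq> 0"

definition min_open_subgroup :: "'a::topological_group_add measure \<Rightarrow> ennreal" where
  "min_open_subgroup M = (INF U\<in>{U. open_subgroup U}. emeasure M U)"

definition supp :: "('a \<Rightarrow> real) \<Rightarrow> 'a set" where
  "supp \<phi> = {g. \<phi> g \<noteq> 0}"

definition nonneg_measurable :: "'a measure \<Rightarrow> ('a \<Rightarrow> real) \<Rightarrow> bool" where
  "nonneg_measurable M \<phi> \<longleftrightarrow>
     \<phi> \<in> borel_measurable M \<and> (\<forall>g. 0 \<le> \<phi> g) \<and>
     sigma_finite_measure (restrict_space M (supp \<phi>))"

text \<open>
  The same definition serves for the group, in the form \<open>\<integral> u(h) v(h\<^sup>-\<^sup>1 g) dh\<close>, and for the real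
  line with Lebesgue measure, where \<open>- h + g\<close> is \<open>g - h\<close>.
\<close>

definition convolve ::
  "'a::group_add measure \<Rightarrow> ('a \<Rightarrow> ennreal) \<Rightarrow> ('a \<Rightarrow> ennreal) \<Rightarrow> 'a \<Rightarrow> ennreal" where
  "convolve M u v g = (\<integral>\<^sup>+ h. u h * v (- h + g) \<partial>M)"

text \<open>In \<^typ>\<open>ennreal\<close> the infimum of the empty set is \<open>\<infinity>\<close>.\<close>

definition rearrangement :: "'a measure \<Rightarrow> ('a \<Rightarrow> real) \<Rightarrow> real \<Rightarrow> ennreal" where
  "rearrangement M \<phi> x =
     Inf {ennreal t | t. 0 \<le> t \<and> emeasure M {g \<in> space M. t < \<phi> g} \<le> ennreal (2 * \<bar>x\<bar>)}"

text \<open>Since \<open>ennreal r = 0\<close> for \<open>r \<le> 0\<close>, the two integrals are those of the positive and of the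
  negative part of \<open>h\<close>.\<close>

definition integral_definable :: "'a measure \<Rightarrow> ('a \<Rightarrow> real) \<Rightarrow> bool" where
  "integral_definable M h \<longleftrightarrow>
     (\<integral>\<^sup>+ x. ennreal (h x) \<partial>M) < \<infinity> \<or> (\<integral>\<^sup>+ x. ennreal (- h x) \<partial>M) < \<infinity>"

definition ext_integral :: "'a measure \<Rightarrow> ('a \<Rightarrow> real) \<Rightarrow> ereal" where
  "ext_integral M h =
     enn2ereal (\<integral>\<^sup>+ x. ennreal (h x) \<partial>M) - enn2ereal (\<integral>\<^sup>+ x. ennreal (- h x) \<partial>M)"

text \<open>
  The composite \<open>f \<circ> u\<close> for \<open>f\<close> on the finite nonnegative reals and \<open>u\<close> finite almost everywhere.
  Where \<open>u\<close> is infinite its value is irrelevant for integration.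
\<close>

definition comp_ennreal :: "(real \<Rightarrow> real) \<Rightarrow> ('a \<Rightarrow> ennreal) \<Rightarrow> 'a \<Rightarrow> real" where
  "comp_ennreal f u x = f (enn2real (u x))"

end

theory Submission
  imports Defs
begin

text \<open>
  By a layer cake decomposition the inequality reduces to the functions \<open>y \<mapsto> max 0 (y - t)\<close> and to
  sets: for sets \<open>A\<close>, \<open>B\<close> of measures \<open>a\<close>, \<open>b\<close> with \<open>a + b \<le> m(G)\<close> and \<open>t \<le> min a b\<close>, the excess
  of the convolution of their indicator functions over \<open>t\<close> has integral at most \<open>(a - t) * (b - t)\<close>,
  which is the value for two intervals on the real line.

  Kemperman's uncrossing replaces \<open>(A, B)\<close> by the two pairs \<open>(A \<union> (A + g), B \<inter> (- g + B))\<close> and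
  \<open>(A \<inter> (A + g), B \<union> (- g + B))\<close>. The defect of the inequality at \<open>(A, B)\<close> is at most the average of
  its defects at these two pairs, so by a maximum principle only the boundary matters, where one of
  the measures is \<open>t\<close>, or \<open>A\<close> and \<open>B\<close> fill their cosets of a smallest open subgroup up to overlap
  \<open>t\<close>; there the inequality is elementary. Elements \<open>g\<close> with small but nonzero effect exist because there
  is no smaller open subgroup. When \<open>A\<close> and \<open>B\<close> meet several cosets, \<open>t\<close> is split over the pairs of
  cosets.
\<close>

section \<open>Radon measures\<close>

text \<open>Uncrossing changes the measures \<open>(a, b)\<close> to
  \<open>(a + \<delta>, b - \<epsilon>)\<close> and \<open>(a - \<delta>, b + \<epsilon>)\<close>.
  The average of \<open>(a - t) * (b - t)\<close> thereby drops by
  \<open>\<delta> * \<epsilon>\<close>, and this is exactly what the difference sets of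
  \<open>A\<close>, \<open>B\<close> and their translates can contribute to the excess. That is why
  the defect passes to the average without loss. Two obstacles shape the rest. The Haar measure is
  only a Radon measure, so measurability of the overlap and the exchange of integrals are derived
  from open sets by regularity. And the functions \<open>max 0 (y - t)\<close> generate only
  nonnegative convex functions vanishing at 0, whereas \<open>f\<close> may be negative, may drop
  steeply at 0, and may have infinite integrals. Its decreasing part is reached by subtracting a
  concave function from a linear one, using that the step convolutions on both sides have equal
  finite mass.\<close>

lemma step_sum_le:
  fixes L :: ennreal and d :: real
  assumes "0 < d" and "\<And>k. k \<in> {1..N} \<Longrightarrow> P k \<Longrightarrow> ennreal (real k * d) \<le> L"
  shows "(\<Sum>k=1..N. if P k then ennreal d else 0) \<le> L"
proof -
  define K where "K = {k\<in>{1..N}. P k}"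
  have fin: "finite K" unfolding K_def by simp
  have *: "(\<Sum>k=1..N. if P k then ennreal d else 0) = of_nat (card K) * ennreal d"
    by (subst sum.inter_filter[symmetric]) (simp_all add: K_def)
  also have "\<dots> = ennreal (real (card K) * d)"
    using assms(1) by (simp add: ennreal_of_nat_eq_real_of_nat ennreal_mult')
  also have "\<dots> \<le> L"
  proof (cases "K = {}")
    case False
    \<comment> \<open>The number of indices satisfying \<open>P\<close> is at most the largest of
      them, and at that index \<open>P\<close> already bounds \<open>L\<close> from below.\<close>
    have "K \<subseteq> {1..Max K}" using fin False unfolding K_def by auto
    from card_mono[OF _ this] have "card K \<le> Max K" by simp
    then have "ennreal (real (card K) * d) \<le> ennreal (real (Max K) * d)"
      using assms(1) by (intro ennreal_leI mult_right_mono) auto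
    also have "\<dots> \<le> L" using Max_in[OF fin False] assms(2) unfolding K_def by blast
    finally show ?thesis .
  qed simp
  finally show ?thesis .
qed

text \<open>With \<open>(n + 1)^2\<close> steps of width \<open>1 / (n + 1)\<close> the sums reach
  the height \<open>n + 1\<close>, so resolution and range improve together and
  \<open>L = \<infinity>\<close> is covered. The lower condition is asked only for large
  \<open>n\<close> because later \<open>P n k\<close> involves a set that exhausts the support as
  \<open>n\<close> grows.\<close>

lemma step_sum_tendsto:
  fixes L :: ennreal
  assumes up: "\<And>n k. P n k \<Longrightarrow> ennreal (real k * (1 / real (Suc n))) \<le> L"
    and low: "\<And>s. 0 \<le> s \<Longrightarrow> ennreal s < L \<Longrightarrow>
      eventually (\<lambda>n. \<forall>k\<ge>1. real k * (1 / real (Suc n)) \<le> s \<longrightarrow> P n k) sequentially"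
  shows "(\<lambda>n. \<Sum>k=1..(Suc n)^2. if P n k then ennreal (1 / real (Suc n)) else 0) \<longlonglongrightarrow> L"
proof (rule order_tendstoI)
  fix l assume "L < l"
  moreover have "(\<Sum>k=1..(Suc n)^2. if P n k then ennreal (1 / real (Suc n)) else 0) \<le> L" for n
    by (rule step_sum_le) (use up in auto)
  ultimately show "\<forall>\<^sub>F n in sequentially.
      (\<Sum>k=1..(Suc n)^2. if P n k then ennreal (1 / real (Suc n)) else 0) < l"
    by (intro always_eventually allI) (rule le_less_trans)
next
  fix l assume "l < L"
  obtain s' where s': "l < s'" "s' < L" using dense[OF \<open>l < L\<close>] by auto
  obtain s where s: "s' = ennreal s" "0 \<le> s"
    using s'(2) by (cases s') auto
  obtain r where r: "l = ennreal r" "0 \<le> r"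
    using s'(1) by (cases l) auto
  have rs: "r < s" using s' s r by (simp add: ennreal_less_iff)
  have e1: "\<forall>\<^sub>F n in sequentially. 1 / real (Suc n) < s - r"
    using rs by (intro order_tendstoD(2)[OF LIMSEQ_Suc[OF lim_1_over_n]]) auto
  have e2: "\<forall>\<^sub>F n in sequentially. s \<le> real n"
    by (rule eventually_sequentiallyI[of "nat \<lceil>s\<rceil>"]) linarith
  have e3: "\<forall>\<^sub>F n in sequentially. \<forall>k\<ge>1. real k * (1 / real (Suc n)) \<le> s \<longrightarrow> P n k"
    using low[of s] s s' by simp
  show "\<forall>\<^sub>F n in sequentially.
      l < (\<Sum>k=1..(Suc n)^2. if P n k then ennreal (1 / real (Suc n)) else 0)"
    using e1 e2 e3
  proof eventually_elim
    case (elim n)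
    define m where "m = nat \<lfloor>s * real (Suc n)\<rfloor>"
    have sn: "0 \<le> s * real (Suc n)" using s by simp
    have mle: "real m \<le> s * real (Suc n)" unfolding m_def using sn by linarith
    have mge: "s * real (Suc n) - 1 < real m" unfolding m_def using sn by linarith
    have "real m \<le> real (Suc n) * real (Suc n)"
      using mle mult_right_mono[of s "real (Suc n)" "real (Suc n)"] elim(2) by linarith
    then have m2: "m \<le> (Suc n)^2" by (metis of_nat_le_iff of_nat_mult power2_eq_square)
    have "r < s - 1 / real (Suc n)" using elim(1) by linarith
    also have "\<dots> = (s * real (Suc n) - 1) * (1 / real (Suc n))" by (simp add: field_simps)
    also have "\<dots> \<le> real m * (1 / real (Suc n))" using mge by (intro mult_right_mono) auto
    finally have "l < ennreal (real m * (1 / real (Suc n)))" using r by (simp add: ennreal_less_iff)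
    also have "\<dots> = (\<Sum>k=1..m. ennreal (1 / real (Suc n)))"
      by (simp add: ennreal_of_nat_eq_real_of_nat flip: ennreal_mult')
    also have "\<dots> = (\<Sum>k=1..m. if P n k then ennreal (1 / real (Suc n)) else 0)"
    proof (rule sum.cong[OF refl])
      fix k assume k: "k \<in> {1..m}"
      have "real k * (1 / real (Suc n)) \<le> real m * (1 / real (Suc n))"
        using k by (intro mult_right_mono) auto
      also have "\<dots> \<le> s" using mle by (simp add: field_simps)
      finally have "P n k" using elim(3) k by auto
      then show "ennreal (1 / real (Suc n)) = (if P n k then ennreal (1 / real (Suc n)) else 0)" by simp
    qed
    also have "\<dots> \<le> (\<Sum>k=1..(Suc n)^2. if P n k then ennreal (1 / real (Suc n)) else 0)"
      using m2 by (intro sum_mono2) auto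
    finally show ?case .
  qed
qed

text \<open>Half of the layer cake formula, obtained from Fatou's lemma and hence valid for every
  measure; this half is what the exchange of integrals below requires.\<close>

lemma nn_integral_le_liminf_steps:
  fixes f :: "'a \<Rightarrow> ennreal"
  assumes [measurable]: "f \<in> borel_measurable M"
  shows "(\<integral>\<^sup>+x. f x \<partial>M) \<le> liminf (\<lambda>n. \<Sum>k=1..(Suc n)^2.
      ennreal (1 / real (Suc n)) * emeasure M {x\<in>space M. ennreal (real k * (1 / real (Suc n))) < f x})"
proof -
  define g where "g n x = (\<Sum>k=1..(Suc n)^2. if ennreal (real k * (1 / real (Suc n))) < f x
    then ennreal (1 / real (Suc n)) else 0)" for n x
  have [measurable]: "g n \<in> borel_measurable M" for n unfolding g_def by measurable
  have lim: "(\<lambda>n. g n x) \<longlonglongrightarrow> f x" for x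
    unfolding g_def
  proof (rule step_sum_tendsto)
    fix s :: real assume "0 \<le> s" "ennreal s < f x"
    then show "\<forall>\<^sub>F n in sequentially.
        \<forall>k\<ge>1. real k * (1 / real (Suc n)) \<le> s \<longrightarrow> ennreal (real k * (1 / real (Suc n))) < f x"
      by (auto intro!: always_eventually intro: le_less_trans[OF ennreal_leI])
  qed auto
  have "(\<integral>\<^sup>+x. f x \<partial>M) = (\<integral>\<^sup>+x. liminf (\<lambda>n. g n x) \<partial>M)"
    by (intro nn_integral_cong) (simp add: lim_imp_Liminf[OF _ lim])
  also have "\<dots> \<le> liminf (\<lambda>n. \<integral>\<^sup>+x. g n x \<partial>M)" by (rule nn_integral_liminf) measurable
  also have "(\<lambda>n. \<integral>\<^sup>+x. g n x \<partial>M) = (\<lambda>n. \<Sum>k=1..(Suc n)^2.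
      ennreal (1 / real (Suc n)) * emeasure M {x\<in>space M. ennreal (real k * (1 / real (Suc n))) < f x})"
  proof
    fix n
    have "(\<integral>\<^sup>+x. g n x \<partial>M) = (\<Sum>k=1..(Suc n)^2. \<integral>\<^sup>+x. (if ennreal (real k * (1 / real (Suc n))) < f x
       then ennreal (1 / real (Suc n)) else 0) \<partial>M)"
      unfolding g_def by (rule nn_integral_sum) measurable
    also have "\<dots> = (\<Sum>k=1..(Suc n)^2. \<integral>\<^sup>+x. ennreal (1 / real (Suc n)) *
        indicator {x\<in>space M. ennreal (real k * (1 / real (Suc n))) < f x} x \<partial>M)"
      by (intro sum.cong refl nn_integral_cong) (auto simp: indicator_def)
    also have "\<dots> = (\<Sum>k=1..(Suc n)^2.
      ennreal (1 / real (Suc n)) * emeasure M {x\<in>space M. ennreal (real k * (1 / real (Suc n))) < f x})"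
      by (intro sum.cong refl nn_integral_cmult_indicator) measurable
    finally show "(\<integral>\<^sup>+x. g n x \<partial>M) = (\<Sum>k=1..(Suc n)^2.
      ennreal (1 / real (Suc n)) * emeasure M {x\<in>space M. ennreal (real k * (1 / real (Suc n))) < f x})" .
  qed
  finally show ?thesis .
qed

lemma borel_measurable_lower_semicontinuous:
  fixes f :: "'a::topological_space \<Rightarrow> ennreal"
  assumes "\<And>s. open {x. s < f x}"
  shows "f \<in> borel_measurable borel"
  by (rule borel_measurableI_greater) (use assms in auto)

text \<open>Cutting \<open>M\<close> down to a density supported on \<open>D\<close> gives a finite
  measure, to which Tonelli's theorem applies.\<close>

lemma nn_integral_section_swap:
  assumes [measurable]: "R \<in> sets (M \<Otimes>\<^sub>M M)" and D[measurable]: "D \<in> sets M" and fin: "emeasure M D < \<infinity>"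
    and sub: "R \<subseteq> D \<times> D"
  shows "(\<integral>\<^sup>+x. emeasure M {y. (x, y) \<in> R} \<partial>M) = (\<integral>\<^sup>+y. emeasure M {x. (x, y) \<in> R} \<partial>M)"
proof -
  define N where "N = density M (indicator D)"
  have sN[measurable_cong, simp]: "sets N = sets M" by (simp add: N_def)
  have em: "emeasure N X = emeasure M (D \<inter> X)" if "X \<in> sets M" for X
  proof -
    have "emeasure N X = (\<integral>\<^sup>+x. indicator (D \<inter> X) x \<partial>M)"
      unfolding N_def using that D
      by (subst emeasure_density) (auto simp: indicator_inter_arith simp del: nn_integral_indicator intro!: nn_integral_cong)
    then show ?thesis using that D by (simp add: nn_integral_set_ennreal)
  qed
  have "finite_measure N"
    using fin D by (intro finite_measureI) (use em[of "space M"] D in \<open>simp add: sets_eq_imp_space_eq[OF sN]\<close>)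
  then interpret N: finite_measure N .
  interpret P: pair_sigma_finite N N ..
  have RN: "R \<in> sets (N \<Otimes>\<^sub>M N)" using assms(1) by (simp cong: sets_pair_measure_cong)
  have sec1: "{y. (x, y) \<in> R} = Pair x -` R" for x by auto
  have sec2: "{x. (x, y) \<in> R} = (\<lambda>x. (x, y)) -` R" for y by auto
  have m1: "Pair x -` R \<in> sets M" for x by (rule sets_Pair1) fact
  have m2: "(\<lambda>x. (x, y)) -` R \<in> sets M" for y by (rule sets_Pair2) fact
  have i1: "D \<inter> (Pair x -` R) = Pair x -` R" "D \<inter> ((\<lambda>x. (x, y)) -` R) = (\<lambda>x. (x, y)) -` R" for x y
    using sub by auto
  have e1: "emeasure N (Pair x -` R) = emeasure M (Pair x -` R)" for x
    using em[OF m1] i1 by simp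
  have e2: "emeasure N ((\<lambda>x. (x, y)) -` R) = emeasure M ((\<lambda>x. (x, y)) -` R)" for y
    using em[OF m2] i1 by simp
  have z1: "Pair x -` R = {}" if "x \<notin> D" for x using sub that by auto
  have z2: "(\<lambda>x. (x, y)) -` R = {}" if "y \<notin> D" for y using sub that by auto
  have ms1: "(\<lambda>x. emeasure M (Pair x -` R)) \<in> borel_measurable M"
    using N.measurable_emeasure_Pair[OF RN] by (simp add: e1 cong: measurable_cong_sets)
  have ms2: "(\<lambda>y. emeasure M ((\<lambda>x. (x, y)) -` R)) \<in> borel_measurable M"
    using P.measurable_emeasure_Pair2[OF RN] by (simp add: e2 cong: measurable_cong_sets)
  have "(\<integral>\<^sup>+x. emeasure M (Pair x -` R) \<partial>M) = (\<integral>\<^sup>+x. emeasure N (Pair x -` R) \<partial>N)"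
    unfolding e1 using ms1 unfolding N_def
    by (subst nn_integral_density) (auto intro!: nn_integral_cong simp: indicator_def z1)
  also have "\<dots> = emeasure (N \<Otimes>\<^sub>M N) R" by (rule N.emeasure_pair_measure_alt[OF RN, symmetric])
  also have "\<dots> = (\<integral>\<^sup>+y. emeasure N ((\<lambda>x. (x, y)) -` R) \<partial>N)" by (rule P.emeasure_pair_measure_alt2[OF RN])
  also have "\<dots> = (\<integral>\<^sup>+y. emeasure M ((\<lambda>x. (x, y)) -` R) \<partial>M)"
    unfolding e2 using ms2 unfolding N_def
    by (subst nn_integral_density) (auto intro!: nn_integral_cong simp: indicator_def z2)
  finally show ?thesis by (simp add: sec1 sec2)
qed

section \<open>Sections of open sets under a Radon measure\<close>

lemma radon_measureD:
  assumes "radon_measure M"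
  shows "sets M = sets borel" "space M = UNIV" "compact K \<Longrightarrow> emeasure M K < \<infinity>"
    "A \<in> sets borel \<Longrightarrow> emeasure M A = (INF U\<in>{U. open U \<and> A \<subseteq> U}. emeasure M U)"
    "open U \<Longrightarrow> emeasure M U = (SUP K\<in>{K. compact K \<and> K \<subseteq> U}. emeasure M K)"
  using assms sets_eq_imp_space_eq[of M borel] unfolding radon_measure_def by auto

lemma open_section: "open \<Omega> \<Longrightarrow> open {y. (x, y) \<in> \<Omega>}"
  using open_vimage[of \<Omega> "Pair x"] by (simp add: vimage_def continuous_on_Pair)

lemma open_section': "open \<Omega> \<Longrightarrow> open {x. (x, y) \<in> \<Omega>}"
  using open_vimage[of \<Omega> "\<lambda>x. (x, y)"] by (simp add: vimage_def continuous_on_Pair)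

text \<open>A compact subset of the section, found by inner regularity, stays inside the sections
  over a whole neighbourhood of \<open>x\<close> by the tube lemma.\<close>

lemma radon_section_open:
  fixes M :: "'a::t2_space measure" and \<Omega> :: "('b::t2_space \<times> 'a) set"
  assumes M: "radon_measure M" and \<Omega>: "open \<Omega>" and less: "s < emeasure M {y. (x, y) \<in> \<Omega>}"
  shows "\<exists>U C. open U \<and> x \<in> U \<and> compact C \<and> s < emeasure M C \<and> U \<times> C \<subseteq> \<Omega>"
proof -
  have "open {y. (x, y) \<in> \<Omega>}" by (rule open_section[OF \<Omega>])
  from less[unfolded radon_measureD(5)[OF M this]]
  obtain C where C: "compact C" "C \<subseteq> {y. (x, y) \<in> \<Omega>}" "s < emeasure M C"
    unfolding less_SUP_iff by auto
  have "{x} \<times> C \<subseteq> \<Omega>" using C(2) by auto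
  from Elementary_Topology.tube_lemma[OF C(1) \<Omega> this]
  obtain U where "x \<in> U \<and> open U \<and> U \<times> C \<subseteq> \<Omega>" ..
  with C show ?thesis by metis
qed

lemma radon_section_lsc:
  fixes M :: "'a::t2_space measure" and \<Omega> :: "('b::t2_space \<times> 'a) set"
  assumes M: "radon_measure M" and \<Omega>: "open \<Omega>"
  shows "open {x. s < emeasure M {y. (x, y) \<in> \<Omega>}}"
proof (subst open_subopen, safe)
  fix x assume "s < emeasure M {y. (x, y) \<in> \<Omega>}"
  from radon_section_open[OF M \<Omega> this] obtain U C where
    U: "open U" "x \<in> U" "compact C" "s < emeasure M C" "U \<times> C \<subseteq> \<Omega>" by auto
  have "s < emeasure M {y. (z, y) \<in> \<Omega>}" if "z \<in> U" for z
  proof -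
    have "open {y. (z, y) \<in> \<Omega>}"
      using open_section[OF \<Omega>] .
    then have "emeasure M C \<le> emeasure M {y. (z, y) \<in> \<Omega>}"
      using U that radon_measureD(1)[OF M] by (intro emeasure_mono) auto
    then show ?thesis using U by auto
  qed
  then show "\<exists>T. open T \<and> x \<in> T \<and> T \<subseteq> {x. s < emeasure M {y. (x, y) \<in> \<Omega>}}"
    using U by auto
qed

text \<open>
  On a non-metrizable space the Borel sets of a product need not lie in the product
  \<open>\<sigma>\<close>-algebra, and the measure need not be \<open>\<sigma>\<close>-finite, so Tonelli's theorem is derived for open
  sets by exhausting them from inside with finite unions of rectangles.
\<close>

lemma radon_tonelli_open_le:
  fixes M :: "'a::t2_space measure" and \<Omega> :: "('a \<times> 'a) set"
  assumes M: "radon_measure M" and \<Omega>: "open \<Omega>"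
  shows "(\<integral>\<^sup>+x. emeasure M {y. (x, y) \<in> \<Omega>} \<partial>M) \<le> (\<integral>\<^sup>+y. emeasure M {x. (x, y) \<in> \<Omega>} \<partial>M)"
proof (rule ccontr)
  define f where "f x = emeasure M {y. (x, y) \<in> \<Omega>}" for x
  note sM = radon_measureD(1,2)[OF M]
  have fo: "open {x. s < f x}" for s unfolding f_def by (rule radon_section_lsc[OF M \<Omega>])
  have [measurable]: "f \<in> borel_measurable M"
    using borel_measurable_lower_semicontinuous[of f, OF fo] sM by (simp cong: measurable_cong_sets)
  assume "\<not> ?thesis"
  then have "(\<integral>\<^sup>+y. emeasure M {x. (x, y) \<in> \<Omega>} \<partial>M) < (\<integral>\<^sup>+x. f x \<partial>M)" (is "?r < _")
    unfolding f_def by simp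
  also have "\<dots> \<le> liminf (\<lambda>n. \<Sum>k=1..(Suc n)^2. ennreal (1 / real (Suc n)) *
      emeasure M {x\<in>space M. ennreal (real k * (1 / real (Suc n))) < f x})"
    by (rule nn_integral_le_liminf_steps) measurable
  finally have "\<forall>\<^sub>F n in sequentially. ?r < (\<Sum>k=1..(Suc n)^2. ennreal (1 / real (Suc n)) *
      emeasure M {x\<in>space M. ennreal (real k * (1 / real (Suc n))) < f x})"
    by (rule less_LiminfD)
  then obtain n where n: "?r < (\<Sum>k=1..(Suc n)^2. ennreal (1 / real (Suc n)) *
      emeasure M {x\<in>space M. ennreal (real k * (1 / real (Suc n))) < f x})"
    by (meson eventually_happens sequentially_bot)
  define d where "d = 1 / real (Suc n)"
  have d: "0 < d" unfolding d_def by simp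
  define V where "V k = {x. ennreal (real k * d) < f x}" for k
  \<comment> \<open>The open sets \<open>V k\<close> may have infinite measure, so each is exhausted
    along a sequence; one index \<open>j\<close> then serves all of the finitely many
    \<open>k\<close>.\<close>
  have "\<exists>K. (\<forall>j. compact (K j) \<and> K j \<subseteq> V k) \<and> (\<lambda>j. emeasure M (K j)) \<longlonglongrightarrow> emeasure M (V k)" for k
  proof -
    have oV: "open (V k)" unfolding V_def by (rule fo)
    obtain c :: "nat \<Rightarrow> ennreal" where c: "incseq c" "range c \<subseteq> emeasure M ` {K. compact K \<and> K \<subseteq> V k}"
        "emeasure M (V k) = Sup (range c)"
      using ennreal_Sup_countable_SUP[of "emeasure M ` {K. compact K \<and> K \<subseteq> V k}"]
      by (auto simp: radon_measureD(5)[OF M oV])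
    then have "\<forall>j. \<exists>K. compact K \<and> K \<subseteq> V k \<and> c j = emeasure M K" by blast
    then obtain K where K: "\<forall>j. compact (K j) \<and> K j \<subseteq> V k" "c = (\<lambda>j. emeasure M (K j))"
      by metis
    with LIMSEQ_SUP[OF c(1)] c(3) show ?thesis by auto
  qed
  then obtain KK where KK: "\<And>k j. compact (KK k j)" "\<And>k j. KK k j \<subseteq> V k"
    "\<And>k. (\<lambda>j. emeasure M (KK k j)) \<longlonglongrightarrow> emeasure M (V k)" by metis
  have "(\<lambda>j. \<Sum>k=1..(Suc n)^2. ennreal d * emeasure M (KK k j)) \<longlonglongrightarrow> (\<Sum>k=1..(Suc n)^2. ennreal d * emeasure M (V k))"
    by (intro tendsto_sum ennreal_tendsto_cmult KK) simp
  then have "\<forall>\<^sub>F j in sequentially. ?r < (\<Sum>k=1..(Suc n)^2. ennreal d * emeasure M (KK k j))"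
    using n by (intro order_tendstoD(1)) (auto simp: V_def d_def sM)
  then obtain j where j: "?r < (\<Sum>k=1..(Suc n)^2. ennreal d * emeasure M (KK k j))"
    by (auto simp: eventually_sequentially)
  define Kc where "Kc k = KK k j" for k
  have Kc: "compact (Kc k)" "Kc k \<subseteq> V k" for k unfolding Kc_def by (rule KK)+
  have Kcs[measurable]: "Kc k \<in> sets M" for k using borel_compact[OF Kc(1)] sM by simp
  have "\<forall>k. \<forall>x\<in>Kc k. \<exists>U C. open U \<and> x \<in> U \<and> compact C \<and> ennreal (real k * d) < emeasure M C \<and> U \<times> C \<subseteq> \<Omega>"
  proof (intro allI ballI)
    fix k x assume "x \<in> Kc k"
    then have "ennreal (real k * d) < emeasure M {y. (x, y) \<in> \<Omega>}"
      using Kc(2)[of k] unfolding V_def f_def by auto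
    from radon_section_open[OF M \<Omega> this]
    show "\<exists>U C. open U \<and> x \<in> U \<and> compact C \<and> ennreal (real k * d) < emeasure M C \<and> U \<times> C \<subseteq> \<Omega>"
      by blast
  qed
  then obtain U C where UC: "\<And>k x. x \<in> Kc k \<Longrightarrow> open (U k x) \<and> x \<in> U k x \<and> compact (C k x) \<and>
      ennreal (real k * d) < emeasure M (C k x) \<and> U k x \<times> C k x \<subseteq> \<Omega>" by metis
  have "\<exists>T. finite T \<and> T \<subseteq> Kc k \<and> Kc k \<subseteq> (\<Union>x\<in>T. U k x)" for k
  proof -
    have 1: "open (U k x)" "x \<in> U k x" if "x \<in> Kc k" for x using UC[OF that] by simp_all
    then have 2: "Kc k \<subseteq> (\<Union>x\<in>Kc k. U k x)" by auto
    from compactE_image[OF Kc(1)[of k] 1(1) 2] show ?thesis by metis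
  qed
  then obtain T where T: "\<And>k. finite (T k)" "\<And>k. T k \<subseteq> Kc k" "\<And>k. Kc k \<subseteq> (\<Union>x\<in>T k. U k x)" by metis
  define I where "I = {1..(Suc n)^2}"
  define K where "K = (\<Union>k\<in>I. Kc k)"
  define D where "D = K \<union> (\<Union>k\<in>I. \<Union>x\<in>T k. C k x)"
  \<comment> \<open>A finite union of measurable rectangles inside \<open>\<Omega>\<close>. Cutting
    with \<open>K\<close> places it in the square of the compact set \<open>D\<close>, which has
    finite measure.\<close>
  define R where "R = (\<Union>k\<in>I. \<Union>x\<in>T k. (U k x \<inter> K) \<times> C k x)"
  have Cc: "compact (C k x)" if "x \<in> T k" for k x using UC T(2) that by blast
  then have "compact D" unfolding D_def K_def I_def using T(1) Kc(1)
    by (intro compact_Un compact_UN) auto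
  then have D: "D \<in> sets M" "emeasure M D < \<infinity>"
    using sM radon_measureD(3)[OF M] borel_compact by auto
  have Ks: "K \<in> sets M" unfolding K_def I_def by auto
  have Cs: "C k x \<in> sets M" "U k x \<in> sets M" if "x \<in> T k" for k x
    using UC[of x k] T(2)[of k] that sM borel_compact[OF Cc[OF that]] by auto
  have RM: "R \<in> sets (M \<Otimes>\<^sub>M M)"
    unfolding R_def I_def using T Ks Cs by (intro sets.finite_UN pair_measureI sets.Int) auto
  have RD: "R \<subseteq> D \<times> D" unfolding R_def D_def by auto
  have RO: "R \<subseteq> \<Omega>" unfolding R_def using UC T by blast
  have "(\<Sum>k\<in>I. ennreal d * emeasure M (Kc k)) = (\<Sum>k\<in>I. \<integral>\<^sup>+x. ennreal d * indicator (Kc k) x \<partial>M)"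
    by (intro sum.cong refl nn_integral_cmult_indicator[symmetric]) auto
  also have "\<dots> = (\<integral>\<^sup>+x. (\<Sum>k\<in>I. ennreal d * indicator (Kc k) x) \<partial>M)"
    by (rule nn_integral_sum[symmetric]) auto
  also have "\<dots> \<le> (\<integral>\<^sup>+x. emeasure M {y. (x, y) \<in> R} \<partial>M)"
  proof (rule nn_integral_mono)
    fix x
    have "(\<Sum>k\<in>I. ennreal d * indicator (Kc k) x) = (\<Sum>k=1..(Suc n)^2. if x \<in> Kc k then ennreal d else 0)"
      unfolding I_def by (intro sum.cong) (auto simp: indicator_def)
    also have "\<dots> \<le> emeasure M {y. (x, y) \<in> R}"
    proof (rule step_sum_le[OF d])
      fix k assume k: "k \<in> {1..(Suc n)\<^sup>2}" "x \<in> Kc k"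
      then obtain z where z: "z \<in> T k" "x \<in> U k z" using T(3) by blast
      have "{y. (x, y) \<in> R} = Pair x -` R" by auto
      then have ms: "{y. (x, y) \<in> R} \<in> sets M" using sets_Pair1[OF RM] by simp
      have "ennreal (real k * d) \<le> emeasure M (C k z)" using UC[of z k] z T(2) by (auto intro: less_imp_le)
      also have "\<dots> \<le> emeasure M {y. (x, y) \<in> R}"
        using z k unfolding R_def K_def I_def by (intro emeasure_mono ms[unfolded R_def K_def I_def]) blast
      finally show "ennreal (real k * d) \<le> emeasure M {y. (x, y) \<in> R}" .
    qed
    finally show "(\<Sum>k\<in>I. ennreal d * indicator (Kc k) x) \<le> emeasure M {y. (x, y) \<in> R}" .
  qed
  also have "\<dots> = (\<integral>\<^sup>+y. emeasure M {x. (x, y) \<in> R} \<partial>M)"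
    by (rule nn_integral_section_swap[OF RM D RD])
  also have "\<dots> \<le> ?r"
  proof (intro nn_integral_mono emeasure_mono)
    fix y
    show "{x. (x, y) \<in> \<Omega>} \<in> sets M"
      using open_section'[OF \<Omega>] sM by simp
  qed (use RO in auto)
  finally show False using j unfolding Kc_def I_def by simp
qed

lemma radon_tonelli_open:
  fixes M :: "'a::t2_space measure" and \<Omega> :: "('a \<times> 'a) set"
  assumes M: "radon_measure M" and \<Omega>: "open \<Omega>"
  shows "(\<integral>\<^sup>+x. emeasure M {y. (x, y) \<in> \<Omega>} \<partial>M) = (\<integral>\<^sup>+y. emeasure M {x. (x, y) \<in> \<Omega>} \<partial>M)"
proof (rule antisym[OF radon_tonelli_open_le[OF assms]])
  have "open (prod.swap -` \<Omega>)" using \<Omega> by (intro open_vimage continuous_on_swap)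
  from radon_tonelli_open_le[OF M this]
  show "(\<integral>\<^sup>+y. emeasure M {x. (x, y) \<in> \<Omega>} \<partial>M) \<le> (\<integral>\<^sup>+x. emeasure M {y. (x, y) \<in> \<Omega>} \<partial>M)" by simp
qed

section \<open>Overlaps of translates\<close>

lemma real_le_mult_epsilon:
  fixes X Y Z :: real
  assumes "\<And>e. 0 < e \<Longrightarrow> e < 1 \<Longrightarrow> X \<le> Y + e * Z"
  shows "X \<le> Y"
proof (rule tendsto_lowerbound)
  show "((\<lambda>e. Y + e * Z) \<longlongrightarrow> Y) (at_right 0)" by (auto intro!: tendsto_eq_intros)
  show "\<forall>\<^sub>F e in at_right 0. X \<le> Y + e * Z"
    using assms by (auto simp: eventually_at_right_field intro!: exI[of _ 1])
qed simp

lemma ennreal_le_mult_epsilon: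
  fixes X :: ennreal and a b :: real
  assumes "\<And>e. 0 < e \<Longrightarrow> X \<le> ennreal ((a + e) * (b + e))"
  shows "X \<le> ennreal (a * b)"
proof (rule tendsto_lowerbound)
  show "((\<lambda>e. ennreal ((a + e) * (b + e))) \<longlongrightarrow> ennreal (a * b)) (at_right 0)"
    by (rule tendsto_ennrealI) (auto intro!: tendsto_eq_intros)
  show "\<forall>\<^sub>F e in at_right 0. X \<le> ennreal ((a + e) * (b + e))"
    using assms by (auto simp: eventually_at_right_field intro!: exI[of _ 1])
qed simp

locale unimodular_haar =
  fixes \<mu> :: "'a::{topological_group_add, t2_space} measure"
  assumes haar: "haar_measure \<mu>" and right_inv: "right_invariant \<mu>"
begin

lemma radon: "radon_measure \<mu>"
  using haar unfolding haar_measure_def by simp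

lemma sets_mu [simp, measurable_cong]: "sets \<mu> = sets borel"
  and space_mu [simp]: "space \<mu> = UNIV"
  using radon_measureD(1,2)[OF radon] by auto

section \<open>Invariance under translations and inversion\<close>

lemma measurable_translations [measurable]:
  "(\<lambda>x::'a. g + x) \<in> borel_measurable borel" "(\<lambda>x::'a. x + g) \<in> borel_measurable borel"
  "(\<lambda>x::'a. x - g) \<in> borel_measurable borel" "(\<lambda>x::'a. - x) \<in> borel_measurable borel"
  "(\<lambda>x::'a. g - x) \<in> borel_measurable borel" "(\<lambda>x::'a. - x + g) \<in> borel_measurable borel"
  by (intro borel_measurable_continuous_onI continuous_intros)+

lemma emeasure_left:
  assumes "A \<in> sets borel" shows "emeasure \<mu> {x. g + x \<in> A} = emeasure \<mu> A"
proof -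
  have "{x. g + x \<in> A} = (\<lambda>x. - g + x) ` A"
    by (auto simp: image_iff intro!: bexI[of _ "g + x" for x] simp flip: add.assoc)
  then show ?thesis using haar assms unfolding haar_measure_def left_invariant_def by simp
qed

lemma emeasure_right:
  assumes "A \<in> sets borel" shows "emeasure \<mu> {x. x + g \<in> A} = emeasure \<mu> A"
proof -
  have "{x. x + g \<in> A} = (\<lambda>x. x + - g) ` A"
    by (auto simp: image_iff add.assoc intro!: bexI[of _ "x + g" for x])
  moreover have "emeasure \<mu> ((\<lambda>x. x + - g) ` A) = emeasure \<mu> A"
    using right_inv assms unfolding right_invariant_def by (metis sets_mu)
  ultimately show ?thesis by metis
qed

lemma emeasure_right_minus:
  assumes "A \<in> sets borel" shows "emeasure \<mu> {x. x - g \<in> A} = emeasure \<mu> A"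
  using emeasure_right[OF assms, of "- g"] by simp

lemma outer_open:
  assumes "A \<in> sets borel" "emeasure \<mu> A < c"
  obtains U where "open U" "A \<subseteq> U" "emeasure \<mu> U < c"
  using assms(2) unfolding radon_measureD(4)[OF radon assms(1)] Inf_less_iff by auto

lemma inner_compact:
  assumes "open U" "c < emeasure \<mu> U"
  obtains K where "compact K" "K \<subseteq> U" "c < emeasure \<mu> K"
  using assms(2) unfolding radon_measureD(5)[OF radon assms(1)] less_SUP_iff by auto

lemma open_pos_finite:
  obtains P where "open P" "0 < emeasure \<mu> P" "emeasure \<mu> P < \<infinity>"
proof -
  have "0 < emeasure \<mu> UNIV" using haar unfolding haar_measure_def by (simp add: zero_less_iff_neq_zero)
  then obtain K where K: "compact K" "0 < emeasure \<mu> K" by (metis inner_compact open_UNIV)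
  have Ks: "K \<in> sets borel" using K(1) by (rule borel_compact)
  obtain U where "open U" "K \<subseteq> U" "emeasure \<mu> U < \<infinity>"
    by (rule outer_open[OF Ks radon_measureD(3)[OF radon K(1)]])
  moreover have "emeasure \<mu> K \<le> emeasure \<mu> U" using calculation by (intro emeasure_mono) auto
  ultimately show ?thesis using K that[of U] by (auto intro: less_le_trans)
qed

text \<open>The pairs \<open>(h, x)\<close> with \<open>h \<in> P\<close> and
  \<open>h - x \<in> Q\<close> are measured by slices in either order. With \<open>h\<close> fixed,
  right invariance gives the measure of the inverse of \<open>Q\<close>; with \<open>x\<close>
  fixed, the substitution \<open>h = q + x\<close> leads to slices that left invariance measures by
  \<open>P\<close>. The factor \<open>emeasure \<mu> P\<close> cancels.\<close>

lemma emeasure_uminus_open: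
  assumes Q: "open Q" shows "emeasure \<mu> {x. - x \<in> Q} = emeasure \<mu> Q"
proof -
  obtain P where P: "open P" "0 < emeasure \<mu> P" "emeasure \<mu> P < \<infinity>" by (rule open_pos_finite)
  have [measurable]: "P \<in> sets borel" "Q \<in> sets borel" using P Q by auto
  have Qm: "{x. - x \<in> Q} \<in> sets borel" by measurable
  have "open ((\<lambda>p. snd p) -` P \<inter> (\<lambda>p. snd p - fst p) -` Q)"
    using P Q by (intro open_Int open_vimage continuous_intros)
  then have 1: "open {p. snd p \<in> P \<and> snd p - fst p \<in> Q}" by (simp add: vimage_def Int_def)
  have "open ((\<lambda>p. snd p) -` Q \<inter> (\<lambda>p. snd p + fst p) -` P)"
    using P Q by (intro open_Int open_vimage continuous_intros)
  then have 2: "open {p. snd p \<in> Q \<and> snd p + fst p \<in> P}" by (simp add: vimage_def Int_def)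
  have "{x. h - x \<in> Q} = {x. x - h \<in> {x. - x \<in> Q}}" for h by simp
  then have hx: "emeasure \<mu> {x. h - x \<in> Q} = emeasure \<mu> {x. - x \<in> Q}" for h
    using emeasure_right_minus[OF Qm, of h] by simp
  have "emeasure \<mu> {x. - x \<in> Q} * emeasure \<mu> P = (\<integral>\<^sup>+h. emeasure \<mu> {x. - x \<in> Q} * indicator P h \<partial>\<mu>)"
    by (intro nn_integral_cmult_indicator[symmetric]) auto
  also have "\<dots> = (\<integral>\<^sup>+h. emeasure \<mu> {x. h \<in> P \<and> h - x \<in> Q} \<partial>\<mu>)"
    by (intro nn_integral_cong) (auto simp: indicator_def hx)
  also have "\<dots> = (\<integral>\<^sup>+x. emeasure \<mu> {h. h \<in> P \<and> h - x \<in> Q} \<partial>\<mu>)"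
    using radon_tonelli_open[OF radon 1] by simp
  also have "\<dots> = (\<integral>\<^sup>+x. emeasure \<mu> {q. q \<in> Q \<and> q + x \<in> P} \<partial>\<mu>)"
  proof (intro nn_integral_cong)
    fix x
    have "{h. h \<in> P \<and> h - x \<in> Q} \<in> sets borel" by measurable
    from emeasure_right[OF this, of x]
    show "emeasure \<mu> {h. h \<in> P \<and> h - x \<in> Q} = emeasure \<mu> {q. q \<in> Q \<and> q + x \<in> P}"
      by (simp add: conj_commute)
  qed
  also have "\<dots> = (\<integral>\<^sup>+q. emeasure \<mu> {x. q \<in> Q \<and> q + x \<in> P} \<partial>\<mu>)"
    using radon_tonelli_open[OF radon 2] by simp
  also have "\<dots> = (\<integral>\<^sup>+q. emeasure \<mu> P * indicator Q q \<partial>\<mu>)"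
    by (intro nn_integral_cong) (auto simp: indicator_def emeasure_left)
  also have "\<dots> = emeasure \<mu> P * emeasure \<mu> Q"
    by (intro nn_integral_cmult_indicator) auto
  finally show ?thesis using P by (auto simp: mult.commute ennreal_mult_cancel_left)
qed

text \<open>Outer regularity gives one inequality for every Borel set; applied to the inverse set it
  gives the other.\<close>

lemma emeasure_uminus:
  assumes A: "A \<in> sets borel" shows "emeasure \<mu> {x. - x \<in> A} = emeasure \<mu> A"
proof -
  have *: "emeasure \<mu> {x. - x \<in> A} \<le> emeasure \<mu> A" if A[measurable]: "A \<in> sets borel" for A
  proof (rule ccontr)
    assume "\<not> ?thesis"
    then have "emeasure \<mu> A < emeasure \<mu> {x. - x \<in> A}" by simp
    from outer_open[OF A this] obtain U where U: "open U" "A \<subseteq> U" "emeasure \<mu> U < emeasure \<mu> {x. - x \<in> A}" .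
    have [measurable]: "U \<in> sets borel" using U by simp
    have "{x. - x \<in> U} \<in> sets \<mu>" by measurable
    then have "emeasure \<mu> {x. - x \<in> A} \<le> emeasure \<mu> {x. - x \<in> U}"
      using U by (intro emeasure_mono) auto
    with U emeasure_uminus_open[OF U(1)] show False by simp
  qed
  have "{x. - x \<in> A} \<in> sets borel" using A by measurable
  from *[OF this] *[OF A] show ?thesis by simp
qed

section \<open>Sets of finite measure and the continuity of translation\<close>

abbreviation vol :: "'a set \<Rightarrow> real" where "vol \<equiv> measure \<mu>"

abbreviation fin :: "'a set \<Rightarrow> bool" where "fin A \<equiv> A \<in> fmeasurable \<mu>"

lemma finD: "fin A \<Longrightarrow> A \<in> sets borel" "fin A \<Longrightarrow> emeasure \<mu> A < \<infinity>"
  "fin A \<Longrightarrow> emeasure \<mu> A = ennreal (vol A)"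
  by (auto simp: fmeasurable_def intro!: emeasure_eq_ennreal_measure)

lemma fin_left: "fin A \<Longrightarrow> fin {x. g + x \<in> A}"
  and fin_right: "fin A \<Longrightarrow> fin {x. x - g \<in> A}"
  and fin_uminus: "fin A \<Longrightarrow> fin {x. - x \<in> A}"
  by (auto simp: fmeasurable_def emeasure_left emeasure_right_minus emeasure_uminus)

lemma measure_left: "A \<in> sets borel \<Longrightarrow> vol {x. g + x \<in> A} = vol A"
  and measure_right: "A \<in> sets borel \<Longrightarrow> vol {x. x - g \<in> A} = vol A"
  and measure_uminus: "A \<in> sets borel \<Longrightarrow> vol {x. - x \<in> A} = vol A"
  by (simp_all add: measure_def emeasure_left emeasure_right_minus emeasure_uminus)

lemma fin_subset: "fin A \<Longrightarrow> B \<in> sets borel \<Longrightarrow> B \<subseteq> A \<Longrightarrow> fin B"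
  using fmeasurableI2[of A \<mu> B] by simp

lemma outer_open_fin:
  assumes "fin A" "0 < e"
  obtains U where "open U" "A \<subseteq> U" "fin U" "vol U < vol A + e"
proof -
  have "emeasure \<mu> A < ennreal (vol A + e)"
    using assms by (simp add: finD(3) ennreal_less_iff)
  from outer_open[OF finD(1)[OF assms(1)] this]
  obtain U where U: "open U" "A \<subseteq> U" "emeasure \<mu> U < ennreal (vol A + e)" .
  then have "fin U" by (auto simp: fmeasurable_def intro: less_trans)
  with U show ?thesis using that by (simp add: finD(3) ennreal_less_iff)
qed

lemma inner_compact_fin:
  assumes "open U" "fin U" "0 < e"
  obtains K where "compact K" "K \<subseteq> U" "fin K" "vol U - e < vol K"
proof (cases "vol U = 0")
  case True
  with assms(3) show ?thesis using that[of "{}"] by simp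
next
  case False
  then have "0 < vol U" using measure_nonneg[of \<mu> U] by linarith
  then have "ennreal (vol U - e) < emeasure \<mu> U"
    using assms by (simp add: finD(3) ennreal_lessI)
  from inner_compact[OF assms(1) this]
  obtain K where K: "compact K" "K \<subseteq> U" "ennreal (vol U - e) < emeasure \<mu> K" .
  have "fin K" using K assms fin_subset[OF assms(2) borel_compact[OF K(1)]] by simp
  with K show ?thesis using that[of K] by (auto simp: finD(3) ennreal_less_iff not_le[symmetric] ennreal_le_iff2)
qed

text \<open>Inner regularity holds for open sets only, so the compact set \<open>K\<close>
  approximates an open superset \<open>U\<close> of \<open>A\<close>, not \<open>A\<close> itself.
  For small \<open>w\<close> the translate \<open>K + w\<close> stays in \<open>U\<close>. The
  points of \<open>A\<close> lost by translation lie in \<open>U - (K + w)\<close> or in the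
  translate of \<open>K - A\<close>, and both have measure below \<open>e / 2\<close>.\<close>

lemma right_translation_small:
  assumes A: "fin A" and e: "0 < e"
  obtains W where "open W" "0 \<in> W" "\<And>w. w \<in> W \<Longrightarrow> vol {x\<in>A. x - w \<notin> A} < e"
proof -
  obtain U where U: "open U" "A \<subseteq> U" "fin U" "vol U < vol A + e / 2"
    by (rule outer_open_fin[OF A half_gt_zero[OF e]])
  obtain K where K: "compact K" "K \<subseteq> U" "fin K" "vol U - e / 2 < vol K"
    by (rule inner_compact_fin[OF U(1,3) half_gt_zero[OF e]])
  have "open ((\<lambda>p::'a\<times>'a. snd p + fst p) -` U)"
    using U by (intro open_vimage continuous_intros)
  moreover have "{0} \<times> K \<subseteq> (\<lambda>p. snd p + fst p) -` U" using K by auto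
  ultimately have "\<exists>W. 0 \<in> W \<and> open W \<and> W \<times> K \<subseteq> (\<lambda>p. snd p + fst p) -` U"
    by (rule Elementary_Topology.tube_lemma[OF K(1)])
  then obtain W where W: "0 \<in> W" "open W" "W \<times> K \<subseteq> (\<lambda>p. snd p + fst p) -` U" by metis
  note [measurable] = finD(1)[OF A] finD(1)[OF U(3)] finD(1)[OF K(3)]
  have "vol {x\<in>A. x - w \<notin> A} < e" if w: "w \<in> W" for w
  proof -
    have sub: "{x. x - w \<in> K} \<subseteq> U"
    proof
      fix x assume "x \<in> {x. x - w \<in> K}"
      then have "(w, x - w) \<in> W \<times> K" using w by simp
      with W(3) show "x \<in> U" by (auto dest!: subsetD)
    qed
    have f1: "fin (U - {x. x - w \<in> K})" and f2: "fin {x. x - w \<in> K - A}"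
      using U K A fin_right[of "K - A" w] fin_right[of K w] by (auto intro: fmeasurable.Diff)
    have "vol {x\<in>A. x - w \<notin> A} \<le> vol ((U - {x. x - w \<in> K}) \<union> {x. x - w \<in> K - A})"
      using U(2) f1 f2 by (intro measure_mono_fmeasurable fmeasurable.Un) auto
    also have "\<dots> \<le> vol (U - {x. x - w \<in> K}) + vol {x. x - w \<in> K - A}"
      using f1 f2 by (intro measure_Un_le) auto
    also have "vol (U - {x. x - w \<in> K}) = vol U - vol K"
      using measure_Diff[of \<mu> U "{x. x - w \<in> K}"] sub U finD(1)[OF fin_right[OF K(3)]]
      by (simp add: measure_right fmeasurable_def)
    also have "vol {x. x - w \<in> K - A} = vol (K - A)"
      by (rule measure_right) simp
    also have "vol (K - A) \<le> vol (U - A)"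
      using K U A by (intro measure_mono_fmeasurable fmeasurable.Diff) auto
    also have "vol (U - A) = vol U - vol A"
      using measure_Diff[of \<mu> U A] U A by (simp add: fmeasurable_def)
    finally show ?thesis using U K by linarith
  qed
  with W that show ?thesis by blast
qed

lemma left_translation_small:
  assumes A: "fin A" and e: "0 < e"
  obtains W where "open W" "0 \<in> W" "\<And>w. w \<in> W \<Longrightarrow> vol {x\<in>A. w + x \<notin> A} < e"
proof -
  obtain W where W: "open W" "0 \<in> W" "\<And>w. w \<in> W \<Longrightarrow> vol {x\<in>{x. - x \<in> A}. x - w \<notin> {x. - x \<in> A}} < e"
    using right_translation_small[OF fin_uminus[OF A] e] by blast
  note [measurable] = finD(1)[OF A]
  have "vol {x\<in>A. w + x \<notin> A} < e" if "w \<in> W" for w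
  proof -
    have "{x\<in>A. w + x \<notin> A} \<in> sets borel" by measurable
    from measure_uminus[OF this] W(3)[OF that] show ?thesis by simp
  qed
  with W that show ?thesis by blast
qed

text \<open>The convolution of the indicator functions of \<open>A\<close> and \<open>B\<close>.\<close>

definition overlap :: "'a set \<Rightarrow> 'a set \<Rightarrow> 'a \<Rightarrow> real" where
  "overlap A B g = vol {h\<in>A. - h + g \<in> B}"

lemma overlap_set [measurable]:
  fixes A B :: "'a set"
  assumes [measurable]: "A \<in> sets borel" "B \<in> sets borel"
  shows "{h\<in>A. - h + g \<in> B} \<in> sets borel"
  by measurable

lemma fin_overlap: "fin A \<Longrightarrow> fin B \<Longrightarrow> fin {h\<in>A. - h + g \<in> B}"
  by (rule fin_subset[of A]) (auto intro!: overlap_set finD)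

lemma overlap_nonneg [simp]: "0 \<le> overlap A B g"
  unfolding overlap_def by simp

lemma overlap_le1: "fin A \<Longrightarrow> fin B \<Longrightarrow> overlap A B g \<le> vol A"
  unfolding overlap_def by (intro measure_mono_fmeasurable) (auto intro!: overlap_set finD)

lemma measure_reflect: "B \<in> sets borel \<Longrightarrow> vol {h. - h + g \<in> B} = vol B"
  and fin_reflect: "fin B \<Longrightarrow> fin {h. - h + g \<in> B}"
proof -
  have *: "{h. - h + g \<in> B} = {h. - g + h \<in> {x. - x \<in> B}}" by (simp add: minus_add)
  show "B \<in> sets borel \<Longrightarrow> vol {h. - h + g \<in> B} = vol B"
    unfolding * by (subst measure_left) (auto simp: measure_uminus)
  show "fin B \<Longrightarrow> fin {h. - h + g \<in> B}"
    unfolding * by (intro fin_left fin_uminus)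
qed

lemma overlap_le2: "fin A \<Longrightarrow> fin B \<Longrightarrow> overlap A B g \<le> vol B"
  unfolding overlap_def measure_reflect[OF finD(1), of B g, symmetric]
  by (intro measure_mono_fmeasurable fin_reflect) (auto intro!: overlap_set finD)

lemma overlap_mono:
  "fin A' \<Longrightarrow> fin B' \<Longrightarrow> A \<in> sets borel \<Longrightarrow> B \<in> sets borel \<Longrightarrow> A \<subseteq> A' \<Longrightarrow> B \<subseteq> B' \<Longrightarrow>
    overlap A B g \<le> overlap A' B' g"
  unfolding overlap_def by (intro measure_mono_fmeasurable fin_overlap) auto

text \<open>Semicontinuity supplies Borel measurability of the overlap, in place of Tonelli's
  theorem. Passing from \<open>g0\<close> to \<open>g\<close> amounts to a left translation of the
  inverse of \<open>B\<close> by the element \<open>- g + g0\<close>, which is close to 0.\<close>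

lemma open_overlap_greater:
  assumes A: "fin A" and B: "fin B"
  shows "open {g. s < overlap A B g}"
proof (subst open_subopen, safe)
  fix g0 assume s: "s < overlap A B g0"
  let ?D = "{x. - x \<in> B}"
  note [measurable] = finD(1)[OF A] finD(1)[OF B]
  have D: "fin ?D" by (rule fin_uminus[OF B])
  obtain W where W: "open W" "0 \<in> W" "\<And>w. w \<in> W \<Longrightarrow> vol {x\<in>?D. w + x \<notin> ?D} < overlap A B g0 - s"
    by (rule left_translation_small[OF D, of "overlap A B g0 - s"]) (use s in auto)
  let ?T = "(\<lambda>g. - g + g0) -` W"
  have "open ?T" using W by (intro open_vimage continuous_intros)
  moreover have "g0 \<in> ?T" using W by simp
  moreover have "s < overlap A B g" if g: "g \<in> ?T" for g
  proof -
    have Dg: "- h + g \<in> B \<longleftrightarrow> - g + h \<in> ?D" for h g by (simp add: minus_add)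
    let ?E = "{y\<in>?D. (- g + g0) + y \<notin> ?D}"
    have Em: "?E \<in> sets borel" by measurable
    have fE: "fin ?E" by (rule fin_subset[OF D Em]) auto
    have "overlap A B g0 \<le> vol ({h\<in>A. - h + g \<in> B} \<union> {h. - g0 + h \<in> ?E})"
      unfolding overlap_def Dg
      by (intro measure_mono_fmeasurable fmeasurable.Un fin_overlap[unfolded Dg] fin_left fE A B fin_overlap[of A B g, OF A B, unfolded Dg])
        (auto simp: add.assoc)
    also have "\<dots> \<le> overlap A B g + vol {h. - g0 + h \<in> ?E}"
      unfolding overlap_def using finD(1)[OF fin_left[OF fE]] by (intro measure_Un_le) auto
    also have "vol {h. - g0 + h \<in> ?E} = vol ?E" by (rule measure_left[OF Em])
    also have "\<dots> < overlap A B g0 - s" using W(3)[of "- g + g0"] g by auto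
    finally show ?thesis by simp
  qed
  ultimately show "\<exists>T. open T \<and> g0 \<in> T \<and> T \<subseteq> {g. s < overlap A B g}" by (intro exI[of _ ?T]) auto
qed

lemma overlap_measurable [measurable]:
  "fin A \<Longrightarrow> fin B \<Longrightarrow> overlap A B \<in> borel_measurable borel"
  by (rule borel_measurableI_greater) (auto intro: borel_open open_overlap_greater)

lemma nn_integral_overlap_open:
  assumes P: "open P" "fin P" and Q: "open Q" "fin Q"
  shows "(\<integral>\<^sup>+g. ennreal (overlap P Q g) \<partial>\<mu>) = ennreal (vol P * vol Q)"
proof -
  note [measurable] = finD(1)[OF P(2)] finD(1)[OF Q(2)]
  have "open ((\<lambda>p. snd p) -` P \<inter> (\<lambda>p. - snd p + fst p) -` Q)"
    using P Q by (intro open_Int open_vimage continuous_intros)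
  then have 1: "open {p. snd p \<in> P \<and> - snd p + fst p \<in> Q}" by (simp add: vimage_def Int_def)
  have "(\<integral>\<^sup>+g. ennreal (overlap P Q g) \<partial>\<mu>) = (\<integral>\<^sup>+x. emeasure \<mu> {h. h \<in> P \<and> - h + x \<in> Q} \<partial>\<mu>)"
    unfolding overlap_def by (intro nn_integral_cong finD(3)[symmetric] fin_overlap P Q)
  also have "\<dots> = (\<integral>\<^sup>+h. emeasure \<mu> {x. h \<in> P \<and> - h + x \<in> Q} \<partial>\<mu>)"
    using radon_tonelli_open[OF radon 1] by simp
  also have "\<dots> = (\<integral>\<^sup>+q. emeasure \<mu> Q * indicator P q \<partial>\<mu>)"
    by (intro nn_integral_cong) (auto simp: indicator_def emeasure_left)
  also have "\<dots> = emeasure \<mu> Q * emeasure \<mu> P"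
    by (intro nn_integral_cmult_indicator) auto
  finally show ?thesis by (simp add: finD(3) P Q ennreal_mult mult.commute)
qed

lemma nn_integral_overlap_le:
  assumes A: "fin A" and B: "fin B"
  shows "(\<integral>\<^sup>+g. ennreal (overlap A B g) \<partial>\<mu>) \<le> ennreal (vol A * vol B)"
proof (rule ennreal_le_mult_epsilon)
  fix e :: real assume e: "0 < e"
  obtain P where P: "open P" "A \<subseteq> P" "fin P" "vol P < vol A + e"
    using outer_open_fin[OF A e] .
  obtain Q where Q: "open Q" "B \<subseteq> Q" "fin Q" "vol Q < vol B + e"
    using outer_open_fin[OF B e] .
  have "(\<integral>\<^sup>+g. ennreal (overlap A B g) \<partial>\<mu>) \<le> (\<integral>\<^sup>+g. ennreal (overlap P Q g) \<partial>\<mu>)"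
    using P Q finD[OF A] finD[OF B] by (intro nn_integral_mono ennreal_leI overlap_mono) auto
  also have "\<dots> = ennreal (vol P * vol Q)"
    using P Q by (intro nn_integral_overlap_open) auto
  also have "\<dots> \<le> ennreal ((vol A + e) * (vol B + e))"
    using P Q e by (intro ennreal_leI mult_mono) auto
  finally show "(\<integral>\<^sup>+g. ennreal (overlap A B g) \<partial>\<mu>) \<le> ennreal ((vol A + e) * (vol B + e))" .
qed

lemma overlap_split:
  assumes "fin A" "fin A'" "fin B" "fin B'"
  shows "overlap (A \<union> A') (B \<union> B') g \<le> overlap A B g + overlap A' (B \<union> B') g + overlap A B' g"
proof -
  note [measurable] = assms[THEN finD(1)]
  have "overlap (A \<union> A') (B \<union> B') g \<le>
      vol ({h\<in>A. - h + g \<in> B} \<union> {h\<in>A'. - h + g \<in> B \<union> B'} \<union> {h\<in>A. - h + g \<in> B'})"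
    unfolding overlap_def using assms
    by (intro measure_mono_fmeasurable fmeasurable.Un fin_overlap) auto
  also have "\<dots> \<le> vol ({h\<in>A. - h + g \<in> B} \<union> {h\<in>A'. - h + g \<in> B \<union> B'}) + vol {h\<in>A. - h + g \<in> B'}"
    by (intro measure_Un_le) auto
  also have "vol ({h\<in>A. - h + g \<in> B} \<union> {h\<in>A'. - h + g \<in> B \<union> B'})
     \<le> vol {h\<in>A. - h + g \<in> B} + vol {h\<in>A'. - h + g \<in> B \<union> B'}"
    by (intro measure_Un_le) auto
  finally show ?thesis unfolding overlap_def by simp
qed

text \<open>For the lower bound the sets are enlarged to open sets \<open>P\<close> and
  \<open>Q\<close>, where the integrals can be exchanged. The surplus consists of overlaps involving
  \<open>P - A\<close> and \<open>Q - B\<close>, and the upper bound makes their integrals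
  small.\<close>

lemma nn_integral_overlap:
  assumes A: "fin A" and B: "fin B"
  shows "(\<integral>\<^sup>+g. ennreal (overlap A B g) \<partial>\<mu>) = ennreal (vol A * vol B)"
proof (rule antisym[OF nn_integral_overlap_le[OF A B]])
  let ?a = "vol A" and ?b = "vol B"
  have I: "(\<integral>\<^sup>+g. ennreal (overlap A B g) \<partial>\<mu>) < \<infinity>"
    using nn_integral_overlap_le[OF A B] by (rule le_less_trans) simp
  then obtain I where I: "0 \<le> I" "(\<integral>\<^sup>+g. ennreal (overlap A B g) \<partial>\<mu>) = ennreal I"
    by (cases "\<integral>\<^sup>+g. ennreal (overlap A B g) \<partial>\<mu>") auto
  have bound: "?a * ?b \<le> I + e * (?a + ?b + e)" if e: "0 < e" for e
  proof -
    obtain P where P: "open P" "A \<subseteq> P" "fin P" "vol P < vol A + e"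
      using outer_open_fin[OF A e] .
    obtain Q where Q: "open Q" "B \<subseteq> Q" "fin Q" "vol Q < vol B + e"
      using outer_open_fin[OF B e] .
    have fA': "fin (P - A)" and fB': "fin (Q - B)" using P Q A B by auto
    note [measurable] = overlap_measurable[OF A B] overlap_measurable[OF fA' Q(3)] overlap_measurable[OF A fB']
    have mA': "vol (P - A) \<le> e" and mB': "vol (Q - B) \<le> e"
      using measure_Diff[of \<mu> P A] measure_Diff[of \<mu> Q B] P Q A B by (auto simp: fmeasurable_def)
    have "ennreal (?a * ?b) \<le> ennreal (vol P * vol Q)"
      using P Q A B by (intro ennreal_leI mult_mono measure_mono_fmeasurable) auto
    also have "\<dots> = (\<integral>\<^sup>+g. ennreal (overlap P Q g) \<partial>\<mu>)"
      using P Q by (intro nn_integral_overlap_open[symmetric]) auto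
    also have "\<dots> \<le> (\<integral>\<^sup>+g. ennreal (overlap A B g) + ennreal (overlap (P - A) Q g) + ennreal (overlap A (Q - B) g) \<partial>\<mu>)"
    proof (intro nn_integral_mono)
      fix g
      have "A \<union> (P - A) = P" "B \<union> (Q - B) = Q" using P Q by auto
      then show "ennreal (overlap P Q g) \<le> ennreal (overlap A B g) + ennreal (overlap (P - A) Q g) + ennreal (overlap A (Q - B) g)"
        using overlap_split[OF A fA' B fB', of g] by (simp flip: ennreal_plus add: ennreal_leI)
    qed
    also have "\<dots> = (\<integral>\<^sup>+g. ennreal (overlap A B g) \<partial>\<mu>) + (\<integral>\<^sup>+g. ennreal (overlap (P - A) Q g) \<partial>\<mu>) + (\<integral>\<^sup>+g. ennreal (overlap A (Q - B) g) \<partial>\<mu>)"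
      by (subst nn_integral_add nn_integral_add; measurable)+ 
    also have "\<dots> \<le> ennreal I + ennreal (vol (P - A) * vol Q) + ennreal (?a * vol (Q - B))"
      unfolding I(2) by (intro add_mono nn_integral_overlap_le order_refl fA' fB' A Q)
    also have "\<dots> \<le> ennreal I + ennreal (e * (?b + e)) + ennreal (?a * e)"
      using mA' mB' Q e by (intro add_mono ennreal_leI mult_mono) auto
    also have "\<dots> = ennreal (I + e * (?b + e) + ?a * e)" using I e by (simp flip: ennreal_plus)
    finally have "?a * ?b \<le> I + e * (?b + e) + ?a * e"
      using I(1) e by (subst (asm) ennreal_le_iff) auto
    then show ?thesis by (simp add: algebra_simps)
  qed
  \<comment> \<open>Restricting to \<open>e < 1\<close> makes the error linear in
    \<open>e\<close>.\<close>
  have "?a * ?b \<le> I + e * (?a + ?b + 1)" if "0 < e" "e < 1" for e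
    by (rule order_trans[OF bound[OF that(1)]]) (use that in \<open>auto intro!: mult_left_mono\<close>)
  then have "?a * ?b \<le> I" by (rule real_le_mult_epsilon)
  then show "ennreal (?a * ?b) \<le> (\<integral>\<^sup>+g. ennreal (overlap A B g) \<partial>\<mu>)"
    unfolding I(2) by (simp add: ennreal_leI)
qed

lemma overlap_integrable: "fin A \<Longrightarrow> fin B \<Longrightarrow> integrable \<mu> (overlap A B)"
  by (rule integrableI_nn_integral_finite[where x="vol A * vol B"])
    (auto simp: nn_integral_overlap)

lemma overlap_integral: "fin A \<Longrightarrow> fin B \<Longrightarrow> integral\<^sup>L \<mu> (overlap A B) = vol A * vol B"
  by (subst integral_eq_nn_integral) (auto simp: nn_integral_overlap)

end

section \<open>Uncrossing\<close>

lemma integral_add_mono: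
  fixes f1 f2 f3 f4 f5 f6 :: "'a \<Rightarrow> real"
  assumes i: "integrable M f1" "integrable M f2" "integrable M f3" "integrable M f4"
      "integrable M f5" "integrable M f6"
    and le: "\<And>h. f1 h + f2 h \<le> f3 h + f4 h + f5 h + f6 h"
  shows "integral\<^sup>L M f1 + integral\<^sup>L M f2 \<le>
      integral\<^sup>L M f3 + integral\<^sup>L M f4 + integral\<^sup>L M f5 + integral\<^sup>L M f6"
proof -
  have "(\<integral>h. f1 h + f2 h \<partial>M) \<le> (\<integral>h. f3 h + f4 h + f5 h + f6 h \<partial>M)"
    using i le by (intro integral_mono Bochner_Integration.integrable_add)
  then show ?thesis using i by simp
qed

context unimodular_haar
begin

section \<open>The part of a set that a translation moves away\<close>

definition right_defect :: "'a set \<Rightarrow> 'a \<Rightarrow> real" where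
  "right_defect A g = vol {x\<in>A. x - g \<notin> A}"

definition left_defect :: "'a set \<Rightarrow> 'a \<Rightarrow> real" where
  "left_defect B g = vol {x\<in>B. g + x \<notin> B}"

lemma fin_right_parts:
  assumes "fin A"
  shows "fin {x\<in>A. x - g \<notin> A}" "fin {x\<in>A. x - g \<in> A}" "fin {x. x - g \<in> A \<and> x \<notin> A}"
    "fin (A \<union> {x. x - g \<in> A})"
proof -
  note [measurable] = finD(1)[OF assms]
  show "fin {x\<in>A. x - g \<notin> A}" by (rule fin_subset[OF assms]) auto
  show "fin {x\<in>A. x - g \<in> A}" by (rule fin_subset[OF assms]) auto
  show "fin {x. x - g \<in> A \<and> x \<notin> A}" by (rule fin_subset[OF fin_right[OF assms, of g]]) auto
  show "fin (A \<union> {x. x - g \<in> A})" using assms by (intro fmeasurable.Un fin_right)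
qed

lemma measure_disjoint_Un:
  "fin A \<Longrightarrow> fin B \<Longrightarrow> A \<inter> B = {} \<Longrightarrow> vol (A \<union> B) = vol A + vol B"
  by (intro measure_Union) (auto simp: fmeasurable_def)

lemma right_defect_eq:
  assumes "fin A"
  shows "vol {x\<in>A. x - g \<in> A} = vol A - right_defect A g"
proof -
  have "vol ({x\<in>A. x - g \<in> A} \<union> {x\<in>A. x - g \<notin> A}) = vol {x\<in>A. x - g \<in> A} + vol {x\<in>A. x - g \<notin> A}"
    by (intro measure_disjoint_Un fin_right_parts assms) auto
  moreover have "{x\<in>A. x - g \<in> A} \<union> {x\<in>A. x - g \<notin> A} = A" by auto
  ultimately show ?thesis unfolding right_defect_def by simp
qed

lemma right_defect_eq':
  assumes "fin A"
  shows "vol {x. x - g \<in> A \<and> x \<notin> A} = right_defect A g"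
    "vol (A \<union> {x. x - g \<in> A}) = vol A + right_defect A g"
proof -
  note [measurable] = finD(1)[OF assms]
  have "vol ({x\<in>A. x - g \<in> A} \<union> {x. x - g \<in> A \<and> x \<notin> A}) =
      vol {x\<in>A. x - g \<in> A} + vol {x. x - g \<in> A \<and> x \<notin> A}"
    by (intro measure_disjoint_Un fin_right_parts assms) auto
  moreover have "{x\<in>A. x - g \<in> A} \<union> {x. x - g \<in> A \<and> x \<notin> A} = {x. x - g \<in> A}" by auto
  ultimately show 1: "vol {x. x - g \<in> A \<and> x \<notin> A} = right_defect A g"
    using right_defect_eq[OF assms, of g] measure_right[of A g] by simp
  have "vol (A \<union> {x. x - g \<in> A \<and> x \<notin> A}) = vol A + vol {x. x - g \<in> A \<and> x \<notin> A}"
    by (intro measure_disjoint_Un fin_right_parts assms) auto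
  moreover have "A \<union> {x. x - g \<in> A \<and> x \<notin> A} = A \<union> {x. x - g \<in> A}" by auto
  ultimately show "vol (A \<union> {x. x - g \<in> A}) = vol A + right_defect A g"
    using 1 by simp
qed

text \<open>A triangle inequality: by invariance the defect is half the measure of the symmetric
  difference of \<open>A\<close> and \<open>A + g\<close>.\<close>

lemma right_defect_add:
  assumes "fin A"
  shows "right_defect A (g + h) \<le> right_defect A g + right_defect A h"
proof -
  note [measurable] = finD(1)[OF assms]
  have *: "x - (g + h) = x - h - g" for x :: 'a by (simp add: diff_conv_add_uminus minus_add add.assoc del: add_uminus_conv_diff)
  let ?X = "{x\<in>A. x - g \<notin> A}"
  have X: "?X \<in> sets borel" by measurable
  have "right_defect A (g + h) \<le> vol ({x. x - h \<in> ?X} \<union> {x\<in>A. x - h \<notin> A})"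
    unfolding right_defect_def *
    by (intro measure_mono_fmeasurable fmeasurable.Un fin_right fin_right_parts assms) auto
  also have "\<dots> \<le> vol {x. x - h \<in> ?X} + vol {x\<in>A. x - h \<notin> A}"
    by (intro measure_Un_le) auto
  finally show ?thesis unfolding right_defect_def measure_right[OF X] .
qed

lemma right_defect_uminus:
  assumes "fin A"
  shows "right_defect A (- g) = right_defect A g"
proof -
  note [measurable] = finD(1)[OF assms]
  let ?X = "{x\<in>A. x - - g \<in> A}"
  have X: "?X \<in> sets borel" by measurable
  have "vol ?X = vol {x. x - g \<in> ?X}" by (rule measure_right[OF X, symmetric])
  also have "{x. x - g \<in> ?X} = {x\<in>A. x - g \<in> A}" by auto
  finally show ?thesis
    unfolding right_defect_eq[OF assms] by simp
qed

lemma left_defect_conv: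
  assumes "fin B"
  shows "left_defect B g = right_defect {x. - x \<in> B} g"
proof -
  note [measurable] = finD(1)[OF assms]
  have "{x\<in>B. g + x \<notin> B} \<in> sets borel" by measurable
  from measure_uminus[OF this] show ?thesis unfolding left_defect_def right_defect_def by simp
qed

lemma fin_left_parts:
  assumes "fin B"
  shows "fin {x\<in>B. g + x \<notin> B}" "fin {x\<in>B. g + x \<in> B}" "fin {x. g + x \<in> B \<and> x \<notin> B}"
    "fin (B \<union> {x. g + x \<in> B})"
proof -
  note [measurable] = finD(1)[OF assms]
  show "fin {x\<in>B. g + x \<notin> B}" by (rule fin_subset[OF assms]) auto
  show "fin {x\<in>B. g + x \<in> B}" by (rule fin_subset[OF assms]) auto
  show "fin {x. g + x \<in> B \<and> x \<notin> B}" by (rule fin_subset[OF fin_left[OF assms, of g]]) auto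
  show "fin (B \<union> {x. g + x \<in> B})" using assms by (intro fmeasurable.Un fin_left)
qed

lemma left_defect_eq:
  assumes "fin B"
  shows "vol {x\<in>B. g + x \<in> B} = vol B - left_defect B g"
    "vol {x. g + x \<in> B \<and> x \<notin> B} = left_defect B g"
    "vol (B \<union> {x. g + x \<in> B}) = vol B + left_defect B g"
proof -
  note [measurable] = finD(1)[OF assms]
  have "{x\<in>B. g + x \<in> B} \<in> sets borel" "{x. g + x \<in> B \<and> x \<notin> B} \<in> sets borel"
    "B \<union> {x. g + x \<in> B} \<in> sets borel" by measurable
  note m = this[THEN measure_uminus] measure_uminus[OF finD(1)[OF assms]]
  have e: "{x. - x \<in> {x\<in>B. g + x \<in> B}} = {x\<in>{x. - x \<in> B}. x - g \<in> {x. - x \<in> B}}"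
    "{x. - x \<in> {x. g + x \<in> B \<and> x \<notin> B}} = {x. x - g \<in> {x. - x \<in> B} \<and> x \<notin> {x. - x \<in> B}}"
    "{x. - x \<in> B \<union> {x. g + x \<in> B}} = {x. - x \<in> B} \<union> {x. x - g \<in> {x. - x \<in> B}}" by auto
  show "vol {x\<in>B. g + x \<in> B} = vol B - left_defect B g"
    "vol {x. g + x \<in> B \<and> x \<notin> B} = left_defect B g"
    "vol (B \<union> {x. g + x \<in> B}) = vol B + left_defect B g"
    using m(1)[unfolded e] m(2)[unfolded e] m(3)[unfolded e] m(4)
      right_defect_eq[OF fin_uminus[OF assms], of g] right_defect_eq'[OF fin_uminus[OF assms], of g]
      left_defect_conv[OF assms, of g] by argo+
qed

lemma left_defect_add: "fin B \<Longrightarrow> left_defect B (g + h) \<le> left_defect B g + left_defect B h"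
  by (simp add: left_defect_conv right_defect_add fin_uminus)

lemma left_defect_uminus: "fin B \<Longrightarrow> left_defect B (- g) = left_defect B g"
  by (simp add: left_defect_conv right_defect_uminus fin_uminus)

lemma right_defect_nonneg [simp]: "0 \<le> right_defect A g"
  and left_defect_nonneg [simp]: "0 \<le> left_defect A g"
  unfolding right_defect_def left_defect_def by simp_all

lemma overlap_eq_integral: "fin A \<Longrightarrow> fin B \<Longrightarrow>
    overlap A B x = (\<integral>h. indicator {h\<in>A. - h + x \<in> B} h \<partial>\<mu>)"
  "fin A \<Longrightarrow> fin B \<Longrightarrow> integrable \<mu> (indicator {h\<in>A. - h + x \<in> B} :: 'a \<Rightarrow> real)"
  using fin_overlap[of A B x] finD(2)[of "{h\<in>A. - h + x \<in> B}"] unfolding overlap_def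
  by (auto simp: fmeasurable_def)

text \<open>Translating \<open>A\<close> by \<open>g\<close> on the right and \<open>B\<close> by
  \<open>- g\<close> on the left preserves the overlap. What remains is a pointwise relation between
  indicator functions at \<open>h\<close>, decided by four memberships; the two products of
  difference sets account for the pairs that union and intersection miss.\<close>

lemma overlap_uncrossing:
  assumes A: "fin A" and B: "fin B"
  shows "2 * overlap A B x \<le> overlap (A \<union> {x. x - g \<in> A}) {x\<in>B. g + x \<in> B} x
    + overlap {x\<in>A. x - g \<in> A} (B \<union> {x. g + x \<in> B}) x
    + overlap {x\<in>A. x - g \<notin> A} {x\<in>B. g + x \<notin> B} x
    + overlap {x. x - g \<in> A \<and> x \<notin> A} {x. g + x \<in> B \<and> x \<notin> B} x"
proof -
  note fA = fin_right_parts[OF A, of g] and fB = fin_left_parts[OF B, of g]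
  note [measurable] = finD(1)[OF A] finD(1)[OF B]
  have "{h\<in>A. - h + x \<in> B} \<in> sets borel" by measurable
  from measure_right[OF this, of g]
  have e: "overlap A B x = overlap {x. x - g \<in> A} {x. g + x \<in> B} x"
    unfolding overlap_def by (simp add: add.assoc diff_conv_add_uminus minus_add del: add_uminus_conv_diff)
  have "2 * overlap A B x = overlap A B x + overlap {x. x - g \<in> A} {x. g + x \<in> B} x" using e by simp
  also have "\<dots> \<le> overlap (A \<union> {x. x - g \<in> A}) {x\<in>B. g + x \<in> B} x
    + overlap {x\<in>A. x - g \<in> A} (B \<union> {x. g + x \<in> B}) x
    + overlap {x\<in>A. x - g \<notin> A} {x\<in>B. g + x \<notin> B} x
    + overlap {x. x - g \<in> A \<and> x \<notin> A} {x. g + x \<in> B \<and> x \<notin> B} x"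
  proof -
    note e = overlap_eq_integral[OF A B, of x] overlap_eq_integral(1)[OF fin_right[OF A] fin_left[OF B], of g g x]
      overlap_eq_integral(2)[OF fin_right[OF A] fin_left[OF B], of g x g]
      overlap_eq_integral[OF fA(4) fB(2), of x] overlap_eq_integral[OF fA(2) fB(4), of x]
      overlap_eq_integral[OF fA(1) fB(1), of x] overlap_eq_integral[OF fA(3) fB(3), of x]
    show ?thesis
      unfolding e(1,3,5,7,9,11)
      by (rule integral_add_mono[OF e(2,4,6,8,10,12)]) (auto simp: indicator_def)
  qed
  finally show ?thesis .
qed

section \<open>Excess of the overlap over a level\<close>

definition overlap_excess :: "real \<Rightarrow> 'a set \<Rightarrow> 'a set \<Rightarrow> real" where
  "overlap_excess t A B = (\<integral>g. max 0 (overlap A B g - t) \<partial>\<mu>)"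

lemma overlap_excess_integrable:
  assumes "fin A" "fin B" "0 \<le> t"
  shows "integrable \<mu> (\<lambda>g. max 0 (overlap A B g - t))"
proof (rule Bochner_Integration.integrable_bound[OF overlap_integrable[OF assms(1,2)]])
  show "(\<lambda>g. max 0 (overlap A B g - t)) \<in> borel_measurable \<mu>"
    using overlap_measurable[OF assms(1,2)] by measurable
  have "max 0 (overlap A B g - t) \<le> overlap A B g" for g using assms(3) by simp
  then show "AE g in \<mu>. norm (max 0 (overlap A B g - t)) \<le> norm (overlap A B g)" by simp
qed

lemma overlap_excess_nonneg [simp]: "0 \<le> overlap_excess t A B"
  unfolding overlap_excess_def by simp

lemma overlap_excess_le:
  assumes "fin A" "fin B" "0 \<le> t"
  shows "overlap_excess t A B \<le> vol A * vol B"
  unfolding overlap_excess_def overlap_integral[OF assms(1,2), symmetric]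
  using assms by (intro integral_mono overlap_excess_integrable overlap_integrable) auto

lemma overlap_excess_eq_0:
  assumes "fin A" "fin B" "vol A \<le> t \<or> vol B \<le> t"
  shows "overlap_excess t A B = 0"
proof -
  have "overlap A B g \<le> t" for g
    using overlap_le1[OF assms(1,2), of g] overlap_le2[OF assms(1,2), of g] assms(3) by linarith
  then have "(\<lambda>g. max 0 (overlap A B g - t)) = (\<lambda>g. 0)" by (simp add: max_absorb1)
  then show ?thesis unfolding overlap_excess_def by simp
qed

text \<open>The overlap never exceeds the smaller measure \<open>m\<close>, and on
  \<open>[0, m]\<close> the function \<open>max 0 (y - t)\<close> lies below its chord
  \<open>(m - t) * y / m\<close>, whose integral is known. The bound exceeds the target by
  \<open>t * (m - t)\<close>, which is negligible when \<open>m\<close> is close to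
  \<open>t\<close>.\<close>

lemma overlap_excess_le_max:
  assumes "fin A" "fin B" "0 \<le> t" "t \<le> vol A" "t \<le> vol B"
  shows "overlap_excess t A B \<le> max (vol A) (vol B) * (min (vol A) (vol B) - t)"
proof (cases "min (vol A) (vol B) = 0")
  case True
  then have "vol A \<le> t \<or> vol B \<le> t" using assms(3) by (auto simp: min_def split: if_splits)
  moreover have "t = 0" using True assms by linarith
  ultimately show ?thesis using overlap_excess_eq_0[OF assms(1,2)] True by simp
next
  case False
  define m where "m = min (vol A) (vol B)"
  have m: "0 < m" using False measure_nonneg[of \<mu> A] measure_nonneg[of \<mu> B] unfolding m_def by linarith
  have "m * overlap_excess t A B = (\<integral>g. m * max 0 (overlap A B g - t) \<partial>\<mu>)"
    unfolding overlap_excess_def by simp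
  also have "\<dots> \<le> (\<integral>g. (m - t) * overlap A B g \<partial>\<mu>)"
  proof (intro integral_mono integrable_mult_right overlap_excess_integrable overlap_integrable assms)
    fix g
    have le: "overlap A B g \<le> m"
      using overlap_le1[OF assms(1,2), of g] overlap_le2[OF assms(1,2), of g] unfolding m_def by simp
    have tm: "t \<le> m" unfolding m_def using assms by simp
    show "m * max 0 (overlap A B g - t) \<le> (m - t) * overlap A B g"
    proof (cases "overlap A B g \<le> t")
      case False
      then show ?thesis using mult_left_mono[OF le assms(3)] by (simp add: max_def algebra_simps)
    qed (use tm in \<open>auto simp: max_def\<close>)
  qed
  also have "\<dots> = (m - t) * (vol A * vol B)"
    using overlap_integral[OF assms(1,2)] by simp
  also have "vol A * vol B = m * max (vol A) (vol B)"
    unfolding m_def by (simp add: min_def max_def)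
  finally have "m * overlap_excess t A B \<le> m * (max (vol A) (vol B) * (m - t))"
    by (simp add: algebra_simps)
  then show ?thesis using m by (simp add: m_def)
qed

text \<open>The level \<open>t\<close> is subtracted from the two uncrossed pairs only; the
  difference sets enter with their full overlaps, each of integral
  \<open>right_defect A g * left_defect B g\<close>.\<close>

lemma overlap_excess_uncrossing:
  assumes A: "fin A" and B: "fin B" and t: "0 \<le> t"
  shows "2 * overlap_excess t A B \<le>
      overlap_excess t (A \<union> {x. x - g \<in> A}) {x\<in>B. g + x \<in> B}
    + overlap_excess t {x\<in>A. x - g \<in> A} (B \<union> {x. g + x \<in> B})
    + 2 * (right_defect A g * left_defect B g)"
proof -
  note fA = fin_right_parts[OF A, of g] and fB = fin_left_parts[OF B, of g]
  let ?A1 = "A \<union> {x. x - g \<in> A}" and ?B1 = "{x\<in>B. g + x \<in> B}"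
  let ?A2 = "{x\<in>A. x - g \<in> A}" and ?B2 = "B \<union> {x. g + x \<in> B}"
  let ?Q = "{x\<in>A. x - g \<notin> A}" and ?S = "{x\<in>B. g + x \<notin> B}"
  let ?Q' = "{x. x - g \<in> A \<and> x \<notin> A}" and ?S' = "{x. g + x \<in> B \<and> x \<notin> B}"
  note i = overlap_excess_integrable[OF A B t] overlap_excess_integrable[OF fA(4) fB(2) t]
    overlap_excess_integrable[OF fA(2) fB(4) t] overlap_integrable[OF fA(1) fB(1)]
    overlap_integrable[OF fA(3) fB(3)]
  have "2 * overlap_excess t A B = (\<integral>x. 2 * max 0 (overlap A B x - t) \<partial>\<mu>)"
    unfolding overlap_excess_def by simp
  also have "\<dots> \<le> (\<integral>x. max 0 (overlap ?A1 ?B1 x - t) + max 0 (overlap ?A2 ?B2 x - t)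
      + overlap ?Q ?S x + overlap ?Q' ?S' x \<partial>\<mu>)"
  proof (intro integral_mono integrable_mult_right Bochner_Integration.integrable_add i)
    fix x
    show "2 * max 0 (overlap A B x - t) \<le> max 0 (overlap ?A1 ?B1 x - t) + max 0 (overlap ?A2 ?B2 x - t)
      + overlap ?Q ?S x + overlap ?Q' ?S' x"
      using overlap_uncrossing[OF A B, of x g] overlap_nonneg[of ?Q ?S x] overlap_nonneg[of ?Q' ?S' x]
      unfolding max_def by auto
  qed
  also have "\<dots> = overlap_excess t ?A1 ?B1 + overlap_excess t ?A2 ?B2
      + vol ?Q * vol ?S + vol ?Q' * vol ?S'"
    unfolding overlap_excess_def using i overlap_integral[OF fA(1) fB(1)] overlap_integral[OF fA(3) fB(3)]
    by simp
  finally show ?thesis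
    unfolding right_defect_eq'[OF A] left_defect_eq[OF B]
    by (simp add: right_defect_def left_defect_def)
qed

text \<open>
  Otherwise the elements of \<open>V\<close> with small defects form an open subgroup, and the average overlap
  of \<open>B\<close> with its translates by that subgroup is too large.
\<close>

lemma small_translation_exists:
  assumes A: "fin A" and B: "fin B" and V: "open_subgroup V"
    and min: "\<And>N. open_subgroup N \<Longrightarrow> N \<subseteq> V \<Longrightarrow> emeasure \<mu> N = emeasure \<mu> V"
    and \<eta>: "0 < \<eta>"
    and big: "ennreal ((vol B)\<^sup>2) < ennreal (vol B - \<eta> / 2) * emeasure \<mu> V"
  shows "\<exists>g\<in>V. right_defect A g \<le> \<eta> \<and> left_defect B g \<le> \<eta> \<and>
    (\<eta> / 2 \<le> right_defect A g \<or> \<eta> / 2 \<le> left_defect B g)"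
proof (rule ccontr)
  assume "\<not> ?thesis"
  then have no: "right_defect A g < \<eta> / 2 \<and> left_defect B g < \<eta> / 2"
    if "g \<in> V" "right_defect A g \<le> \<eta>" "left_defect B g \<le> \<eta>" for g
    using that by force
  define N where "N = {g\<in>V. right_defect A g < \<eta> / 2 \<and> left_defect B g < \<eta> / 2}"
  have V': "open V" "0 \<in> V" "\<And>x y. x \<in> V \<Longrightarrow> y \<in> V \<Longrightarrow> x + y \<in> V" "\<And>x. x \<in> V \<Longrightarrow> - x \<in> V"
    using V unfolding open_subgroup_def by auto
  have N0: "0 \<in> N" unfolding N_def right_defect_def left_defect_def using V' \<eta> by simp
  \<comment> \<open>Subadditivity bounds the defects of the sum by \<open>\<eta>\<close>, and by
    assumption elements of \<open>V\<close> with both defects at most \<open>\<eta>\<close> have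
    both below \<open>\<eta> / 2\<close>.\<close>
  have Nadd: "x + y \<in> N" if "x \<in> N" "y \<in> N" for x y
  proof -
    have "x + y \<in> V" using that V' unfolding N_def by auto
    moreover have "right_defect A (x + y) \<le> \<eta>" "left_defect B (x + y) \<le> \<eta>"
      using that right_defect_add[OF A, of x y] left_defect_add[OF B, of x y] unfolding N_def by auto
    ultimately show ?thesis using no unfolding N_def by blast
  qed
  have Nneg: "- x \<in> N" if "x \<in> N" for x
    using that V' unfolding N_def by (simp add: right_defect_uminus[OF A] left_defect_uminus[OF B])
  obtain W1 :: "'a set" where W1: "open W1" "0 \<in> W1" "\<And>w. w \<in> W1 \<Longrightarrow> vol {x\<in>A. x - w \<notin> A} < \<eta> / 2"
    by (rule right_translation_small[OF A half_gt_zero[OF \<eta>]]) (rule that)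
  obtain W2 where W2: "open W2" "0 \<in> W2" "\<And>w. w \<in> W2 \<Longrightarrow> vol {x\<in>B. w + x \<notin> B} < \<eta> / 2"
    by (rule left_translation_small[OF B half_gt_zero[OF \<eta>]]) (rule that)
  have WN: "W1 \<inter> W2 \<inter> V \<subseteq> N" using W1 W2 unfolding N_def right_defect_def left_defect_def by auto
  have "open N"
  proof (subst open_subopen, safe)
    fix g assume g: "g \<in> N"
    let ?T = "(\<lambda>x. - g + x) -` (W1 \<inter> W2 \<inter> V)"
    have "open ?T" using W1 W2 V' by (intro open_vimage open_Int continuous_intros)
    moreover have "g \<in> ?T" using W1 W2 V' by simp
    moreover have "?T \<subseteq> N"
    proof
      fix x assume "x \<in> ?T"
      then have "- g + x \<in> N" using WN by auto
      from Nadd[OF g this] show "x \<in> N" by (simp flip: add.assoc)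
    qed
    ultimately show "\<exists>T. open T \<and> g \<in> T \<and> T \<subseteq> N" by blast
  qed
  then have oN: "open_subgroup N" using N0 Nadd Nneg unfolding open_subgroup_def by blast
  then have mN: "emeasure \<mu> N = emeasure \<mu> V" by (intro min) (auto simp: N_def)
  note [measurable] = finD(1)[OF B]
  have "ennreal (vol B - \<eta> / 2) * emeasure \<mu> V = (\<integral>\<^sup>+g. ennreal (vol B - \<eta> / 2) * indicator N g \<partial>\<mu>)"
    unfolding mN[symmetric] using \<open>open N\<close> by (intro nn_integral_cmult_indicator[symmetric]) auto
  also have "\<dots> \<le> (\<integral>\<^sup>+g. ennreal (overlap B {x. - x \<in> B} g) \<partial>\<mu>)"
  proof (intro nn_integral_mono)
    fix g
    show "ennreal (vol B - \<eta> / 2) * indicator N g \<le> ennreal (overlap B {x. - x \<in> B} g)"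
    proof (cases "g \<in> N")
      case True
      have "overlap B {x. - x \<in> B} g = vol {x\<in>B. - g + x \<in> B}"
        unfolding overlap_def by (simp add: minus_add)
      also have "\<dots> = vol B - left_defect B g"
        using left_defect_eq(1)[OF B, of "- g"] left_defect_uminus[OF B, of g] by simp
      finally show ?thesis using True unfolding N_def by (simp add: ennreal_leI)
    qed simp
  qed
  also have "\<dots> = ennreal (vol B * vol {x. - x \<in> B})"
    by (rule nn_integral_overlap[OF B fin_uminus[OF B]])
  also have "\<dots> = ennreal ((vol B)\<^sup>2)" using measure_uminus[of B] by (simp add: power2_eq_square)
  finally show False using big by simp
qed

end

section \<open>The excess inequality inside one coset\<close>

context unimodular_haar
begin

text \<open>
  A near-maximizer of the functional below in the interior of the domain would, after one
  uncrossing step, produce a pair exceeding the supremum, because the term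
  \<open>\<kappa> * (a\<^sup>2 + b\<^sup>2)\<close> gains at least \<open>\<kappa> * \<eta>\<^sup>2 / 4\<close> on average. So only the boundary layer matters.
\<close>

lemma overlap_excess_from_layer:
  fixes t R \<zeta> \<eta> lam \<rho> L :: real
  assumes t: "0 \<le> t" and \<eta>: "0 < \<eta>" "\<eta> \<le> \<zeta>" and lam: "0 \<le> lam" and \<rho>: "0 \<le> \<rho>"
    and X: "\<And>x g. x \<in> X \<Longrightarrow> g \<in> V \<Longrightarrow> x - g \<in> X \<and> x + g \<in> X"
    and Y: "\<And>y g. y \<in> Y \<Longrightarrow> g \<in> V \<Longrightarrow> g + y \<in> Y \<and> - g + y \<in> Y"
    and progress: "\<And>A B. fin A \<Longrightarrow> fin B \<Longrightarrow> A \<subseteq> X \<Longrightarrow> B \<subseteq> Y \<Longrightarrow> t + \<zeta> \<le> vol A \<Longrightarrow>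
      t + \<zeta> \<le> vol B \<Longrightarrow> vol A + vol B \<le> R - \<zeta> \<Longrightarrow>
      \<exists>g\<in>V. right_defect A g \<le> \<eta> \<and> left_defect B g \<le> \<eta> \<and>
        (\<eta> / 2 \<le> right_defect A g \<or> \<eta> / 2 \<le> left_defect B g)"
    and layer: "\<And>A B. fin A \<Longrightarrow> fin B \<Longrightarrow> A \<subseteq> X \<Longrightarrow> B \<subseteq> Y \<Longrightarrow> t \<le> vol A \<Longrightarrow>
      t \<le> vol B \<Longrightarrow> vol A + vol B \<le> R \<Longrightarrow>
      vol A < t + \<zeta> \<or> vol B < t + \<zeta> \<or> R - \<zeta> < vol A + vol B \<Longrightarrow>
      overlap_excess t A B - (vol A - t) * (vol B - t) - lam * (vol A * vol B)
        - \<rho> * (vol A + vol B) \<le> L"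
    and AB: "fin A" "fin B" "A \<subseteq> X" "B \<subseteq> Y" "t \<le> vol A" "t \<le> vol B"
      "vol A + vol B \<le> R"
  shows "overlap_excess t A B - (vol A - t) * (vol B - t) - lam * (vol A * vol B)
        - \<rho> * (vol A + vol B) \<le> L"
proof -
  define D where "D = {(A, B). fin A \<and> fin B \<and> A \<subseteq> X \<and> B \<subseteq> Y \<and> t \<le> vol A \<and> t \<le> vol B \<and>
      vol A + vol B \<le> R}"
  \<comment> \<open>Both correction terms respect uncrossing: the product of the measures decreases
    on average by \<open>\<delta> * \<epsilon>\<close> and their sum is preserved, so subtracting
    nonnegative multiples keeps the averaged inequality.\<close>
  define E where "E p = (case p of (A, B) \<Rightarrow> overlap_excess t A B - (vol A - t) * (vol B - t)
      - lam * (vol A * vol B) - \<rho> * (vol A + vol B))" for p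
  define sq where "sq p = (case p of (A, B) \<Rightarrow> (vol A)\<^sup>2 + (vol B)\<^sup>2)" for p
  have sq: "0 \<le> sq p" "sq p \<le> R\<^sup>2" "E p \<le> R\<^sup>2" if p: "p \<in> D" for p
  proof -
    obtain A B where [simp]: "p = (A, B)" by (cases p)
    have *: "fin A" "fin B" "t \<le> vol A" "t \<le> vol B" "vol A + vol B \<le> R"
      using p unfolding D_def by auto
    have n: "0 \<le> vol A" "0 \<le> vol B" by auto
    have sR: "(vol A + vol B)\<^sup>2 \<le> R\<^sup>2" using *(5) n by (intro power_mono) auto
    have ab: "0 \<le> vol A * vol B" using n by simp
    have "(vol A + vol B)\<^sup>2 = (vol A)\<^sup>2 + (vol B)\<^sup>2 + 2 * (vol A * vol B)"
      by (simp add: power2_sum)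
    then have "(vol A)\<^sup>2 + (vol B)\<^sup>2 \<le> R\<^sup>2" "vol A * vol B \<le> R\<^sup>2"
      using sR ab zero_le_power2[of "vol A"] zero_le_power2[of "vol B"] by linarith+
    moreover have "0 \<le> (vol A - t) * (vol B - t)" "0 \<le> lam * (vol A * vol B)"
      "0 \<le> \<rho> * (vol A + vol B)" using * lam \<rho> by auto
    ultimately show "0 \<le> sq p" "sq p \<le> R\<^sup>2" "E p \<le> R\<^sup>2"
      using overlap_excess_le[OF *(1,2) t] unfolding sq_def E_def by auto
  qed
  have main: "E p + \<kappa> * sq p \<le> L + \<kappa> * R\<^sup>2" if \<kappa>: "0 < \<kappa>" and p: "p \<in> D" for \<kappa> p
  proof (rule ccontr)
    define F where "F q = E q + \<kappa> * sq q" for q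
    assume "\<not> ?thesis"
    then have Lp: "L + \<kappa> * R\<^sup>2 < F p" unfolding F_def by simp
    define s where "s = Sup (F ` D)"
    have Fb: "F q \<le> R\<^sup>2 + \<kappa> * R\<^sup>2" if "q \<in> D" for q
      using sq[OF that] \<kappa> unfolding F_def by (intro add_mono mult_left_mono) auto
    then have bdd: "bdd_above (F ` D)" by (auto intro!: bdd_aboveI)
    have Fs: "F q \<le> s" if "q \<in> D" for q unfolding s_def using that bdd by (intro cSup_upper) auto
    \<comment> \<open>The margin below the supremum is half of the gain
      \<open>\<kappa> * \<eta>^2 / 4\<close>; exceeding \<open>L + \<kappa> * R^2\<close> keeps the
      chosen pair out of the boundary layer.\<close>
    define c where "c = max (L + \<kappa> * R\<^sup>2) (s - \<kappa> * \<eta>\<^sup>2 / 8)"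
    have "0 < \<kappa> * \<eta>\<^sup>2 / 8" using \<kappa> \<eta> by simp
    then have "c < s" using Lp Fs[OF p] unfolding c_def by simp
    then obtain q where q: "q \<in> D" "c < F q"
      using less_cSupD[of "F ` D" c] p unfolding s_def by blast
    obtain A B where AB': "q = (A, B)" by (cases q)
    have f: "fin A" "fin B" "A \<subseteq> X" "B \<subseteq> Y" "t \<le> vol A" "t \<le> vol B" "vol A + vol B \<le> R"
      using q(1) unfolding D_def AB' by auto
    have int: "\<not> (vol A < t + \<zeta> \<or> vol B < t + \<zeta> \<or> R - \<zeta> < vol A + vol B)"
    proof
      assume "vol A < t + \<zeta> \<or> vol B < t + \<zeta> \<or> R - \<zeta> < vol A + vol B"
      from layer[OF f this] have "E q \<le> L" unfolding E_def AB' by simp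
      moreover have "\<kappa> * sq q \<le> \<kappa> * R\<^sup>2" using sq(2)[OF q(1)] \<kappa> by (intro mult_left_mono) auto
      ultimately have "F q \<le> L + \<kappa> * R\<^sup>2" unfolding F_def by simp
      then show False using q(2) unfolding c_def by simp
    qed
    then obtain g where g: "g \<in> V" "right_defect A g \<le> \<eta>" "left_defect B g \<le> \<eta>"
        "\<eta> / 2 \<le> right_defect A g \<or> \<eta> / 2 \<le> left_defect B g"
      using progress[OF f(1-4)] by auto
    define a b \<delta> \<epsilon> where "a = vol A" and "b = vol B" and "\<delta> = right_defect A g" and "\<epsilon> = left_defect B g"
    define A1 A2 B1 B2 where "A1 = A \<union> {x. x - g \<in> A}" and "A2 = {x\<in>A. x - g \<in> A}"
      and "B1 = {x\<in>B. g + x \<in> B}" and "B2 = B \<union> {x. g + x \<in> B}"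
    have fins: "fin A1" "fin A2" "fin B1" "fin B2"
      unfolding A1_def A2_def B1_def B2_def using f by (auto intro!: fin_right_parts fin_left_parts)
    have ms: "vol A1 = a + \<delta>" "vol A2 = a - \<delta>" "vol B1 = b - \<epsilon>" "vol B2 = b + \<epsilon>"
      unfolding A1_def A2_def B1_def B2_def a_def b_def \<delta>_def \<epsilon>_def
      using right_defect_eq[OF f(1), of g] right_defect_eq'[OF f(1), of g] left_defect_eq[OF f(2), of g] by auto
    have subs: "A1 \<subseteq> X" "A2 \<subseteq> X" "B1 \<subseteq> Y" "B2 \<subseteq> Y"
    proof -
      show "A2 \<subseteq> X" "B1 \<subseteq> Y" unfolding A2_def B1_def using f by auto
      show "A1 \<subseteq> X"
      proof
        fix x assume "x \<in> A1"
        then have "x \<in> X \<or> x - g \<in> X" unfolding A1_def using f by auto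
        then show "x \<in> X" using X[of "x - g" g] g by auto
      qed
      show "B2 \<subseteq> Y"
      proof
        fix x assume "x \<in> B2"
        then have "x \<in> Y \<or> g + x \<in> Y" unfolding B2_def using f by auto
        then show "x \<in> Y" using Y[of "g + x" g] g by (auto simp: add.assoc[symmetric])
      qed
    qed
    have bnds: "0 \<le> \<delta>" "0 \<le> \<epsilon>" "\<delta> \<le> \<zeta>" "\<epsilon> \<le> \<zeta>" unfolding \<delta>_def \<epsilon>_def using g \<eta> by auto
    have i: "t + \<zeta> \<le> a" "t + \<zeta> \<le> b" "a + b \<le> R - \<zeta>" using int unfolding a_def b_def by auto
    \<comment> \<open>Defects of at most \<open>\<zeta>\<close> cannot carry a pair across the
      boundary layer, so both new pairs stay in the domain.\<close>
    have D12: "(A1, B1) \<in> D" "(A2, B2) \<in> D"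
      unfolding D_def using fins subs ms bnds i by auto
    have exc: "2 * overlap_excess t A B \<le> overlap_excess t A1 B1 + overlap_excess t A2 B2 + 2 * (\<delta> * \<epsilon>)"
      unfolding A1_def A2_def B1_def B2_def \<delta>_def \<epsilon>_def by (rule overlap_excess_uncrossing[OF f(1,2) t])
    have "0 \<le> lam * (\<delta> * \<epsilon>)" using lam bnds by simp
    have "2 * E q \<le> E (A1, B1) + E (A2, B2)"
    proof -
      have "E (A1, B1) + E (A2, B2) - 2 * E q = overlap_excess t A1 B1 + overlap_excess t A2 B2
          + 2 * (\<delta> * \<epsilon>) - 2 * overlap_excess t A B + 2 * (lam * (\<delta> * \<epsilon>))"
        unfolding E_def AB' prod.case ms a_def[symmetric] b_def[symmetric] by (simp add: algebra_simps)
      then show ?thesis using exc \<open>0 \<le> lam * (\<delta> * \<epsilon>)\<close> by linarith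
    qed
    moreover have "sq (A1, B1) + sq (A2, B2) = 2 * sq q + 2 * (\<delta>\<^sup>2 + \<epsilon>\<^sup>2)"
      unfolding sq_def AB' prod.case ms a_def[symmetric] b_def[symmetric] by (simp add: power2_eq_square algebra_simps)
    moreover have "\<kappa> * (sq (A1, B1) + sq (A2, B2)) = \<kappa> * sq (A1, B1) + \<kappa> * sq (A2, B2)" by (simp add: algebra_simps)
    ultimately have "2 * F q + \<kappa> * (2 * (\<delta>\<^sup>2 + \<epsilon>\<^sup>2)) \<le> F (A1, B1) + F (A2, B2)"
      unfolding F_def by (simp add: algebra_simps)
    also have "\<dots> \<le> 2 * s" using Fs[OF D12(1)] Fs[OF D12(2)] by simp
    finally have le: "F q + \<kappa> * (\<delta>\<^sup>2 + \<epsilon>\<^sup>2) \<le> s" by (simp add: algebra_simps)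
    have "(\<eta> / 2)\<^sup>2 \<le> \<delta>\<^sup>2 + \<epsilon>\<^sup>2"
      using g(4)
    proof
      assume "\<eta> / 2 \<le> right_defect A g"
      then have "(\<eta> / 2)\<^sup>2 \<le> \<delta>\<^sup>2" using \<eta> unfolding \<delta>_def by (intro power_mono) auto
      then show ?thesis using zero_le_power2[of \<epsilon>] by linarith
    next
      assume "\<eta> / 2 \<le> left_defect B g"
      then have "(\<eta> / 2)\<^sup>2 \<le> \<epsilon>\<^sup>2" using \<eta> unfolding \<epsilon>_def by (intro power_mono) auto
      then show ?thesis using zero_le_power2[of \<delta>] by linarith
    qed
    then have "\<kappa> * (\<eta> / 2)\<^sup>2 \<le> \<kappa> * (\<delta>\<^sup>2 + \<epsilon>\<^sup>2)" using \<kappa> by (intro mult_left_mono) auto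
    then have "F q \<le> s - \<kappa> * \<eta>\<^sup>2 / 4" using le by (simp add: power2_eq_square)
    then show False using q(2) \<open>0 < \<kappa> * \<eta>\<^sup>2 / 8\<close> unfolding c_def by simp
  qed
  have p: "(A, B) \<in> D" unfolding D_def using AB by auto
  have "E (A, B) \<le> L"
  proof (rule real_le_mult_epsilon)
    fix \<kappa> :: real assume \<kappa>: "0 < \<kappa>"
    show "E (A, B) \<le> L + \<kappa> * R\<^sup>2"
      using main[OF \<kappa> p] mult_nonneg_nonneg[of \<kappa> "sq (A, B)"] sq(1)[OF p] \<kappa> by linarith
  qed
  then show ?thesis unfolding E_def by simp
qed

text \<open>Open subgroups are compared by measure instead of inclusion, so that the whole group
  qualifies when every open subgroup has infinite measure.\<close>

definition measure_minimal :: "'a set \<Rightarrow> bool" where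
  "measure_minimal V \<longleftrightarrow> open_subgroup V \<and> (\<forall>N. open_subgroup N \<longrightarrow> N \<subseteq> V \<longrightarrow> emeasure \<mu> N = emeasure \<mu> V)"

lemma coset_translate:
  assumes V: "open_subgroup V" and g: "g \<in> V"
  shows "- x0 + x \<in> V \<Longrightarrow> - x0 + (x - g) \<in> V \<and> - x0 + (x + g) \<in> V"
    "y - y0 \<in> V \<Longrightarrow> g + y - y0 \<in> V \<and> - g + y - y0 \<in> V"
proof -
  have sg: "\<And>x y. x \<in> V \<Longrightarrow> y \<in> V \<Longrightarrow> x + y \<in> V" "- g \<in> V"
    using V g unfolding open_subgroup_def by auto
  show "- x0 + x \<in> V \<Longrightarrow> - x0 + (x - g) \<in> V \<and> - x0 + (x + g) \<in> V"
    using g sg(1)[of "- x0 + x" g] sg(1)[of "- x0 + x" "- g"] sg(2)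
    by (simp add: add.assoc diff_conv_add_uminus del: add_uminus_conv_diff)
  show "y - y0 \<in> V \<Longrightarrow> g + y - y0 \<in> V \<and> - g + y - y0 \<in> V"
    using g sg(1)[of g "y - y0"] sg(1)[of "- g" "y - y0"] sg(2)
    by (simp add: add.assoc diff_conv_add_uminus del: add_uminus_conv_diff)
qed

text \<open>
  Uncrossing does not increase the average of \<open>a * b\<close>, so a small multiple of \<open>a * b\<close> can be
  subtracted; it dominates the trivial bound on the excess when \<open>a + b\<close> is large.
\<close>

lemma overlap_excess_coset_infinite:
  assumes V: "measure_minimal V" "emeasure \<mu> V = \<infinity>"
    and X: "X = {x. - x0 + x \<in> V}" and Y: "Y = {y. y - y0 \<in> V}"
    and A: "fin A" "A \<subseteq> X" and B: "fin B" "B \<subseteq> Y"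
    and t: "0 \<le> t" "t \<le> vol A" "t \<le> vol B"
  shows "overlap_excess t A B \<le> (vol A - t) * (vol B - t)"
proof -
  have oV: "open_subgroup V" and minV: "\<And>N. open_subgroup N \<Longrightarrow> N \<subseteq> V \<Longrightarrow> emeasure \<mu> N = emeasure \<mu> V"
    using V(1) unfolding measure_minimal_def by blast+
  let ?a = "vol A" and ?b = "vol B"
  let ?E = "overlap_excess t A B - (?a - t) * (?b - t)"
  \<comment> \<open>Three limits are taken in turn: \<open>\<zeta> \<rightarrow> 0\<close> inside
    this step, then \<open>R \<rightarrow> \<infinity>\<close>, then
    \<open>lam \<rightarrow> 0\<close>.\<close>
  have step: "?E \<le> lam * (?a * ?b) + t\<^sup>2 / (4 * lam * (R - 1)) * (?a + ?b)"
    if lam: "0 < lam" and R: "1 < R" "?a + ?b \<le> R" for lam R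
  proof -
    \<comment> \<open>Chosen so that \<open>\<rho> * (R - 1)\<close> is the constant
      \<open>t^2 / (4 * lam)\<close> left over from completing the square; in the layer of large
      sums, \<open>R - 1\<close> is below the sum of the measures.\<close>
    define \<rho> where "\<rho> = t\<^sup>2 / (4 * lam * (R - 1))"
    have \<rho>: "0 \<le> \<rho>" unfolding \<rho>_def using lam R by simp
    have "?E - lam * (?a * ?b) - \<rho> * (?a + ?b) \<le> R * \<zeta>" if \<zeta>: "0 < \<zeta>" "\<zeta> < 1" for \<zeta>
    proof (rule overlap_excess_from_layer[OF t(1) _ _ less_imp_le[OF lam] \<rho>])
      show "0 < \<zeta>" "\<zeta> \<le> \<zeta>" using \<zeta> by auto
      show "x - g \<in> X \<and> x + g \<in> X" if "x \<in> X" "g \<in> V" for x g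
        using coset_translate(1)[OF oV] that unfolding X by simp
      show "g + y \<in> Y \<and> - g + y \<in> Y" if "y \<in> Y" "g \<in> V" for y g
        using coset_translate(2)[OF oV] that unfolding Y by simp
    next
      fix A' B' assume f: "fin A'" "fin B'" and b: "t + \<zeta> \<le> vol B'"
      have "0 < vol B' - \<zeta> / 2" using b \<zeta> t by linarith
      then have "ennreal (vol B' - \<zeta> / 2) * emeasure \<mu> V = \<infinity>"
        using V(2) by (simp add: ennreal_mult_top)
      then show "\<exists>g\<in>V. right_defect A' g \<le> \<zeta> \<and> left_defect B' g \<le> \<zeta> \<and>
          (\<zeta> / 2 \<le> right_defect A' g \<or> \<zeta> / 2 \<le> left_defect B' g)"
        using \<zeta> by (intro small_translation_exists[OF f oV minV]) auto
    next
      fix A' B' assume f: "fin A'" "fin B'" and tab: "t \<le> vol A'" "t \<le> vol B'"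
        and sR: "vol A' + vol B' \<le> R"
        and lay: "vol A' < t + \<zeta> \<or> vol B' < t + \<zeta> \<or> R - \<zeta> < vol A' + vol B'"
      define a b M m where "a = vol A'" and "b = vol B'" and "M = max a b" and "m = min a b"
      have ex: "overlap_excess t A' B' \<le> M * (m - t)"
        unfolding M_def m_def a_def b_def by (rule overlap_excess_le_max[OF f t(1) tab])
      have ab: "a * b = M * m" "(a - t) * (b - t) = (M - t) * (m - t)" "a + b = M + m"
        unfolding M_def m_def by (auto simp: max_def min_def)
      have tm: "t \<le> m" "m \<le> M" "0 \<le> m" unfolding m_def M_def a_def b_def using tab t by auto
      have n1: "0 \<le> lam * (M * m)" "0 \<le> \<rho> * (M + m)" "0 \<le> (M - t) * (m - t)"
        using lam \<rho> tm by auto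
      have "overlap_excess t A' B' - (M - t) * (m - t) - lam * (M * m) - \<rho> * (M + m) \<le> R * \<zeta>"
      proof (cases "m < t + \<zeta>")
        case True
        have "M * (m - t) \<le> R * \<zeta>"
          using True tm sR unfolding a_def[symmetric] b_def[symmetric] ab(3) by (intro mult_mono) auto
        then show ?thesis using ex n1 by linarith
      next
        case False
        then have "R - \<zeta> < a + b" using lay unfolding a_def b_def m_def by auto
        then have RR: "R - 1 \<le> M + m" using \<zeta> ab(3) by linarith
        have "overlap_excess t A' B' - (M - t) * (m - t) \<le> t * (m - t)"
          using ex by (simp add: algebra_simps)
        also have "\<dots> \<le> t * m" using t(1) by (intro mult_left_mono) auto
        also have "t * m \<le> lam * (m * m) + t\<^sup>2 / (4 * lam)"
        proof -
          have "0 \<le> (2 * lam * m - t)\<^sup>2 / (4 * lam)" using lam by simp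
          also have "\<dots> = lam * (m * m) + t\<^sup>2 / (4 * lam) - t * m"
            using lam by (simp add: power2_eq_square field_simps)
          finally show ?thesis by simp
        qed
        also have "lam * (m * m) \<le> lam * (M * m)" using lam tm by (intro mult_left_mono mult_right_mono) auto
        also have "t\<^sup>2 / (4 * lam) = \<rho> * (R - 1)" unfolding \<rho>_def using R lam by simp
        also have "\<rho> * (R - 1) \<le> \<rho> * (M + m)" using RR \<rho> by (intro mult_left_mono) auto
        finally have "overlap_excess t A' B' - (M - t) * (m - t) \<le> lam * (M * m) + \<rho> * (M + m)" by simp
        moreover have "0 \<le> R * \<zeta>" using R \<zeta> by simp
        ultimately show ?thesis by linarith
      qed
      then show "overlap_excess t A' B' - (vol A' - t) * (vol B' - t)
          - lam * (vol A' * vol B') - \<rho> * (vol A' + vol B') \<le> R * \<zeta>"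
        unfolding a_def[symmetric] b_def[symmetric] ab .
    qed (use A B t R in auto)
    note bound = this
    have "?E - lam * (?a * ?b) - \<rho> * (?a + ?b) \<le> 0"
      by (rule real_le_mult_epsilon[where Z=R]) (use bound in \<open>simp add: mult.commute\<close>)
    then show ?thesis unfolding \<rho>_def by simp
  qed
  have step2: "?E \<le> lam * (?a * ?b)" if lam: "0 < lam" for lam
  proof (rule tendsto_lowerbound)
    have "((\<lambda>R. t\<^sup>2 / (4 * lam * (R - 1))) \<longlongrightarrow> 0) at_top"
      using lam by (intro tendsto_divide_0[OF tendsto_const] filterlim_at_top_imp_at_infinity
        filterlim_tendsto_pos_mult_at_top[OF tendsto_const] filterlim_tendsto_add_at_top[OF tendsto_const filterlim_ident, of "-1", simplified]) auto
    from tendsto_add[OF tendsto_const tendsto_mult[OF this tendsto_const]]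
    show "((\<lambda>R. lam * (?a * ?b) + t\<^sup>2 / (4 * lam * (R - 1)) * (?a + ?b)) \<longlongrightarrow> lam * (?a * ?b)) at_top"
      by simp
    show "\<forall>\<^sub>F R in at_top. ?E \<le> lam * (?a * ?b) + t\<^sup>2 / (4 * lam * (R - 1)) * (?a + ?b)"
      using eventually_gt_at_top[of 1] eventually_ge_at_top[of "?a + ?b"]
      by eventually_elim (rule step[OF lam])
  qed simp
  have "?E \<le> 0" by (rule real_le_mult_epsilon[where Z="?a * ?b"]) (simp add: step2)
  then show ?thesis by simp
qed

text \<open>
  At the boundary \<open>a + b = \<mu> V + t\<close> the overlap is at least \<open>t\<close> on a whole coset, so the excess is
  known exactly.
\<close>

lemma overlap_excess_coset_finite:
  assumes V: "measure_minimal V" "emeasure \<mu> V < \<infinity>"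
    and X: "X = {x. - x0 + x \<in> V}" and Y: "Y = {y. y - y0 \<in> V}"
    and A: "fin A" "A \<subseteq> X" and B: "fin B" "B \<subseteq> Y"
    and t: "0 \<le> t" "t \<le> vol A" "t \<le> vol B"
    and sum: "vol A + vol B \<le> vol V + t"
  shows "overlap_excess t A B \<le> (vol A - t) * (vol B - t)"
proof -
  have oV: "open_subgroup V" and minV: "\<And>N. open_subgroup N \<Longrightarrow> N \<subseteq> V \<Longrightarrow> emeasure \<mu> N = emeasure \<mu> V"
    using V(1) unfolding measure_minimal_def by blast+
  have sg: "\<And>x y. x \<in> V \<Longrightarrow> y \<in> V \<Longrightarrow> x + y \<in> V" "\<And>x. x \<in> V \<Longrightarrow> - x \<in> V" "0 \<in> V" "open V"
    using oV unfolding open_subgroup_def by auto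
  have fV: "fin V" using sg V unfolding fmeasurable_def by simp
  note [measurable] = finD(1)[OF fV]
  have fX: "fin X" and mX: "vol X = vol V" unfolding X by (auto intro: fin_left fV measure_left)
  have fY: "fin Y" and mY: "vol Y = vol V" unfolding Y by (auto intro: fin_right fV measure_right)
  \<comment> \<open>This is \<open>x0 + V + y0\<close>, the set of all sums of an element of
    \<open>X\<close> and an element of \<open>Y\<close>; outside it the overlap of their subsets
    vanishes.\<close>
  define Z where "Z = {z. - x0 + z - y0 \<in> V}"
  have Zx: "Z = {z. - x0 + z \<in> {y. y - y0 \<in> V}}" unfolding Z_def by simp
  have fZ: "fin Z" and mZ: "vol Z = vol V"
    unfolding Zx using fY mY fin_left[OF fY] measure_left[OF finD(1)[OF fY]] unfolding Y by simp_all
  let ?a = "vol A" and ?b = "vol B" and ?v = "vol V"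
  let ?E = "overlap_excess t A B - (?a - t) * (?b - t)"
  define R where "R = ?v + t"
  \<comment> \<open>For \<open>g\<close> in \<open>Z\<close>, the set \<open>A'\<close> and the
    reflection of \<open>B'\<close> both lie in \<open>X\<close>; if their measures add up to more
    than \<open>vol V + t - \<zeta>\<close>, they meet in measure at least
    \<open>t - \<zeta>\<close>.\<close>
  have barrier: "overlap_excess t A' B' \<le> vol A' * vol B' - (t - \<zeta>) * ?v"
    if f: "fin A'" "fin B'" "A' \<subseteq> X" "B' \<subseteq> Y" and c: "?v + t - \<zeta> < vol A' + vol B'" and \<zeta>: "0 < \<zeta>" for A' B' \<zeta>
  proof -
    have "overlap_excess t A' B' \<le> (\<integral>g. overlap A' B' g - (t - \<zeta>) * indicator Z g \<partial>\<mu>)"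
      unfolding overlap_excess_def
    proof (intro integral_mono overlap_excess_integrable f t Bochner_Integration.integrable_diff overlap_integrable)
      show "integrable \<mu> (\<lambda>g. (t - \<zeta>) * indicat_real Z g)"
        using fZ by (auto simp: fmeasurable_def)
      fix g
      show "max 0 (overlap A' B' g - t) \<le> overlap A' B' g - (t - \<zeta>) * indicator Z g"
      proof (cases "g \<in> Z")
        case True
        have sub: "{h. - h + g \<in> B'} \<subseteq> X"
        proof
          fix h assume "h \<in> {h. - h + g \<in> B'}"
          then have "- h + g - y0 \<in> V" using f(4) unfolding Y by auto
          from sg(1)[OF True[unfolded Z_def mem_Collect_eq] sg(2)[OF this]]
          show "h \<in> X" unfolding X by (simp add: add.assoc diff_conv_add_uminus minus_add del: add_uminus_conv_diff)
        qed
        have fB: "fin {h. - h + g \<in> B'}" by (rule fin_reflect[OF f(2)])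
        have "vol (A' \<union> {h. - h + g \<in> B'}) \<le> ?v"
          unfolding mX[symmetric] using f sub fB fX by (intro measure_mono_fmeasurable) (auto simp: fmeasurable_def)
        moreover have "vol (A' \<union> {h. - h + g \<in> B'}) = vol A' + vol B' - overlap A' B' g"
          using measure_Un3[OF f(1) fB] measure_reflect[OF finD(1)[OF f(2)], of g]
          unfolding overlap_def by (simp add: Int_def)
        ultimately have "t - \<zeta> \<le> overlap A' B' g" using c by linarith
        then show ?thesis using True \<zeta> by simp
      next
        case False
        have "{h\<in>A'. - h + g \<in> B'} = {}"
        proof (rule ccontr)
          assume "{h\<in>A'. - h + g \<in> B'} \<noteq> {}"
          then obtain h where h: "- x0 + h \<in> V" "- h + g - y0 \<in> V" using f(3,4) unfolding X Y by auto
          from sg(1)[OF this] have "g \<in> Z"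
            unfolding Z_def by (simp add: add.assoc diff_conv_add_uminus del: add_uminus_conv_diff)
          with False show False by simp
        qed
        then have "overlap A' B' g = 0" unfolding overlap_def by (metis measure_empty)
        then show ?thesis using False t by simp
      qed
    qed
    also have "\<dots> = vol A' * vol B' - (t - \<zeta>) * ?v"
      using overlap_integral[OF f(1,2)] overlap_integrable[OF f(1,2)] fZ mZ
      by (subst Bochner_Integration.integral_diff) (auto simp: fmeasurable_def)
    finally show ?thesis .
  qed
  have "?E \<le> R * \<zeta>" if \<zeta>: "0 < \<zeta>" for \<zeta>
  proof -
    \<comment> \<open>The second entry gives \<open>vol V * \<eta> \<le> \<zeta>^2\<close>. In the
      interior \<open>\<zeta>^2\<close> is a lower bound for
      \<open>vol B' * (vol V - vol B')\<close>, so the size condition of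
      \<open>small_translation_exists\<close> holds.\<close>
    define \<eta> where "\<eta> = min \<zeta> (\<zeta>\<^sup>2 / (?v + 1))"
    have v0: "0 \<le> ?v" by simp
    have \<eta>: "0 < \<eta>" "\<eta> \<le> \<zeta>" unfolding \<eta>_def using \<zeta> v0 by (auto simp: zero_less_divide_iff intro: add_nonneg_pos)
    have \<eta>v: "?v * \<eta> \<le> \<zeta>\<^sup>2"
    proof -
      have "?v * \<eta> \<le> (?v + 1) * (\<zeta>\<^sup>2 / (?v + 1))" unfolding \<eta>_def using \<zeta> v0 by (intro mult_mono) auto
      also have "\<dots> = \<zeta>\<^sup>2" using v0 by (simp add: add_nonneg_eq_0_iff)
      finally show ?thesis .
    qed
    have "?E - 0 * (?a * ?b) - 0 * (?a + ?b) \<le> R * \<zeta>"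
    proof (rule overlap_excess_from_layer[OF t(1) \<eta> order_refl order_refl])
      show "x - g \<in> X \<and> x + g \<in> X" if "x \<in> X" "g \<in> V" for x g
        using coset_translate(1)[OF oV] that unfolding X by simp
      show "g + y \<in> Y \<and> - g + y \<in> Y" if "y \<in> Y" "g \<in> V" for y g
        using coset_translate(2)[OF oV] that unfolding Y by simp
    next
      fix A' B' assume f: "fin A'" "fin B'" and a: "t + \<zeta> \<le> vol A'" and b: "t + \<zeta> \<le> vol B'"
        and ab: "vol A' + vol B' \<le> R - \<zeta>"
      have "\<zeta> * \<zeta> \<le> vol B' * (?v - vol B')"
        using a b ab t \<zeta> unfolding R_def by (intro mult_mono) auto
      moreover have "0 < \<zeta> * \<zeta>" using \<zeta> by simp
      ultimately have "(vol B')\<^sup>2 < (vol B' - \<eta> / 2) * ?v"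
        using \<eta>v by (simp add: power2_eq_square algebra_simps)
      then have "ennreal ((vol B')\<^sup>2) < ennreal (vol B' - \<eta> / 2) * emeasure \<mu> V"
        using b t \<zeta> \<eta> by (simp add: finD(3)[OF fV] ennreal_mult[symmetric] ennreal_less_iff)
      then show "\<exists>g\<in>V. right_defect A' g \<le> \<eta> \<and> left_defect B' g \<le> \<eta> \<and>
          (\<eta> / 2 \<le> right_defect A' g \<or> \<eta> / 2 \<le> left_defect B' g)"
        using \<eta> by (intro small_translation_exists[OF f oV minV]) auto
    next
      fix A' B' assume f: "fin A'" "fin B'" "A' \<subseteq> X" "B' \<subseteq> Y" and tab: "t \<le> vol A'" "t \<le> vol B'"
        and sR: "vol A' + vol B' \<le> R"
        and lay: "vol A' < t + \<zeta> \<or> vol B' < t + \<zeta> \<or> R - \<zeta> < vol A' + vol B'"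
      let ?A = "vol A'" and ?B = "vol B'"
      have n: "0 \<le> (?A - t) * (?B - t)" using tab by simp
      show "overlap_excess t A' B' - (?A - t) * (?B - t) - 0 * (?A * ?B) - 0 * (?A + ?B) \<le> R * \<zeta>"
      proof (cases "min ?A ?B < t + \<zeta>")
        case True
        have "max ?A ?B * (min ?A ?B - t) \<le> R * \<zeta>"
          using True tab sR t by (intro mult_mono) (auto simp: max_def)
        then show ?thesis using overlap_excess_le_max[OF f(1,2) t(1) tab] n by simp
      next
        case False
        then have c: "?v + t - \<zeta> < ?A + ?B" using lay unfolding R_def by auto
        have "t * (?A + ?B) \<le> t * R" using sR t by (intro mult_left_mono)
        moreover have "0 \<le> t * \<zeta>" using t \<zeta> by simp
        ultimately show ?thesis using barrier[OF f c \<zeta>] unfolding R_def by (simp add: algebra_simps)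
      qed
    qed (use A B t sum in \<open>auto simp: R_def\<close>)
    then show ?thesis by simp
  qed
  note bound = this
  have "?E \<le> 0" by (rule real_le_mult_epsilon[where Z=R]) (use bound in \<open>simp add: mult.commute\<close>)
  then show ?thesis by simp
qed

end

section \<open>Splitting a level over partial matchings\<close>

text \<open>
  The sets \<open>K\<close> are partial matchings: for a fixed \<open>g\<close>, the pairs of a left coset \<open>X\<close> and a right
  coset \<open>Y\<close> with \<open>g \<in> X + Y\<close> form one.
\<close>

definition is_split :: "'i set \<Rightarrow> 'j set \<Rightarrow> ('i \<Rightarrow> real) \<Rightarrow> ('j \<Rightarrow> real) \<Rightarrow> real \<Rightarrow> ('i \<Rightarrow> 'j \<Rightarrow> real) \<Rightarrow> bool" where
  "is_split I J a b t \<tau> \<longleftrightarrow> (\<forall>i j. 0 \<le> \<tau> i j) \<and>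
     (\<forall>K\<subseteq>I \<times> J. inj_on fst K \<longrightarrow> inj_on snd K \<longrightarrow> (\<Sum>(i, j)\<in>K. \<tau> i j) \<le> t) \<and>
     (\<Sum>i\<in>I. \<Sum>j\<in>J. max 0 (a i - \<tau> i j) * max 0 (b j - \<tau> i j)) \<le> (sum a I - t) * (sum b J - t)"

definition splits_for :: "'i set \<Rightarrow> 'j set \<Rightarrow> ('i \<Rightarrow> real) \<Rightarrow> ('j \<Rightarrow> real) \<Rightarrow> real \<Rightarrow> bool" where
  "splits_for I J a b t \<longleftrightarrow> (\<exists>\<tau>. is_split I J a b t \<tau>)"

lemma is_splitD:
  assumes "is_split I J a b t \<tau>"
  shows "0 \<le> \<tau> i j" "K \<subseteq> I \<times> J \<Longrightarrow> inj_on fst K \<Longrightarrow> inj_on snd K \<Longrightarrow> (\<Sum>(i, j)\<in>K. \<tau> i j) \<le> t"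
    "(\<Sum>i\<in>I. \<Sum>j\<in>J. max 0 (a i - \<tau> i j) * max 0 (b j - \<tau> i j)) \<le> (sum a I - t) * (sum b J - t)"
  using assms unfolding is_split_def by simp_all

lemma splits_for_swap:
  assumes "splits_for I J a b t" shows "splits_for J I b a t"
proof -
  from assms obtain \<tau> where "is_split I J a b t \<tau>" unfolding splits_for_def by blast
  note \<tau> = is_splitD[OF this]
  show ?thesis unfolding splits_for_def is_split_def
  proof (intro exI[of _ "\<lambda>j i. \<tau> i j"] conjI allI impI)
    fix K assume K: "K \<subseteq> J \<times> I" "inj_on fst K" "inj_on snd K"
    have "(\<Sum>(j, i)\<in>K. \<tau> i j) = (\<Sum>(i, j)\<in>prod.swap ` K. \<tau> i j)"
      by (subst sum.reindex) (auto simp: case_prod_unfold)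
    also have "\<dots> \<le> t"
      using K by (intro \<tau>(2)) (auto simp: inj_on_def)
    finally show "(\<Sum>(j, i)\<in>K. \<tau> i j) \<le> t" .
  next
    show "(\<Sum>j\<in>J. \<Sum>i\<in>I. max 0 (b j - \<tau> i j) * max 0 (a i - \<tau> i j)) \<le> (sum b J - t) * (sum a I - t)"
      using \<tau>(3) by (subst sum.swap) (simp add: mult.commute)
  qed (rule \<tau>)
qed

text \<open>Giving each pair the full \<open>a i\<close> makes all products vanish, as does the
  right-hand side. A partial matching uses each \<open>i\<close> at most once, so its shares add up
  to at most \<open>t\<close>.\<close>

lemma splits_for_boundary:
  assumes "finite I" "\<And>i. i \<in> I \<Longrightarrow> 0 \<le> a i" "sum a I = t"
  shows "splits_for I J a b t"
  unfolding splits_for_def is_split_def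
proof (intro exI[of _ "\<lambda>i j. if i \<in> I then a i else 0"] conjI allI impI)
  fix K assume K: "K \<subseteq> I \<times> J" "inj_on fst K"
  have "(\<Sum>(i, j)\<in>K. if i \<in> I then a i else 0) = (\<Sum>i\<in>fst ` K. if i \<in> I then a i else 0)"
    by (subst sum.reindex[OF K(2)]) (auto simp: case_prod_unfold)
  also have "\<dots> \<le> (\<Sum>i\<in>I. if i \<in> I then a i else 0)"
    using K assms by (intro sum_mono2) auto
  also have "\<dots> = t" using assms by simp
  finally show "(\<Sum>(i, j)\<in>K. if i \<in> I then a i else 0) \<le> t" .
qed (use assms in auto)

lemma splits_for_remove:
  assumes "finite I" "i0 \<in> I" "a i0 = 0" "splits_for (I - {i0}) J a b t"
  shows "splits_for I J a b t"
proof -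
  from assms(4) obtain \<tau> where "is_split (I - {i0}) J a b t \<tau>" unfolding splits_for_def by blast
  note \<tau> = is_splitD[OF this]
  show ?thesis unfolding splits_for_def is_split_def
  proof (intro exI[of _ "\<lambda>i j. if i = i0 then 0 else \<tau> i j"] conjI allI impI)
    fix K assume K: "K \<subseteq> I \<times> J" "inj_on fst K" "inj_on snd K"
    let ?K = "{p\<in>K. fst p \<noteq> i0}"
    show "(\<Sum>(i, j)\<in>K. if i = i0 then 0 else \<tau> i j) \<le> t"
    proof (cases "finite K")
      case True
      have "(\<Sum>(i, j)\<in>K. if i = i0 then 0 else \<tau> i j) = (\<Sum>(i, j)\<in>?K. \<tau> i j)"
        using True by (subst sum.inter_filter) (auto intro!: sum.cong simp: case_prod_unfold)
      also have "\<dots> \<le> t" using K by (intro \<tau>(2)) (auto intro: inj_on_subset)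
      finally show ?thesis .
    next
      \<comment> \<open>The sum over an infinite \<open>K\<close> is 0 by convention, and the empty
        matching shows that \<open>t\<close> is nonnegative.\<close>
      case False
      then show ?thesis using \<tau>(2)[of "{}"] by simp
    qed
  next
    have "(\<Sum>i\<in>I. \<Sum>j\<in>J. max 0 (a i - (if i = i0 then 0 else \<tau> i j)) * max 0 (b j - (if i = i0 then 0 else \<tau> i j)))
        = (\<Sum>i\<in>I - {i0}. \<Sum>j\<in>J. max 0 (a i - \<tau> i j) * max 0 (b j - \<tau> i j))"
      using assms(1-3) by (subst sum.remove[OF assms(1,2)]) (auto intro!: sum.cong)
    also have "\<dots> \<le> (sum a (I - {i0}) - t) * (sum b J - t)" by (rule \<tau>)
    also have "sum a (I - {i0}) = sum a I" using sum.remove[OF assms(1,2), of a] assms(3) by simp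
    finally show "(\<Sum>i\<in>I. \<Sum>j\<in>J. max 0 (a i - (if i = i0 then 0 else \<tau> i j)) * max 0 (b j - (if i = i0 then 0 else \<tau> i j)))
      \<le> (sum a I - t) * (sum b J - t)" .
  qed (use \<tau> in auto)
qed

text \<open>The right-hand side is convex, being the square of a nonnegative convex function.\<close>

lemma pos_part_mult_eq:
  fixes \<alpha> \<beta> :: real
  shows "max 0 \<alpha> * max 0 \<beta> + ((\<alpha> - \<beta>) / 2)\<^sup>2 = (max (\<alpha> + \<beta>) \<bar>\<alpha> - \<beta>\<bar>)\<^sup>2 / 4"
proof -
  consider "0 \<le> \<alpha>" "0 \<le> \<beta>" | "\<alpha> < 0 \<or> \<beta> < 0" by linarith
  then show ?thesis
  proof cases
    case 1
    then have "max (\<alpha> + \<beta>) \<bar>\<alpha> - \<beta>\<bar> = \<alpha> + \<beta>" by linarith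
    then show ?thesis using 1 by (simp add: max_absorb2 power2_eq_square field_simps)
  next
    case 2
    then have "max (\<alpha> + \<beta>) \<bar>\<alpha> - \<beta>\<bar> = \<bar>\<alpha> - \<beta>\<bar>" by linarith
    moreover have "max 0 \<alpha> * max 0 \<beta> = 0" using 2 by auto
    ultimately show ?thesis by (simp add: power_divide)
  qed
qed

text \<open>The weights make the shifts by \<open>r\<close> and \<open>s\<close> cancel on average.
  In the representation of \<open>pos_part_mult_eq\<close>, the convex square at the average is at
  most the average of the squares, while the subtracted square of the half-difference, in which
  \<open>\<tau>\<close> cancels, has variance exactly \<open>r * s\<close>.\<close>

lemma pos_part_mult_combination:
  fixes a b r s w \<tau>1 \<tau>2 :: real
  assumes r: "0 < r" and s: "0 < s" and w: "w = s / (r + s)"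
  defines "\<tau> \<equiv> w * \<tau>1 + (1 - w) * \<tau>2"
  shows "max 0 (a - \<tau>) * max 0 (b - \<tau>) \<le>
    w * (max 0 (a + r - \<tau>1) * max 0 (b - r - \<tau>1)) +
    (1 - w) * (max 0 (a - s - \<tau>2) * max 0 (b + s - \<tau>2)) + r * s"
proof -
  define M where "M \<alpha> \<beta> = max (\<alpha> + \<beta>) \<bar>\<alpha> - \<beta>\<bar>" for \<alpha> \<beta> :: real
  have \<Phi>: "max 0 \<alpha> * max 0 \<beta> = (M \<alpha> \<beta>)\<^sup>2 / 4 - ((\<alpha> - \<beta>) / 2)\<^sup>2" for \<alpha> \<beta> :: real
    using pos_part_mult_eq[of \<alpha> \<beta>] unfolding M_def by simp
  have w01: "0 \<le> w" "w \<le> 1" "w * (r + s) = s" unfolding w using r s by (auto simp: field_simps)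
  have wr: "w * r = (1 - w) * s" using w01(3) by (simp add: algebra_simps)
  let ?a1 = "a + r - \<tau>1" and ?b1 = "b - r - \<tau>1" and ?a2 = "a - s - \<tau>2" and ?b2 = "b + s - \<tau>2"
  have ea: "a - \<tau> = w * ?a1 + (1 - w) * ?a2" and eb: "b - \<tau> = w * ?b1 + (1 - w) * ?b2"
    using wr unfolding \<tau>_def by (simp_all add: algebra_simps)
  have "M (a - \<tau>) (b - \<tau>) \<le> w * M ?a1 ?b1 + (1 - w) * M ?a2 ?b2"
  proof -
    have 1: "w * (?a1 + ?b1) \<le> w * M ?a1 ?b1" "w * \<bar>?a1 - ?b1\<bar> \<le> w * M ?a1 ?b1"
      unfolding M_def using w01 by (auto intro!: mult_left_mono)
    have 2: "(1 - w) * (?a2 + ?b2) \<le> (1 - w) * M ?a2 ?b2" "(1 - w) * \<bar>?a2 - ?b2\<bar> \<le> (1 - w) * M ?a2 ?b2"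
      unfolding M_def using w01 by (auto intro!: mult_left_mono)
    have "(a - \<tau>) + (b - \<tau>) = w * (?a1 + ?b1) + (1 - w) * (?a2 + ?b2)" unfolding ea eb by (simp add: algebra_simps)
    moreover have "(a - \<tau>) - (b - \<tau>) = w * (?a1 - ?b1) + (1 - w) * (?a2 - ?b2)"
      unfolding ea eb by (simp add: algebra_simps)
    moreover have "\<bar>w * (?a1 - ?b1) + (1 - w) * (?a2 - ?b2)\<bar> \<le> w * \<bar>?a1 - ?b1\<bar> + (1 - w) * \<bar>?a2 - ?b2\<bar>"
      using abs_triangle_ineq[of "w * (?a1 - ?b1)" "(1 - w) * (?a2 - ?b2)"] w01 by (simp add: abs_mult)
    ultimately show ?thesis unfolding M_def[of "a - \<tau>"] using 1 2 by auto
  qed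
  moreover have "0 \<le> M (a - \<tau>) (b - \<tau>)" unfolding M_def by simp
  ultimately have "(M (a - \<tau>) (b - \<tau>))\<^sup>2 \<le> (w * M ?a1 ?b1 + (1 - w) * M ?a2 ?b2)\<^sup>2"
    by (intro power_mono)
  also have "\<dots> = w * (M ?a1 ?b1)\<^sup>2 + (1 - w) * (M ?a2 ?b2)\<^sup>2 - w * (1 - w) * (M ?a1 ?b1 - M ?a2 ?b2)\<^sup>2"
    by (simp add: power2_eq_square algebra_simps)
  also have "\<dots> \<le> w * (M ?a1 ?b1)\<^sup>2 + (1 - w) * (M ?a2 ?b2)\<^sup>2" using w01 by simp
  finally have conv: "(M (a - \<tau>) (b - \<tau>))\<^sup>2 \<le> w * (M ?a1 ?b1)\<^sup>2 + (1 - w) * (M ?a2 ?b2)\<^sup>2" .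
  define d where "d = (a - b) / 2"
  have d: "((a - \<tau>) - (b - \<tau>)) / 2 = d" "(?a1 - ?b1) / 2 = d + r" "(?a2 - ?b2) / 2 = d - s"
    unfolding d_def by (auto simp: field_simps)
  have "w * (d + r)\<^sup>2 + (1 - w) * (d - s)\<^sup>2 = d\<^sup>2 + 2 * d * (w * r - (1 - w) * s) + (w * r) * r + ((1 - w) * s) * s"
    by (simp add: power2_eq_square algebra_simps)
  also have "\<dots> = d\<^sup>2 + (1 - w) * s * (r + s)" unfolding wr by (simp add: algebra_simps)
  also have "(1 - w) * s * (r + s) = r * s"
  proof -
    have "(1 - w) * (r + s) = r" using w01(3) by (simp add: algebra_simps)
    then show ?thesis by (metis mult.assoc mult.commute)
  qed
  finally have var: "w * (d + r)\<^sup>2 + (1 - w) * (d - s)\<^sup>2 = d\<^sup>2 + r * s" .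
  have "(M (a - \<tau>) (b - \<tau>))\<^sup>2 / 4 - d\<^sup>2 \<le> w * ((M ?a1 ?b1)\<^sup>2 / 4 - (d + r)\<^sup>2) +
      (1 - w) * ((M ?a2 ?b2)\<^sup>2 / 4 - (d - s)\<^sup>2) + r * s"
    using conv var unfolding right_diff_distrib by linarith
  then show ?thesis unfolding \<Phi> d .
qed

text \<open>Measure is moved uniformly from the \<open>b j\<close> to the \<open>a i\<close>, or
  back. The errors \<open>r * s\<close> of the \<open>card I * card J\<close> pairs add up to
  exactly what the product on the right-hand side loses on average, and the condition on matchings
  is linear in \<open>\<tau>\<close>.\<close>

lemma splits_for_combination:
  assumes fin: "finite I" "finite J" and r: "0 < r" and s: "0 < s"
    and 1: "splits_for I J (\<lambda>i. a i + r) (\<lambda>j. b j - r) t"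
    and 2: "splits_for I J (\<lambda>i. a i - s) (\<lambda>j. b j + s) t"
  shows "splits_for I J a b t"
proof -
  define w where "w = s / (r + s)"
  have w01: "0 \<le> w" "w \<le> 1" "w * (r + s) = s" unfolding w_def using r s by (auto simp: field_simps)
  from 1 obtain \<tau>1 where "is_split I J (\<lambda>i. a i + r) (\<lambda>j. b j - r) t \<tau>1" unfolding splits_for_def by blast
  note \<tau>1 = is_splitD[OF this]
  from 2 obtain \<tau>2 where "is_split I J (\<lambda>i. a i - s) (\<lambda>j. b j + s) t \<tau>2" unfolding splits_for_def by blast
  note \<tau>2 = is_splitD[OF this]
  define \<tau> where "\<tau> i j = w * \<tau>1 i j + (1 - w) * \<tau>2 i j" for i j
  show ?thesis unfolding splits_for_def is_split_def
  proof (intro exI[of _ \<tau>] conjI allI impI)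
    show "0 \<le> \<tau> i j" for i j unfolding \<tau>_def using w01 \<tau>1(1) \<tau>2(1) by simp
    fix K assume K: "K \<subseteq> I \<times> J" "inj_on fst K" "inj_on snd K"
    have "(\<Sum>(i, j)\<in>K. \<tau> i j) = w * (\<Sum>(i, j)\<in>K. \<tau>1 i j) + (1 - w) * (\<Sum>(i, j)\<in>K. \<tau>2 i j)"
      unfolding \<tau>_def by (simp add: case_prod_unfold sum.distrib sum_distrib_left)
    also have "\<dots> \<le> w * t + (1 - w) * t" using w01 \<tau>1(2)[OF K] \<tau>2(2)[OF K] by (intro add_mono mult_left_mono) auto
    finally show "(\<Sum>(i, j)\<in>K. \<tau> i j) \<le> t" by (simp add: algebra_simps)
  next
    define p q A B where "p = real (card I)" and "q = real (card J)" and "A = sum a I - t" and "B = sum b J - t"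
    have "(\<Sum>i\<in>I. \<Sum>j\<in>J. max 0 (a i - \<tau> i j) * max 0 (b j - \<tau> i j)) \<le>
      (\<Sum>i\<in>I. \<Sum>j\<in>J. w * (max 0 (a i + r - \<tau>1 i j) * max 0 (b j - r - \<tau>1 i j)) +
        (1 - w) * (max 0 (a i - s - \<tau>2 i j) * max 0 (b j + s - \<tau>2 i j)) + r * s)"
      unfolding \<tau>_def by (intro sum_mono pos_part_mult_combination[OF r s w_def])
    also have "\<dots> = w * (\<Sum>i\<in>I. \<Sum>j\<in>J. max 0 (a i + r - \<tau>1 i j) * max 0 (b j - r - \<tau>1 i j)) +
        (1 - w) * (\<Sum>i\<in>I. \<Sum>j\<in>J. max 0 (a i - s - \<tau>2 i j) * max 0 (b j + s - \<tau>2 i j)) + p * q * (r * s)"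
      unfolding p_def q_def by (simp add: sum.distrib sum_distrib_left)
    also have "\<dots> \<le> w * ((sum (\<lambda>i. a i + r) I - t) * (sum (\<lambda>j. b j - r) J - t)) +
        (1 - w) * ((sum (\<lambda>i. a i - s) I - t) * (sum (\<lambda>j. b j + s) J - t)) + p * q * (r * s)"
      using w01 by (intro add_mono mult_left_mono \<tau>1(3) \<tau>2(3) order_refl) auto
    also have "\<dots> = w * ((A + p * r) * (B - q * r)) + (1 - w) * ((A - p * s) * (B + q * s)) + p * q * (r * s)"
      unfolding A_def B_def p_def q_def by (simp add: sum.distrib sum_subtractf algebra_simps)
    also have "\<dots> = A * B + (p * B - q * A) * (w * (r + s) - s) - p * q * ((w * (r + s)) * (r - s) + s * s - r * s)"
      by (simp add: algebra_simps)
    also have "\<dots> = A * B" unfolding w01(3) by (simp add: algebra_simps)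
    finally show "(\<Sum>i\<in>I. \<Sum>j\<in>J. max 0 (a i - \<tau> i j) * max 0 (b j - \<tau> i j)) \<le> (sum a I - t) * (sum b J - t)"
      unfolding A_def B_def .
  qed
qed

text \<open>Shifting measure as far as possible in either direction ends in a degenerate case: a
  part becomes empty and is removed by induction, or a total reaches \<open>t\<close>. The given
  data are a combination of the two end points.\<close>

lemma splits_for_all:
  fixes a :: "'i \<Rightarrow> real" and b :: "'j \<Rightarrow> real"
  assumes "finite I" "finite J" "\<And>i. i \<in> I \<Longrightarrow> 0 \<le> a i" "\<And>j. j \<in> J \<Longrightarrow> 0 \<le> b j"
    "0 \<le> t" "t \<le> sum a I" "t \<le> sum b J"
  shows "splits_for I J a b t"
  using assms
proof (induction "card I + card J" arbitrary: I J a b rule: less_induct)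
  case less
  have A0: "splits_for I J a' b' t"
    if "i0 \<in> I" "a' i0 = 0" "\<And>i. i \<in> I \<Longrightarrow> 0 \<le> a' i" "\<And>j. j \<in> J \<Longrightarrow> 0 \<le> b' j" "t \<le> sum a' I" "t \<le> sum b' J"
    for i0 and a' :: "'i \<Rightarrow> real" and b' :: "'j \<Rightarrow> real"
  proof (rule splits_for_remove[where a=a', OF less.prems(1) that(1,2)])
    have "sum a' (I - {i0}) = sum a' I" using sum.remove[OF less.prems(1) that(1), of a'] that by simp
    moreover have "card (I - {i0}) < card I" using that(1) less.prems(1) by (intro psubset_card_mono) auto
    ultimately show "splits_for (I - {i0}) J a' b' t"
      using that less.prems by (intro less.hyps) auto
  qed
  have B0: "splits_for I J a' b' t"
    if "j0 \<in> J" "b' j0 = 0" "\<And>i. i \<in> I \<Longrightarrow> 0 \<le> a' i" "\<And>j. j \<in> J \<Longrightarrow> 0 \<le> b' j" "t \<le> sum a' I" "t \<le> sum b' J"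
    for j0 and a' :: "'i \<Rightarrow> real" and b' :: "'j \<Rightarrow> real"
  proof (rule splits_for_swap, rule splits_for_remove[where a=b', OF less.prems(2) that(1,2)], rule splits_for_swap)
    have "sum b' (J - {j0}) = sum b' J" using sum.remove[OF less.prems(2) that(1), of b'] that by simp
    moreover have "card (J - {j0}) < card J" using that(1) less.prems(2) by (intro psubset_card_mono) auto
    ultimately show "splits_for I (J - {j0}) a' b' t"
      using that less.prems by (intro less.hyps) auto
  qed
  note bA = splits_for_boundary[OF less.prems(1)]
    and bB = splits_for_swap[OF splits_for_boundary[OF less.prems(2)]]
  show ?case
  proof (cases "(\<exists>i\<in>I. a i = 0) \<or> (\<exists>j\<in>J. b j = 0) \<or> sum a I = t \<or> sum b J = t")
    case True
    then show ?thesis using A0[of _ a b] B0[of _ b a] bA[of a t J b] bB[of b t I a] less.prems by metis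
  next
    case False
    then have pos: "\<And>i. i \<in> I \<Longrightarrow> 0 < a i" "\<And>j. j \<in> J \<Longrightarrow> 0 < b j" "t < sum a I" "t < sum b J"
      using less.prems(3,4,6,7) by (auto simp: less_le)
    have ne: "I \<noteq> {}" "J \<noteq> {}" using pos(3,4) less.prems(5) by auto
    define p q where "p = real (card I)" and "q = real (card J)"
    have pq: "0 < p" "0 < q" unfolding p_def q_def using ne less.prems by (auto simp: card_gt_0_iff)
    \<comment> \<open>The largest shift that keeps every \<open>b j\<close> nonnegative and their
      total at least \<open>t\<close>; attaining either bound is one of the degenerate
      cases.\<close>
    define r where "r = min (Min (b ` J)) ((sum b J - t) / q)"
    define s where "s = min (Min (a ` I)) ((sum a I - t) / p)"
    have r: "0 < r" unfolding r_def using pos pq ne less.prems by auto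
    have s: "0 < s" unfolding s_def using pos pq ne less.prems by auto
    have rb: "r \<le> b j" if "j \<in> J" for j
      using that less.prems(2) unfolding r_def by (intro min.coboundedI1 Min_le) auto
    have sa: "s \<le> a i" if "i \<in> I" for i
      using that less.prems(1) unfolding s_def by (intro min.coboundedI1 Min_le) auto
    have sums: "sum (\<lambda>i. a i + r) I = sum a I + p * r" "sum (\<lambda>j. b j - r) J = sum b J - q * r"
      "sum (\<lambda>i. a i - s) I = sum a I - p * s" "sum (\<lambda>j. b j + s) J = sum b J + q * s"
      unfolding p_def q_def by (simp_all add: sum.distrib sum_subtractf)
    have qr: "q * r \<le> sum b J - t" "p * s \<le> sum a I - t"
      using pq unfolding r_def s_def by (auto simp: min_def field_simps)
    have nn: "0 \<le> p * r" "0 \<le> q * s" using pq r s by auto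
    show ?thesis
    proof (rule splits_for_combination[OF less.prems(1,2) r s])
      show "splits_for I J (\<lambda>i. a i + r) (\<lambda>j. b j - r) t"
      proof (cases "r = Min (b ` J)")
        case True
        moreover have "Min (b ` J) \<in> b ` J" using ne less.prems by (intro Min_in) auto
        ultimately obtain j0 where "j0 \<in> J" "b j0 = r" by auto
        then show ?thesis using pos r rb sums qr nn by (intro B0[of j0]) (auto intro: add_nonneg_nonneg less_imp_le)
      next
        case False
        then have "r = (sum b J - t) / q" unfolding r_def by linarith
        then have "q * r = sum b J - t" using pq by simp
        then show ?thesis using rb sums by (intro bB) auto
      qed
      show "splits_for I J (\<lambda>i. a i - s) (\<lambda>j. b j + s) t"
      proof (cases "s = Min (a ` I)")
        case True
        moreover have "Min (a ` I) \<in> a ` I" using ne less.prems by (intro Min_in) auto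
        ultimately obtain i0 where "i0 \<in> I" "a i0 = s" by auto
        then show ?thesis using pos s sa sums qr nn by (intro A0[of i0]) (auto intro: add_nonneg_nonneg less_imp_le)
      next
        case False
        then have "s = (sum a I - t) / p" unfolding s_def by linarith
        then have "p * s = sum a I - t" using pq by simp
        then show ?thesis using sa sums by (intro bA) auto
      qed
    qed
  qed
qed

section \<open>The excess inequality\<close>

context unimodular_haar
begin

section \<open>Cosets of an open subgroup\<close>

lemma open_subgroupD:
  assumes "open_subgroup V"
  shows "open V" "0 \<in> V" "x \<in> V \<Longrightarrow> y \<in> V \<Longrightarrow> x + y \<in> V" "x \<in> V \<Longrightarrow> - x \<in> V"
  using assms unfolding open_subgroup_def by auto

definition left_cosets :: "'a set \<Rightarrow> 'a set set" where
  "left_cosets V = range (\<lambda>x0. {x. - x0 + x \<in> V})"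

definition right_cosets :: "'a set \<Rightarrow> 'a set set" where
  "right_cosets V = range (\<lambda>y0. {y. y - y0 \<in> V})"

lemma left_coset_absorb:
  assumes "open_subgroup V" "X \<in> left_cosets V" "x \<in> X"
  shows "y \<in> X \<longleftrightarrow> - x + y \<in> V"
proof -
  obtain x0 where X: "X = {x. - x0 + x \<in> V}" using assms(2) unfolding left_cosets_def by auto
  note V = open_subgroupD[OF assms(1)]
  show ?thesis
    using V(3)[of "- (- x0 + x)" "- x0 + y"] V(3)[of "- x0 + x" "- x + y"] V(4)[of "- x0 + x"] assms(3)
    unfolding X by (auto simp: minus_add add.assoc)
qed

lemma right_coset_absorb:
  assumes "open_subgroup V" "Y \<in> right_cosets V" "x \<in> Y"
  shows "y \<in> Y \<longleftrightarrow> y - x \<in> V"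
proof -
  obtain y0 where Y: "Y = {y. y - y0 \<in> V}" using assms(2) unfolding right_cosets_def by auto
  note V = open_subgroupD[OF assms(1)]
  show ?thesis
    using V(3)[of "y - y0" "- (x - y0)"] V(3)[of "y - x" "x - y0"] V(4)[of "x - y0"] assms(3)
    unfolding Y by (auto simp: add.assoc diff_conv_add_uminus minus_add simp del: add_uminus_conv_diff)
qed

lemma left_cosets_disjoint:
  assumes "open_subgroup V" "X \<in> left_cosets V" "X' \<in> left_cosets V" "x \<in> X" "x \<in> X'"
  shows "X = X'"
  using left_coset_absorb[OF assms(1,2,4)] left_coset_absorb[OF assms(1,3,5)] by auto

lemma right_cosets_disjoint:
  assumes "open_subgroup V" "Y \<in> right_cosets V" "Y' \<in> right_cosets V" "x \<in> Y" "x \<in> Y'"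
  shows "Y = Y'"
  using right_coset_absorb[OF assms(1,2,4)] right_coset_absorb[OF assms(1,3,5)] by auto

lemma open_cosets:
  assumes "open_subgroup V"
  shows "X \<in> left_cosets V \<Longrightarrow> open X" "Y \<in> right_cosets V \<Longrightarrow> open Y"
proof -
  have "open ((\<lambda>x. - x0 + x) -` V)" "open ((\<lambda>x. x - x0) -` V)" for x0
    using open_subgroupD(1)[OF assms] by (intro open_vimage continuous_intros; simp)+
  then show "X \<in> left_cosets V \<Longrightarrow> open X" "Y \<in> right_cosets V \<Longrightarrow> open Y"
    unfolding left_cosets_def right_cosets_def vimage_def by auto
qed

text \<open>A set of finite measure may meet infinitely many cosets. A compact subset of an open
  superset meets only finitely many members of a suitable subcover, and regularity makes the
  remainder small.\<close>

lemma finite_open_cover_almost: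
  assumes A: "fin A" and e: "0 < e" and C: "\<And>X. X \<in> C \<Longrightarrow> open X" "\<Union>C = UNIV"
  obtains D where "finite D" "D \<subseteq> C" "vol (A - \<Union>D) < e"
proof -
  obtain U where U: "open U" "A \<subseteq> U" "fin U" "vol U < vol A + e"
    by (rule outer_open_fin[OF A e])
  obtain K where K: "compact K" "K \<subseteq> U" "fin K" "vol U - e < vol K"
    by (rule inner_compact_fin[OF U(1,3) e])
  obtain D where D: "D \<subseteq> C" "finite D" "K \<subseteq> \<Union>D"
    by (rule compactE[OF K(1), of C]) (use C in auto)
  have oD: "open (\<Union>D)" using D C by auto
  have "vol (A - \<Union>D) \<le> vol (U - K)"
    using U D K A oD finD(1)[OF A] by (intro measure_mono_fmeasurable fmeasurable.Diff) auto
  also have "\<dots> = vol U - vol K"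
    using measure_Diff[of \<mu> U K] U K by (simp add: fmeasurable_def)
  also have "\<dots> < e" using K by linarith
  finally show ?thesis using that D by blast
qed

lemma cosets_cover:
  assumes "open_subgroup V"
  shows "\<Union>(left_cosets V) = UNIV" "\<Union>(right_cosets V) = UNIV"
proof -
  have "x \<in> {y. - x + y \<in> V}" "x \<in> {y. y - x \<in> V}" for x
    using open_subgroupD(2)[OF assms] by auto
  then show "\<Union>(left_cosets V) = UNIV" "\<Union>(right_cosets V) = UNIV"
    unfolding left_cosets_def right_cosets_def by blast+
qed

lemma overlap_decompose:
  assumes "finite I" "finite J" and A: "fin A" and B: "fin B"
    and I: "\<And>X. X \<in> I \<Longrightarrow> X \<in> sets borel" "disjoint_family_on (\<lambda>X. X) I" "A \<subseteq> \<Union>I"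
    and J: "\<And>Y. Y \<in> J \<Longrightarrow> Y \<in> sets borel" "disjoint_family_on (\<lambda>X. X) J" "B \<subseteq> \<Union>J"
  shows "overlap A B g = (\<Sum>X\<in>I. \<Sum>Y\<in>J. overlap (A \<inter> X) (B \<inter> Y) g)"
proof -
  have fA: "fin (A \<inter> X)" if "X \<in> I" for X using I(1)[OF that] finD(1)[OF A] by (intro fin_subset[OF A]) auto
  have fB: "fin (B \<inter> Y)" if "Y \<in> J" for Y using J(1)[OF that] finD(1)[OF B] by (intro fin_subset[OF B]) auto
  let ?S = "\<lambda>(X, Y). {h\<in>A \<inter> X. - h + g \<in> B \<inter> Y}"
  have "(\<Sum>X\<in>I. \<Sum>Y\<in>J. overlap (A \<inter> X) (B \<inter> Y) g) = (\<Sum>p\<in>I \<times> J. vol (?S p))"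
    unfolding overlap_def by (simp add: sum.cartesian_product case_prod_unfold)
  also have "\<dots> = vol (\<Union>p\<in>I \<times> J. ?S p)"
  proof (rule measure_finite_Union[symmetric])
    have "?S p \<in> sets \<mu> \<and> emeasure \<mu> (?S p) < \<infinity>" if p: "p \<in> I \<times> J" for p
      using fin_overlap[OF fA fB, of "fst p" "snd p" g] p by (auto simp: fmeasurable_def)
    then show "?S ` (I \<times> J) \<subseteq> sets \<mu>" "\<And>p. p \<in> I \<times> J \<Longrightarrow> emeasure \<mu> (?S p) \<noteq> \<infinity>"
      by (auto simp: less_top[symmetric])
    show "disjoint_family_on ?S (I \<times> J)"
      using I(2) J(2) unfolding disjoint_family_on_def by auto blast+
  qed (use assms in auto)
  also have "(\<Union>p\<in>I \<times> J. ?S p) = {h\<in>A. - h + g \<in> B}" using I(3) J(3) by auto blast+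
  finally show ?thesis unfolding overlap_def by simp
qed

text \<open>At a given \<open>g\<close> the contributing pairs of cosets are matched, so their
  shares of the level add up to at most \<open>t\<close> and the excess is at most the sum of the
  excesses of the pairs. Each pair is estimated inside its cosets at level
  \<open>\<tau> X Y\<close>, and the choice of \<open>\<tau>\<close> bounds the total.\<close>

lemma overlap_excess_coset_union:
  assumes V: "measure_minimal V" "emeasure \<mu> V < \<infinity>"
    and I: "finite I" "I \<subseteq> left_cosets V" "A \<subseteq> \<Union>I" and J: "finite J" "J \<subseteq> right_cosets V" "B \<subseteq> \<Union>J"
    and A: "fin A" and B: "fin B" and t: "0 \<le> t" "t \<le> vol A" "t \<le> vol B"
    and sum: "vol A + vol B \<le> vol V"
  shows "overlap_excess t A B \<le> (vol A - t) * (vol B - t)"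
proof -
  have oV: "open_subgroup V" using V(1) unfolding measure_minimal_def by (rule conjunct1)
  note Vg = open_subgroupD[OF oV]
  have bI: "X \<in> sets borel" if "X \<in> I" for X using open_cosets(1)[OF oV] I that by auto
  have bJ: "Y \<in> sets borel" if "Y \<in> J" for Y using open_cosets(2)[OF oV] J that by auto
  have dI: "disjoint_family_on (\<lambda>X. X) I"
    unfolding disjoint_family_on_def using left_cosets_disjoint[OF oV] I(2) by blast
  have dJ: "disjoint_family_on (\<lambda>X. X) J"
    unfolding disjoint_family_on_def using right_cosets_disjoint[OF oV] J(2) by blast
  have fA: "fin (A \<inter> X)" if "X \<in> I" for X using bI[OF that] finD(1)[OF A] by (intro fin_subset[OF A]) auto
  have fB: "fin (B \<inter> Y)" if "Y \<in> J" for Y using bJ[OF that] finD(1)[OF B] by (intro fin_subset[OF B]) auto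
  define a b where "a X = vol (A \<inter> X)" and "b Y = vol (B \<inter> Y)" for X Y
  have sa: "sum a I = vol A"
  proof -
    have "sum a I = vol (\<Union>X\<in>I. A \<inter> X)"
      unfolding a_def using dI fA I(1) finD(2)[OF fA]
      by (intro measure_finite_Union[symmetric]) (auto simp: disjoint_family_on_def fmeasurable_def less_top[symmetric])
    also have "(\<Union>X\<in>I. A \<inter> X) = A" using I(3) by auto
    finally show ?thesis .
  qed
  have sb: "sum b J = vol B"
  proof -
    have "sum b J = vol (\<Union>X\<in>J. B \<inter> X)"
      unfolding b_def using dJ fB J(1) finD(2)[OF fB]
      by (intro measure_finite_Union[symmetric]) (auto simp: disjoint_family_on_def fmeasurable_def less_top[symmetric])
    also have "(\<Union>X\<in>J. B \<inter> X) = B" using J(3) by auto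
    finally show ?thesis .
  qed
  have "splits_for I J a b t"
    using I(1) J(1) t sa sb by (intro splits_for_all) (auto simp: a_def b_def)
  then obtain \<tau> where "is_split I J a b t \<tau>" unfolding splits_for_def by blast
  note \<tau> = is_splitD[OF this]
  have ij: "overlap_excess (\<tau> X Y) (A \<inter> X) (B \<inter> Y) \<le> max 0 (a X - \<tau> X Y) * max 0 (b Y - \<tau> X Y)"
    if XY: "X \<in> I" "Y \<in> J" for X Y
  proof (cases "\<tau> X Y \<le> a X \<and> \<tau> X Y \<le> b Y")
    case True
    obtain x0 where X: "X = {x. - x0 + x \<in> V}" using I XY unfolding left_cosets_def by auto
    obtain y0 where Y: "Y = {y. y - y0 \<in> V}" using J XY unfolding right_cosets_def by auto
    have "a X \<le> vol A" "b Y \<le> vol B"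
      unfolding a_def b_def using A B fA[OF XY(1)] fB[OF XY(2)]
      by (auto intro!: measure_mono_fmeasurable dest: finD(1))
    then have "a X + b Y \<le> vol V + \<tau> X Y" using sum \<tau>(1)[of X Y] by linarith
    then show ?thesis
      using overlap_excess_coset_finite[OF V X Y fA[OF XY(1)] _ fB[OF XY(2)] _ \<tau>(1)[of X Y]] True
      unfolding a_def b_def by (simp add: max_absorb2)
  next
    case False
    then show ?thesis using overlap_excess_eq_0[OF fA[OF XY(1)] fB[OF XY(2)], of "\<tau> X Y"]
      unfolding a_def b_def by (auto simp: max_def)
  qed
  have pt: "max 0 (overlap A B g - t) \<le> (\<Sum>X\<in>I. \<Sum>Y\<in>J. max 0 (overlap (A \<inter> X) (B \<inter> Y) g - \<tau> X Y))" for g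
  proof -
    define K where "K = {(X, Y). X \<in> I \<and> Y \<in> J \<and> (\<exists>h\<in>X. - h + g \<in> Y)}"
    have KIJ: "K \<subseteq> I \<times> J" unfolding K_def by auto
    have fK: "finite K" by (rule finite_subset[OF KIJ]) (use I J in auto)
    \<comment> \<open>Two elements of the left coset \<open>X\<close> differ on the right by an
      element of \<open>V\<close>, so \<open>- h + g\<close> and \<open>- h' + g\<close> lie in the
      same right coset.\<close>
    have k1: "inj_on fst K"
    proof (rule inj_onI)
      fix p p' assume "p \<in> K" "p' \<in> K" "fst p = fst p'"
      then obtain X Y Y' h h' where *: "p = (X, Y)" "p' = (X, Y')" "X \<in> I" "Y \<in> J" "Y' \<in> J" "h \<in> X" "h' \<in> X"
        "- h + g \<in> Y" "- h' + g \<in> Y'" unfolding K_def by auto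
      have "- h' + h \<in> V" using left_coset_absorb[OF oV _ *(7)] * I by auto
      then have "(- h' + g) - (- h + g) \<in> V" by (simp add: add.assoc diff_conv_add_uminus minus_add del: add_uminus_conv_diff)
      then have "- h' + g \<in> Y" using right_coset_absorb[OF oV _ *(8)] * J by auto
      then have "Y = Y'" using right_cosets_disjoint[OF oV] * J by blast
      then show "p = p'" using * by simp
    qed
    have k2: "inj_on snd K"
    proof (rule inj_onI)
      fix p p' assume "p \<in> K" "p' \<in> K" "snd p = snd p'"
      then obtain X X' Y h h' where *: "p = (X, Y)" "p' = (X', Y)" "X \<in> I" "X' \<in> I" "Y \<in> J" "h \<in> X" "h' \<in> X'"
        "- h + g \<in> Y" "- h' + g \<in> Y" unfolding K_def by auto
      have "(- h + g) - (- h' + g) \<in> V" using right_coset_absorb[OF oV _ *(9)] * J by auto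
      then have "- h + h' \<in> V" by (simp add: add.assoc diff_conv_add_uminus minus_add del: add_uminus_conv_diff)
      then have "h' \<in> X" using left_coset_absorb[OF oV _ *(6)] * I by auto
      then have "X = X'" using left_cosets_disjoint[OF oV] * I by blast
      then show "p = p'" using * by simp
    qed
    have z: "overlap (A \<inter> X) (B \<inter> Y) g = 0" if "(X, Y) \<in> I \<times> J - K" for X Y
    proof -
      have "{h\<in>A \<inter> X. - h + g \<in> B \<inter> Y} = {}" using that unfolding K_def by auto
      then show ?thesis unfolding overlap_def by (metis measure_empty)
    qed
    have "overlap A B g = (\<Sum>X\<in>I. \<Sum>Y\<in>J. overlap (A \<inter> X) (B \<inter> Y) g)"
      by (rule overlap_decompose[OF I(1) J(1) A B bI dI I(3) bJ dJ J(3)])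
    also have "\<dots> = (\<Sum>(X, Y)\<in>I \<times> J. overlap (A \<inter> X) (B \<inter> Y) g)" by (rule sum.cartesian_product)
    also have "\<dots> = (\<Sum>(X, Y)\<in>K. overlap (A \<inter> X) (B \<inter> Y) g)"
      using I(1) J(1) KIJ z by (intro sum.mono_neutral_right) auto
    finally have "overlap A B g - t \<le> (\<Sum>(X, Y)\<in>K. overlap (A \<inter> X) (B \<inter> Y) g) - (\<Sum>(X, Y)\<in>K. \<tau> X Y)"
      using \<tau>(2)[OF KIJ k1 k2] by simp
    also have "\<dots> = (\<Sum>(X, Y)\<in>K. overlap (A \<inter> X) (B \<inter> Y) g - \<tau> X Y)"
      by (simp add: sum_subtractf case_prod_unfold)
    also have "\<dots> \<le> (\<Sum>(X, Y)\<in>K. max 0 (overlap (A \<inter> X) (B \<inter> Y) g - \<tau> X Y))"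
      by (intro sum_mono) auto
    also have "\<dots> \<le> (\<Sum>(X, Y)\<in>I \<times> J. max 0 (overlap (A \<inter> X) (B \<inter> Y) g - \<tau> X Y))"
      using I(1) J(1) KIJ by (intro sum_mono2) auto
    also have "\<dots> = (\<Sum>X\<in>I. \<Sum>Y\<in>J. max 0 (overlap (A \<inter> X) (B \<inter> Y) g - \<tau> X Y))"
      by (rule sum.cartesian_product[symmetric])
    finally show ?thesis by (simp add: sum_nonneg)
  qed
  have i: "integrable \<mu> (\<lambda>g. max 0 (overlap (A \<inter> X) (B \<inter> Y) g - \<tau> X Y))" if "X \<in> I" "Y \<in> J" for X Y
    by (rule overlap_excess_integrable[OF fA[OF that(1)] fB[OF that(2)] \<tau>(1)])
  have "overlap_excess t A B \<le> (\<integral>g. (\<Sum>X\<in>I. \<Sum>Y\<in>J. max 0 (overlap (A \<inter> X) (B \<inter> Y) g - \<tau> X Y)) \<partial>\<mu>)"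
    unfolding overlap_excess_def
    by (intro integral_mono overlap_excess_integrable A B t Bochner_Integration.integrable_sum i pt)
  also have "\<dots> = (\<Sum>X\<in>I. \<Sum>Y\<in>J. overlap_excess (\<tau> X Y) (A \<inter> X) (B \<inter> Y))"
    unfolding overlap_excess_def
    by (subst Bochner_Integration.integral_sum; (intro Bochner_Integration.integrable_sum i)?; assumption?)
      (intro sum.cong refl Bochner_Integration.integral_sum i)
  also have "\<dots> \<le> (\<Sum>X\<in>I. \<Sum>Y\<in>J. max 0 (a X - \<tau> X Y) * max 0 (b Y - \<tau> X Y))"
    by (intro sum_mono ij)
  also have "\<dots> \<le> (vol A - t) * (vol B - t)" using \<tau>(3) unfolding sa sb .
  finally show ?thesis .
qed

text \<open>Discarding what lies outside finitely many cosets costs an error proportional to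
  \<open>e\<close>, because the integral of an overlap is a product of measures.\<close>

lemma overlap_excess_finite_subgroup:
  assumes V: "measure_minimal V" "emeasure \<mu> V < \<infinity>"
    and A: "fin A" and B: "fin B" and t: "0 \<le> t" "t \<le> vol A" "t \<le> vol B"
    and sum: "vol A + vol B \<le> vol V"
  shows "overlap_excess t A B \<le> (vol A - t) * (vol B - t)"
proof -
  have oV: "open_subgroup V" using V(1) unfolding measure_minimal_def by (rule conjunct1)
  let ?a = "vol A" and ?b = "vol B"
  have "overlap_excess t A B \<le> (?a - t) * (?b - t) + e * (?a + ?b)" if e: "0 < e" for e
  proof -
    obtain I where I: "finite I" "I \<subseteq> left_cosets V" "vol (A - \<Union>I) < e"
      by (rule finite_open_cover_almost[OF A e open_cosets(1)[OF oV] cosets_cover(1)[OF oV]])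
    obtain J where J: "finite J" "J \<subseteq> right_cosets V" "vol (B - \<Union>J) < e"
      by (rule finite_open_cover_almost[OF B e open_cosets(2)[OF oV] cosets_cover(2)[OF oV]])
    have o: "open (\<Union>I)" "open (\<Union>J)" using I(2) J(2) open_cosets[OF oV] by (auto intro!: open_Union)
    define A' A'' B' B'' where "A' = A \<inter> \<Union>I" and "A'' = A - \<Union>I" and "B' = B \<inter> \<Union>J" and "B'' = B - \<Union>J"
    have "fin A'" "fin A''" unfolding A'_def A''_def using o finD(1)[OF A]
      by (intro fin_subset[OF A]; auto)+
    moreover have "fin B'" "fin B''" unfolding B'_def B''_def using o finD(1)[OF B]
      by (intro fin_subset[OF B]; auto)+
    ultimately have f: "fin A'" "fin A''" "fin B'" "fin B''" by auto
    have un: "A' \<union> A'' = A" "B' \<union> B'' = B" unfolding A'_def A''_def B'_def B''_def by auto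
    have le: "vol A' \<le> ?a" "vol B' \<le> ?b"
      using f A B un by (auto intro!: measure_mono_fmeasurable dest: finD(1))
    have "overlap_excess t A B \<le> (\<integral>g. max 0 (overlap A' B' g - t) + overlap A'' B g + overlap A' B'' g \<partial>\<mu>)"
      unfolding overlap_excess_def
    proof (intro integral_mono overlap_excess_integrable Bochner_Integration.integrable_add overlap_integrable A B f t)
      fix g
      show "max 0 (overlap A B g - t) \<le> max 0 (overlap A' B' g - t) + overlap A'' B g + overlap A' B'' g"
        using overlap_split[OF f, of g] overlap_nonneg[of A'' B g] overlap_nonneg[of A' B'' g]
        unfolding un by linarith
    qed
    also have "\<dots> = overlap_excess t A' B' + vol A'' * ?b + vol A' * vol B''"
      unfolding overlap_excess_def
      using overlap_integral[OF f(2) B] overlap_integral[OF f(1,4)] overlap_integrable[OF f(2) B]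
        overlap_integrable[OF f(1,4)] overlap_excess_integrable[OF f(1,3) t(1)] by simp
    also have "vol A'' * ?b \<le> e * ?b" using I unfolding A''_def by (intro mult_right_mono) auto
    also have "vol A' * vol B'' \<le> ?a * e" using J le unfolding B''_def by (intro mult_mono) auto
    also have "overlap_excess t A' B' \<le> (?a - t) * (?b - t)"
    proof (cases "t \<le> vol A' \<and> t \<le> vol B'")
      case True
      then have "overlap_excess t A' B' \<le> (vol A' - t) * (vol B' - t)"
        using f sum le t by (intro overlap_excess_coset_union[OF V I(1,2) _ J(1,2)]) (auto simp: A'_def B'_def)
      also have "\<dots> \<le> (?a - t) * (?b - t)" using True le by (intro mult_mono) auto
      finally show ?thesis .
    next
      case False
      then have "overlap_excess t A' B' = 0" by (intro overlap_excess_eq_0 f) auto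
      then show ?thesis using t by simp
    qed
    finally show ?thesis by (simp add: algebra_simps)
  qed
  then show ?thesis by (rule real_le_mult_epsilon)
qed

text \<open>An open subgroup of measure below \<open>2 * m(G)\<close> has no proper open subgroup,
  because two disjoint cosets of one would already have measure at least
  \<open>2 * m(G)\<close>.\<close>

lemma measure_minimal_exists:
  assumes "min_open_subgroup \<mu> < \<infinity>" "0 < min_open_subgroup \<mu>"
  obtains V where "measure_minimal V" "emeasure \<mu> V < \<infinity>" "min_open_subgroup \<mu> \<le> emeasure \<mu> V"
proof -
  let ?m = "min_open_subgroup \<mu>"
  have min: "?m \<le> emeasure \<mu> N" if "open_subgroup N" for N
    unfolding min_open_subgroup_def using that by (intro INF_lower) auto
  obtain r where r: "?m = ennreal r" "0 < r" using assms by (cases ?m) auto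
  have "?m < ennreal (2 * r)" unfolding r using r(2) by (intro ennreal_lessI) auto
  then obtain V where V: "open_subgroup V" "emeasure \<mu> V < ennreal (2 * r)"
    unfolding min_open_subgroup_def Inf_less_iff by auto
  have "N = V" if N: "open_subgroup N" "N \<subseteq> V" for N
  proof (rule ccontr)
    assume "N \<noteq> V"
    then obtain x where x: "x \<in> V" "x \<notin> N" using N by auto
    let ?M = "{y. - x + y \<in> N}"
    have Nb: "N \<in> sets borel" using open_subgroupD(1)[OF N(1)] by simp
    have "open ((\<lambda>y. - x + y) -` N)" using open_subgroupD(1)[OF N(1)] by (intro open_vimage continuous_intros)
    then have Mb: "?M \<in> sets borel" by (simp add: vimage_def)
    have disj: "N \<inter> ?M = {}"
    proof (rule ccontr)
      assume "N \<inter> ?M \<noteq> {}"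
      then obtain y where y: "y \<in> N" "- x + y \<in> N" by auto
      from open_subgroupD(3)[OF N(1) y(1) open_subgroupD(4)[OF N(1) y(2)]] x(2)
      show False by (simp add: minus_add)
    qed
    have MV: "?M \<subseteq> V"
    proof
      fix y assume "y \<in> ?M"
      then have "- x + y \<in> V" using N by auto
      from open_subgroupD(3)[OF V(1) x(1) this] show "y \<in> V" by (simp flip: add.assoc)
    qed
    have "?m + ?m \<le> emeasure \<mu> N + emeasure \<mu> ?M"
      using min[OF N(1)] emeasure_left[OF Nb, of "- x"] by (intro add_mono) auto
    also have "\<dots> = emeasure \<mu> (N \<union> ?M)" using disj Nb Mb by (intro plus_emeasure) auto
    also have "\<dots> \<le> emeasure \<mu> V"
      using N MV open_subgroupD(1)[OF V(1)] by (intro emeasure_mono) auto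
    also note V(2)
    finally show False unfolding r(1) using r(2) by (simp flip: ennreal_plus)
  qed
  then have "measure_minimal V" unfolding measure_minimal_def using V by blast
  moreover have "emeasure \<mu> V < \<infinity>" using V(2) by (rule less_trans) simp
  ultimately show ?thesis using that min[OF V(1)] by blast
qed

text \<open>If \<open>m(G)\<close> is infinite, the whole group serves as the single coset; if it is
  0, both sets are null; otherwise there is an open subgroup of finite measure without smaller
  ones.\<close>

theorem overlap_excess_le_product:
  assumes A: "fin A" and B: "fin B"
    and sum: "emeasure \<mu> A + emeasure \<mu> B \<le> min_open_subgroup \<mu>"
    and t: "0 \<le> t" "t \<le> vol A" "t \<le> vol B"
  shows "overlap_excess t A B \<le> (vol A - t) * (vol B - t)"
proof -
  let ?m = "min_open_subgroup \<mu>"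
  have min: "?m \<le> emeasure \<mu> N" if "open_subgroup N" for N
    unfolding min_open_subgroup_def using that by (intro INF_lower) auto
  consider "?m = \<infinity>" | "?m = 0" | "?m < \<infinity>" "0 < ?m"
    by (metis infinity_ennreal_def not_gr_zero top.not_eq_extremum)
  then show ?thesis
  proof cases
    case 1
    have inf: "emeasure \<mu> N = \<infinity>" if "open_subgroup N" for N
      using min[OF that] unfolding 1 by (simp add: top_unique)
    have oU: "open_subgroup (UNIV :: 'a set)" unfolding open_subgroup_def by simp
    then have U: "measure_minimal UNIV" unfolding measure_minimal_def by (simp add: inf)
    show ?thesis
      by (rule overlap_excess_coset_infinite[OF U inf[OF oU] refl refl A _ B _ t]) auto
  next
    case 2
    then have "emeasure \<mu> A = 0" "emeasure \<mu> B = 0" using sum by auto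
    then have "vol A = 0" "vol B = 0" by (simp_all add: measure_def)
    then show ?thesis using overlap_excess_le[OF A B t(1)] t by simp
  next
    case 3
    obtain V where V: "measure_minimal V" "emeasure \<mu> V < \<infinity>" "?m \<le> emeasure \<mu> V"
      by (rule measure_minimal_exists[OF 3])
    have "emeasure \<mu> V = ennreal (vol V)"
      using V by (intro emeasure_eq_ennreal_measure) auto
    then have "ennreal (vol A + vol B) \<le> ennreal (vol V)"
      using sum V(3) by (simp add: finD(3) A B)
    then have "vol A + vol B \<le> vol V" by (subst (asm) ennreal_le_iff) auto
    then show ?thesis by (intro overlap_excess_finite_subgroup[OF V(1,2) A B t])
  qed
qed

end

section \<open>Step functions and trapezoids\<close>

text \<open>For nonnegative \<open>a\<close> and \<open>b\<close>, the convolution of the indicator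
  functions of the centred intervals of these lengths.\<close>

definition trapezoid :: "real \<Rightarrow> real \<Rightarrow> real \<Rightarrow> real" where
  "trapezoid a b x = max 0 (min (min a b) ((a + b) / 2 - \<bar>x\<bar>))"

lemma trapezoid_nonneg [simp]: "0 \<le> trapezoid a b x"
  unfolding trapezoid_def by simp

lemma trapezoid_mono: "\<bar>x\<bar> \<le> \<bar>y\<bar> \<Longrightarrow> trapezoid a b y \<le> trapezoid a b x"
  unfolding trapezoid_def by (intro max.mono min.mono order_refl) linarith

lemma trapezoid_le: "0 \<le> a \<Longrightarrow> 0 \<le> b \<Longrightarrow> trapezoid a b x \<le> a \<and> trapezoid a b x \<le> b"
  unfolding trapezoid_def by linarith

lemma trapezoid_0: "0 \<le> a \<Longrightarrow> 0 \<le> b \<Longrightarrow> trapezoid a b 0 = min a b"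
  unfolding trapezoid_def by (auto simp: min_def max_def)

lemma continuous_trapezoid [continuous_intros]: "continuous_on S (trapezoid a b)"
  unfolding trapezoid_def by (intro continuous_intros)

lemma trapezoid_measurable [measurable]: "trapezoid a b \<in> borel_measurable borel"
  by (intro borel_measurable_continuous_onI continuous_intros)

text \<open>Subtracting \<open>t\<close> shortens both intervals by \<open>t\<close>, since the
  flank \<open>(a + b) / 2 - |x|\<close> drops by \<open>t\<close> as well. So the excess on the
  line is \<open>(a - t) * (b - t)\<close>, the upper bound for the group.\<close>

lemma trapezoid_truncate:
  assumes "0 \<le> t"
  shows "max 0 (trapezoid a b x - t) = trapezoid (a - t) (b - t) x"
proof -
  have 1: "max 0 (max 0 y - t) = max 0 (y - t)" for y using assms by linarith
  have 2: "min (min a b) y - t = min (min (a - t) (b - t)) (y - t)" for y by linarith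
  show ?thesis unfolding trapezoid_def 1 2 by (simp add: field_simps)
qed

lemma emeasure_interval_overlap:
  assumes "0 \<le> a" "0 \<le> b"
  shows "emeasure lborel {h. \<bar>h\<bar> < a / 2 \<and> \<bar>- h + x\<bar> < b / 2} = ennreal (trapezoid a b x)"
proof -
  define l u where "l = max (- a / 2) (x - b / 2)" and "u = min (a / 2) (x + b / 2)"
  have e: "{h. \<bar>h\<bar> < a / 2 \<and> \<bar>- h + x\<bar> < b / 2} = {l<..<u}"
  proof (intro set_eqI iffI)
    fix h assume "h \<in> {h. \<bar>h\<bar> < a / 2 \<and> \<bar>- h + x\<bar> < b / 2}"
    then have "\<bar>h\<bar> < a / 2" "\<bar>- h + x\<bar> < b / 2" by auto
    then show "h \<in> {l<..<u}" unfolding l_def u_def by (simp; linarith)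
  next
    fix h assume "h \<in> {l<..<u}"
    then have "- a / 2 < h" "x - b / 2 < h" "h < a / 2" "h < x + b / 2" unfolding l_def u_def by auto
    then have "\<bar>h\<bar> < a / 2" "\<bar>- h + x\<bar> < b / 2" by linarith+
    then show "h \<in> {h. \<bar>h\<bar> < a / 2 \<and> \<bar>- h + x\<bar> < b / 2}" by simp
  qed
  have "trapezoid a b x = max 0 (u - l)"
    using assms unfolding trapezoid_def l_def u_def
    by (cases "0 \<le> x") (auto simp: min_def max_def field_simps)
  then show ?thesis unfolding e by (cases "l \<le> u") (auto simp: max_absorb1 max_absorb2)
qed

lemma nn_integral_trapezoid:
  assumes "0 \<le> a" "0 \<le> b"
  shows "(\<integral>\<^sup>+x. ennreal (trapezoid a b x) \<partial>lborel) = ennreal (a * b)"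
proof -
  have eb: "emeasure lborel {x. \<bar>- h + x\<bar> < b / 2} = ennreal b" for h
  proof -
    have "\<bar>- h + x\<bar> < b / 2 \<longleftrightarrow> h - b / 2 < x \<and> x < h + b / 2" for x by linarith
    then have "{x. \<bar>- h + x\<bar> < b / 2} = {h - b / 2<..<h + b / 2}" by (intro set_eqI) simp
    then show ?thesis using assms by simp
  qed
  have "(\<integral>\<^sup>+x. ennreal (trapezoid a b x) \<partial>lborel) =
      (\<integral>\<^sup>+x. \<integral>\<^sup>+h. indicator {h. \<bar>h\<bar> < a / 2 \<and> \<bar>- h + x\<bar> < b / 2} h \<partial>lborel \<partial>lborel)"
    unfolding emeasure_interval_overlap[OF assms, symmetric]
    by (intro nn_integral_cong nn_integral_indicator[symmetric]) simp
  also have "\<dots> = (\<integral>\<^sup>+x. \<integral>\<^sup>+h. indicator {p. \<bar>fst p\<bar> < a / 2 \<and> \<bar>- fst p + snd p\<bar> < b / 2} (h, x) \<partial>lborel \<partial>lborel)"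
    by (simp add: indicator_def)
  also have "\<dots> = (\<integral>\<^sup>+h. \<integral>\<^sup>+x. indicator {p. \<bar>fst p\<bar> < a / 2 \<and> \<bar>- fst p + snd p\<bar> < b / 2} (h, x) \<partial>lborel \<partial>lborel)"
    by (rule lborel_pair.Fubini'[symmetric]) (simp add: case_prod_unfold)
  also have "\<dots> = (\<integral>\<^sup>+h. ennreal b * indicator {- a / 2<..<a / 2} h \<partial>lborel)"
  proof (intro nn_integral_cong)
    fix h :: real
    have "(\<integral>\<^sup>+x. indicator {p. \<bar>fst p\<bar> < a / 2 \<and> \<bar>- fst p + snd p\<bar> < b / 2} (h, x) \<partial>lborel)
        = (\<integral>\<^sup>+x. indicator {- a / 2<..<a / 2} h * indicator {x. \<bar>- h + x\<bar> < b / 2} x \<partial>lborel)"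
      by (intro nn_integral_cong) (auto simp: indicator_def abs_less_iff)
    also have "\<dots> = indicator {- a / 2<..<a / 2} h * ennreal b"
      unfolding eb[of h, symmetric] by (rule nn_integral_cmult_indicator) simp
    finally show "(\<integral>\<^sup>+x. indicator {p. \<bar>fst p\<bar> < a / 2 \<and> \<bar>- fst p + snd p\<bar> < b / 2} (h, x) \<partial>lborel)
        = ennreal b * indicator {- a / 2<..<a / 2} h" by (simp add: mult.commute)
  qed
  also have "\<dots> = ennreal b * ennreal a" using assms by (subst nn_integral_cmult_indicator) auto
  finally show ?thesis using assms by (simp add: ennreal_mult mult.commute)
qed

lemma nn_integral_trapezoid_truncate:
  assumes "0 \<le> t" "t \<le> a" "t \<le> b"
  shows "(\<integral>\<^sup>+x. ennreal (max 0 (trapezoid a b x - t)) \<partial>lborel) = ennreal ((a - t) * (b - t))"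
  unfolding trapezoid_truncate[OF assms(1)] using assms by (intro nn_integral_trapezoid) auto

context unimodular_haar
begin

lemma nn_integral_overlap_excess:
  assumes "fin A" "fin B" "0 \<le> t"
  shows "(\<integral>\<^sup>+g. ennreal (max 0 (overlap A B g - t)) \<partial>\<mu>) = ennreal (overlap_excess t A B)"
  unfolding overlap_excess_def
  by (intro nn_integral_eq_integral overlap_excess_integrable assms) auto

text \<open>
  The share of the level \<open>t\<close> given to a pair is the height of its trapezoid at a point \<open>x0\<close> that
  does not depend on the pair; so no excess is lost on the real line.
\<close>

lemma step_convolution_excess:
  fixes w :: real
  assumes w: "0 \<le> w" and fI: "finite I" "finite J"
    and A: "\<And>i. i \<in> I \<Longrightarrow> fin (A i)" and B: "\<And>j. j \<in> J \<Longrightarrow> fin (B j)"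
    and sum: "\<And>i j. i \<in> I \<Longrightarrow> j \<in> J \<Longrightarrow> emeasure \<mu> (A i) + emeasure \<mu> (B j) \<le> min_open_subgroup \<mu>"
    and t: "0 \<le> t"
  shows "(\<integral>\<^sup>+g. ennreal ((\<Sum>i\<in>I. \<Sum>j\<in>J. w * overlap (A i) (B j) g) - t) \<partial>\<mu>) \<le>
    (\<integral>\<^sup>+x. ennreal ((\<Sum>i\<in>I. \<Sum>j\<in>J. w * trapezoid (vol (A i)) (vol (B j)) x) - t) \<partial>lborel)"
    (is "?l \<le> ?r")
proof -
  define T where "T i j x = trapezoid (vol (A i)) (vol (B j)) x" for i j x
  define H where "H x = (\<Sum>i\<in>I. \<Sum>j\<in>J. w * T i j x)" for x
  have T0: "T i j 0 = min (vol (A i)) (vol (B j))" for i j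
    unfolding T_def by (simp add: trapezoid_0)
  show ?thesis
  proof (cases "H 0 \<le> t")
    \<comment> \<open>At 0 each trapezoid has height \<open>min (vol (A i)) (vol (B j))\<close>, an
      upper bound for the overlap, so the group convolution never exceeds
      \<open>H 0\<close>.\<close>
    case True
    have "(\<Sum>i\<in>I. \<Sum>j\<in>J. w * overlap (A i) (B j) g) \<le> H 0" for g
      unfolding H_def T0 using w A B
      by (intro sum_mono mult_left_mono) (auto intro: overlap_le1 overlap_le2)
    from order_trans[OF this True]
    have "ennreal ((\<Sum>i\<in>I. \<Sum>j\<in>J. w * overlap (A i) (B j) g) - t) = 0" for g
      by (intro ennreal_neg) simp
    then show ?thesis by simp
  next
    case False
    \<comment> \<open>At \<open>X\<close> all trapezoids vanish, so \<open>H\<close> takes the value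
      \<open>t\<close> somewhere between 0 and \<open>X\<close>.\<close>
    define X where "X = (\<Sum>i\<in>I. \<Sum>j\<in>J. vol (A i) + vol (B j))"
    have X0: "0 \<le> X" unfolding X_def by (intro sum_nonneg) auto
    have "T i j X = 0" if ij: "i \<in> I" "j \<in> J" for i j
    proof -
      have "vol (A i) + vol (B j) \<le> (\<Sum>j\<in>J. vol (A i) + vol (B j))"
        using ij fI member_le_sum[of j J "\<lambda>j. vol (A i) + vol (B j)"] by simp
      also have "\<dots> \<le> X" unfolding X_def
        using ij fI member_le_sum[of i I "\<lambda>i. \<Sum>j\<in>J. vol (A i) + vol (B j)"] by (simp add: sum_nonneg)
      finally show ?thesis using measure_nonneg[of \<mu> "A i"] measure_nonneg[of \<mu> "B j"]
        unfolding T_def trapezoid_def using X0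
        by (intro max_absorb1 min.coboundedI2) (simp add: abs_of_nonneg)
    qed
    then have "H X = 0" unfolding H_def by simp
    have "continuous_on {0..X} H" unfolding H_def T_def by (intro continuous_intros)
    then obtain x0 where x0: "0 \<le> x0" "x0 \<le> X" "H x0 = t"
      using IVT2'[of H X t 0] \<open>H X = 0\<close> t False X0 by auto
    have Tle: "T i j x0 \<le> vol (A i)" "T i j x0 \<le> vol (B j)" "0 \<le> T i j x0" for i j
      unfolding T_def using trapezoid_le[of "vol (A i)" "vol (B j)" x0] by auto
    have "?l \<le> (\<integral>\<^sup>+g. (\<Sum>i\<in>I. \<Sum>j\<in>J. ennreal w * ennreal (max 0 (overlap (A i) (B j) g - T i j x0))) \<partial>\<mu>)"
    proof (intro nn_integral_mono)
      fix g
      have "(\<Sum>i\<in>I. \<Sum>j\<in>J. w * overlap (A i) (B j) g) - t =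
          (\<Sum>i\<in>I. \<Sum>j\<in>J. w * (overlap (A i) (B j) g - T i j x0))"
        unfolding x0(3)[symmetric] H_def by (simp add: sum_subtractf right_diff_distrib)
      also have "\<dots> \<le> (\<Sum>i\<in>I. \<Sum>j\<in>J. w * max 0 (overlap (A i) (B j) g - T i j x0))"
        using w by (intro sum_mono mult_left_mono) auto
      finally have "ennreal ((\<Sum>i\<in>I. \<Sum>j\<in>J. w * overlap (A i) (B j) g) - t) \<le>
          ennreal (\<Sum>i\<in>I. \<Sum>j\<in>J. w * max 0 (overlap (A i) (B j) g - T i j x0))" by (rule ennreal_leI)
      also have "\<dots> = (\<Sum>i\<in>I. \<Sum>j\<in>J. ennreal w * ennreal (max 0 (overlap (A i) (B j) g - T i j x0)))"
        using w by (simp add: sum_ennreal[symmetric] sum_nonneg ennreal_mult)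
      finally show "ennreal ((\<Sum>i\<in>I. \<Sum>j\<in>J. w * overlap (A i) (B j) g) - t) \<le>
          (\<Sum>i\<in>I. \<Sum>j\<in>J. ennreal w * ennreal (max 0 (overlap (A i) (B j) g - T i j x0)))" .
    qed
    also have "\<dots> = (\<Sum>i\<in>I. \<Sum>j\<in>J. ennreal w * ennreal (overlap_excess (T i j x0) (A i) (B j)))"
    proof -
      have m: "(\<lambda>g. ennreal (max 0 (overlap (A i) (B j) g - T i j x0))) \<in> borel_measurable \<mu>"
        if "i \<in> I" "j \<in> J" for i j using overlap_measurable[OF A[OF that(1)] B[OF that(2)]] by measurable
      show ?thesis
        using m A B Tle
        by (subst nn_integral_sum; (intro borel_measurable_sum borel_measurable_times_ennreal borel_measurable_const)?; simp?)
          (intro sum.cong refl, subst nn_integral_sum; simp add: nn_integral_cmult nn_integral_overlap_excess)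
    qed
    also have "\<dots> \<le> (\<Sum>i\<in>I. \<Sum>j\<in>J. ennreal w * ennreal ((vol (A i) - T i j x0) * (vol (B j) - T i j x0)))"
      by (intro sum_mono mult_left_mono ennreal_leI overlap_excess_le_product A B sum Tle) auto
    also have "\<dots> = (\<Sum>i\<in>I. \<Sum>j\<in>J. ennreal w * (\<integral>\<^sup>+x. ennreal (max 0 (T i j x - T i j x0)) \<partial>lborel))"
      unfolding T_def[of _ _ x for x] 
      by (subst nn_integral_trapezoid_truncate) (use Tle in \<open>auto simp: T_def\<close>)
    also have "\<dots> = (\<integral>\<^sup>+x. (\<Sum>i\<in>I. \<Sum>j\<in>J. ennreal w * ennreal (max 0 (T i j x - T i j x0))) \<partial>lborel)"
      unfolding T_def by (simp add: nn_integral_sum nn_integral_cmult)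
    also have "\<dots> = (\<integral>\<^sup>+x. ennreal (H x - t) \<partial>lborel)"
    proof (intro nn_integral_cong)
      fix x :: real
      have "(\<Sum>i\<in>I. \<Sum>j\<in>J. ennreal w * ennreal (max 0 (T i j x - T i j x0))) =
          ennreal (\<Sum>i\<in>I. \<Sum>j\<in>J. w * max 0 (T i j x - T i j x0))"
        using w by (simp add: sum_ennreal[symmetric] sum_nonneg ennreal_mult)
      also have "\<dots> = ennreal (H x - t)"
      \<comment> \<open>All trapezoids decrease in \<open>|x|\<close>, so their differences from the
        values at \<open>x0\<close> share one sign, and the positive parts add up to the positive
        part of the sum.\<close>
      proof (cases "\<bar>x\<bar> \<le> \<bar>x0\<bar>")
        case True
        then have "max 0 (T i j x - T i j x0) = T i j x - T i j x0" for i j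
          unfolding T_def using trapezoid_mono by (simp add: max_absorb2)
        then show ?thesis unfolding x0(3)[symmetric] H_def by (simp add: sum_subtractf right_diff_distrib)
      next
        case False
        then have le: "T i j x \<le> T i j x0" for i j unfolding T_def by (intro trapezoid_mono) auto
        then have "max 0 (T i j x - T i j x0) = 0" for i j by (simp add: max_absorb1)
        moreover have "H x \<le> H x0" unfolding H_def using w le by (intro sum_mono mult_left_mono)
        ultimately show ?thesis using x0(3) by (simp add: ennreal_neg)
      qed
      finally show "(\<Sum>i\<in>I. \<Sum>j\<in>J. ennreal w * ennreal (max 0 (T i j x - T i j x0))) = ennreal (H x - t)" .
    qed
    finally show ?thesis unfolding H_def T_def .
  qed
qed

text \<open>Equality of the total masses is what later reverses the comparison for concave
  functions.\<close>

lemma step_convolution_mass: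
  fixes w :: real
  assumes w: "0 \<le> w" and fI: "finite I" "finite J"
    and A: "\<And>i. i \<in> I \<Longrightarrow> fin (A i)" and B: "\<And>j. j \<in> J \<Longrightarrow> fin (B j)"
  shows "(\<integral>\<^sup>+g. ennreal (\<Sum>i\<in>I. \<Sum>j\<in>J. w * overlap (A i) (B j) g) \<partial>\<mu>) =
      ennreal (\<Sum>i\<in>I. \<Sum>j\<in>J. w * (vol (A i) * vol (B j)))"
    "(\<integral>\<^sup>+x. ennreal (\<Sum>i\<in>I. \<Sum>j\<in>J. w * trapezoid (vol (A i)) (vol (B j)) x) \<partial>lborel) =
      ennreal (\<Sum>i\<in>I. \<Sum>j\<in>J. w * (vol (A i) * vol (B j)))"
proof -
  have "(\<integral>\<^sup>+g. ennreal (\<Sum>i\<in>I. \<Sum>j\<in>J. w * overlap (A i) (B j) g) \<partial>\<mu>) =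
      ennreal (\<integral>g. (\<Sum>i\<in>I. \<Sum>j\<in>J. w * overlap (A i) (B j) g) \<partial>\<mu>)"
    using w A B by (intro nn_integral_eq_integral Bochner_Integration.integrable_sum integrable_mult_right
        overlap_integrable) (auto intro!: sum_nonneg)
  also have "(\<integral>g. (\<Sum>i\<in>I. \<Sum>j\<in>J. w * overlap (A i) (B j) g) \<partial>\<mu>) =
      (\<Sum>i\<in>I. \<integral>g. (\<Sum>j\<in>J. w * overlap (A i) (B j) g) \<partial>\<mu>)"
    using A B by (intro Bochner_Integration.integral_sum Bochner_Integration.integrable_sum
        integrable_mult_right overlap_integrable)
  also have "\<dots> = (\<Sum>i\<in>I. \<Sum>j\<in>J. \<integral>g. w * overlap (A i) (B j) g \<partial>\<mu>)"
    using A B by (intro sum.cong refl Bochner_Integration.integral_sum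
        integrable_mult_right overlap_integrable)
  also have "\<dots> = (\<Sum>i\<in>I. \<Sum>j\<in>J. w * (vol (A i) * vol (B j)))"
    using A B by (simp add: overlap_integral)
  finally show "(\<integral>\<^sup>+g. ennreal (\<Sum>i\<in>I. \<Sum>j\<in>J. w * overlap (A i) (B j) g) \<partial>\<mu>) =
      ennreal (\<Sum>i\<in>I. \<Sum>j\<in>J. w * (vol (A i) * vol (B j)))" .
  have "(\<integral>\<^sup>+x. ennreal (\<Sum>i\<in>I. \<Sum>j\<in>J. w * trapezoid (vol (A i)) (vol (B j)) x) \<partial>lborel) =
     (\<integral>\<^sup>+x. (\<Sum>i\<in>I. \<Sum>j\<in>J. ennreal w * ennreal (trapezoid (vol (A i)) (vol (B j)) x)) \<partial>lborel)"
    using w by (simp add: sum_ennreal[symmetric] sum_nonneg ennreal_mult)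
  also have "\<dots> = (\<Sum>i\<in>I. \<Sum>j\<in>J. ennreal w * ennreal (vol (A i) * vol (B j)))"
    by (simp add: nn_integral_sum nn_integral_cmult nn_integral_trapezoid)
  also have "\<dots> = ennreal (\<Sum>i\<in>I. \<Sum>j\<in>J. w * (vol (A i) * vol (B j)))"
    using w by (simp add: sum_ennreal[symmetric] sum_nonneg ennreal_mult)
  finally show "(\<integral>\<^sup>+x. ennreal (\<Sum>i\<in>I. \<Sum>j\<in>J. w * trapezoid (vol (A i)) (vol (B j)) x) \<partial>lborel) =
      ennreal (\<Sum>i\<in>I. \<Sum>j\<in>J. w * (vol (A i) * vol (B j)))" .
qed

end

section \<open>Approximation of convolutions\<close>

text \<open>The superlevel sets of the rearrangement are thus centred open intervals of the same
  measure as those of \<open>\<phi>\<close>. For the direction from right to left, the infimum must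
  be strictly above \<open>s\<close>, which follows from continuity from below along the levels
  \<open>s + 1 / (n + 1)\<close>.\<close>

lemma rearrangement_greater_iff:
  assumes [measurable]: "\<phi> \<in> borel_measurable M" and s: "0 \<le> s"
  shows "ennreal s < rearrangement M \<phi> x \<longleftrightarrow> ennreal (2 * \<bar>x\<bar>) < emeasure M {g\<in>space M. s < \<phi> g}"
proof
  assume l: "ennreal s < rearrangement M \<phi> x"
  show "ennreal (2 * \<bar>x\<bar>) < emeasure M {g\<in>space M. s < \<phi> g}"
  proof (rule ccontr)
    assume "\<not> ?thesis"
    then have "rearrangement M \<phi> x \<le> ennreal s"
      unfolding rearrangement_def using s by (intro Inf_lower) auto
    with l show False by simp
  qed
next
  assume l: "ennreal (2 * \<bar>x\<bar>) < emeasure M {g\<in>space M. s < \<phi> g}"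
  have "incseq (\<lambda>n. {g\<in>space M. s + 1 / real (Suc n) < \<phi> g})"
  proof (intro incseq_SucI subsetI)
    fix n g assume "g \<in> {g\<in>space M. s + 1 / real (Suc n) < \<phi> g}"
    moreover have "1 / real (Suc (Suc n)) \<le> 1 / real (Suc n)" by (intro divide_left_mono) auto
    ultimately show "g \<in> {g\<in>space M. s + 1 / real (Suc (Suc n)) < \<phi> g}" by auto
  qed
  then have "(\<lambda>n. emeasure M {g\<in>space M. s + 1 / real (Suc n) < \<phi> g}) \<longlonglongrightarrow>
      emeasure M (\<Union>n. {g\<in>space M. s + 1 / real (Suc n) < \<phi> g})"
    by (intro Lim_emeasure_incseq) auto
  also have "(\<Union>n. {g\<in>space M. s + 1 / real (Suc n) < \<phi> g}) = {g\<in>space M. s < \<phi> g}"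
  proof (intro set_eqI iffI)
    fix g assume "g \<in> {g\<in>space M. s < \<phi> g}"
    then have g: "g \<in> space M" "0 < \<phi> g - s" by auto
    obtain n where "1 / real (Suc n) < \<phi> g - s" using nat_approx_posE[OF g(2)] .
    then show "g \<in> (\<Union>n. {g\<in>space M. s + 1 / real (Suc n) < \<phi> g})" using g by (auto intro!: exI[of _ n])
  next
    fix g assume "g \<in> (\<Union>n. {g\<in>space M. s + 1 / real (Suc n) < \<phi> g})"
    then obtain n where n: "g \<in> space M" "s + 1 / real (Suc n) < \<phi> g" by blast
    have "0 < 1 / real (Suc n)" by simp
    with n(2) have "s < \<phi> g" by linarith
    with n(1) show "g \<in> {g\<in>space M. s < \<phi> g}" by simp
  qed
  finally have "\<forall>\<^sub>F n in sequentially. ennreal (2 * \<bar>x\<bar>) < emeasure M {g\<in>space M. s + 1 / real (Suc n) < \<phi> g}"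
    using l by (rule order_tendstoD(1))
  then obtain n where n: "ennreal (2 * \<bar>x\<bar>) < emeasure M {g\<in>space M. s + 1 / real (Suc n) < \<phi> g}"
    by (auto simp: eventually_sequentially)
  have "ennreal s < ennreal (s + 1 / real (Suc n))" using s by (intro ennreal_lessI) (auto intro: add_nonneg_pos)
  also have "\<dots> \<le> rearrangement M \<phi> x"
    unfolding rearrangement_def
  proof (rule Inf_greatest, safe)
    fix t :: real assume t: "0 \<le> t" "emeasure M {g\<in>space M. t < \<phi> g} \<le> ennreal (2 * \<bar>x\<bar>)"
    show "ennreal (s + 1 / real (Suc n)) \<le> ennreal t"
    proof (rule ccontr)
      assume "\<not> ?thesis"
      then have "t < s + 1 / real (Suc n)" using t by (simp add: ennreal_le_iff not_le)
      then have "emeasure M {g\<in>space M. s + 1 / real (Suc n) < \<phi> g} \<le> emeasure M {g\<in>space M. t < \<phi> g}"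
        by (intro emeasure_mono) auto
      with n t show False by simp
    qed
  qed
  finally show "ennreal s < rearrangement M \<phi> x" .
qed

text \<open>Common format for the step functions on the group and on the line,
  \<open>P x n k\<close> standing for membership of \<open>x\<close> in the \<open>k\<close>-th
  layer set.\<close>

definition steps :: "('x \<Rightarrow> nat \<Rightarrow> nat \<Rightarrow> bool) \<Rightarrow> nat \<Rightarrow> 'x \<Rightarrow> ennreal" where
  "steps P n x = (\<Sum>k=1..(Suc n)^2. if P x n k then ennreal (1 / real (Suc n)) else 0)"

text \<open>The product \<open>\<infinity> * 0\<close> is harmless here, since a sequence bounded by \<open>0\<close> vanishes.\<close>

lemma tendsto_mult_below:
  fixes a b :: "nat \<Rightarrow> ennreal"
  assumes "a \<longlonglongrightarrow> x" "b \<longlonglongrightarrow> y" "\<And>n. a n \<le> x" "\<And>n. b n \<le> y"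
  shows "(\<lambda>n. a n * b n) \<longlonglongrightarrow> x * y"
proof (cases "x = 0 \<or> y = 0")
  case True
  then have "a n = 0 \<or> b n = 0" for n using assms(3,4)[of n] by auto
  then have "(\<lambda>n. a n * b n) = (\<lambda>n. 0)" by auto
  then show ?thesis using True by auto
next
  case False
  then show ?thesis by (intro tendsto_mult_ennreal assms) auto
qed

text \<open>The step functions are in general not monotone in \<open>n\<close>, so Fatou's lemma
  provides the lower bound and the pointwise bounds the upper one.\<close>

lemma convolve_tendsto:
  fixes u v :: "'g::group_add \<Rightarrow> ennreal"
  assumes meas: "\<And>n. U n \<in> borel_measurable M" "\<And>n. (\<lambda>h. V n (- h + g)) \<in> borel_measurable M"
    and le: "\<And>n h. U n h \<le> u h" "\<And>n h. V n h \<le> v h"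
    and lim: "\<And>h. (\<lambda>n. U n h) \<longlonglongrightarrow> u h" "\<And>h. (\<lambda>n. V n h) \<longlonglongrightarrow> v h"
  shows "convolve M (U n) (V n) g \<le> convolve M u v g"
    "(\<lambda>n. convolve M (U n) (V n) g) \<longlonglongrightarrow> convolve M u v g"
proof -
  show up: "convolve M (U n) (V n) g \<le> convolve M u v g" for n
    unfolding convolve_def by (intro nn_integral_mono mult_mono le) auto
  have l: "(\<lambda>n. U n h * V n (- h + g)) \<longlonglongrightarrow> u h * v (- h + g)" for h
    by (rule tendsto_mult_below[OF lim le])
  have "convolve M u v g = (\<integral>\<^sup>+h. liminf (\<lambda>n. U n h * V n (- h + g)) \<partial>M)"
    unfolding convolve_def by (simp add: lim_imp_Liminf[OF _ l])
  also have "\<dots> \<le> liminf (\<lambda>n. convolve M (U n) (V n) g)"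
    unfolding convolve_def using meas by (intro nn_integral_liminf) measurable
  finally have low: "convolve M u v g \<le> liminf (\<lambda>n. convolve M (U n) (V n) g)" .
  have "limsup (\<lambda>n. convolve M (U n) (V n) g) \<le> convolve M u v g"
    using up by (intro Limsup_bounded always_eventually) auto
  with low Liminf_le_Limsup[of sequentially "\<lambda>n. convolve M (U n) (V n) g"]
  show "(\<lambda>n. convolve M (U n) (V n) g) \<longlonglongrightarrow> convolve M u v g"
    by (intro Liminf_eq_Limsup) (auto intro: antisym)
qed

lemma convolve_steps:
  fixes M :: "'g::group_add measure"
  assumes [measurable]: "\<And>k. {h\<in>space M. P h n k} \<in> sets M" "\<And>k. {h\<in>space M. Q (- h + g) n k} \<in> sets M"
  shows "convolve M (steps P n) (steps Q n) g =
    (\<Sum>i=1..(Suc n)^2. \<Sum>j=1..(Suc n)^2. ennreal ((1 / real (Suc n))^2) * emeasure M {h\<in>space M. P h n i \<and> Q (- h + g) n j})"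
proof -
  define d where "d = 1 / real (Suc n)"
  have "convolve M (steps P n) (steps Q n) g =
      (\<integral>\<^sup>+h. (\<Sum>i=1..(Suc n)^2. \<Sum>j=1..(Suc n)^2. ennreal (d\<^sup>2) * indicator {h\<in>space M. P h n i \<and> Q (- h + g) n j} h) \<partial>M)"
    unfolding convolve_def steps_def sum_product d_def[symmetric]
    by (intro nn_integral_cong sum.cong refl)
      (auto simp: indicator_def power2_eq_square d_def simp flip: ennreal_mult')
  also have "\<dots> = (\<Sum>i=1..(Suc n)^2. \<Sum>j=1..(Suc n)^2. \<integral>\<^sup>+h. ennreal (d\<^sup>2) * indicator {h\<in>space M. P h n i \<and> Q (- h + g) n j} h \<partial>M)"
    by (subst nn_integral_sum; measurable?) (intro sum.cong refl nn_integral_sum; measurable)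
  also have "\<dots> = (\<Sum>i=1..(Suc n)^2. \<Sum>j=1..(Suc n)^2. ennreal (d\<^sup>2) * emeasure M {h\<in>space M. P h n i \<and> Q (- h + g) n j})"
    by (intro sum.cong refl nn_integral_cmult_indicator) measurable
  finally show ?thesis unfolding d_def .
qed

definition approximates :: "'x measure \<Rightarrow> (nat \<Rightarrow> 'x \<Rightarrow> real) \<Rightarrow> ('x \<Rightarrow> ennreal) \<Rightarrow> bool" where
  "approximates M u c \<longleftrightarrow> (\<forall>n. u n \<in> borel_measurable M) \<and> (\<forall>n x. 0 \<le> u n x) \<and>
     (\<forall>n x. ennreal (u n x) \<le> c x) \<and> (\<forall>x. (\<lambda>n. ennreal (u n x)) \<longlonglongrightarrow> c x)"

context unimodular_haar
begin

section \<open>Step functions over sets of finite measure\<close>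

lemma exhausting_sequence:
  assumes "nonneg_measurable \<mu> \<phi>"
  obtains E where "\<And>n::nat. fin (E n)" "incseq E" "(\<Union>n. E n) = supp \<phi>"
proof -
  have \<phi>: "\<phi> \<in> borel_measurable borel" and sf: "sigma_finite_measure (restrict_space \<mu> (supp \<phi>))"
    using assms unfolding nonneg_measurable_def by (auto cong: measurable_cong_sets)
  have S: "supp \<phi> \<in> sets borel" unfolding supp_def using \<phi> by measurable
  obtain E :: "nat \<Rightarrow> 'a set" where E: "range E \<subseteq> sets (restrict_space \<mu> (supp \<phi>))"
      "(\<Union>i. E i) = space (restrict_space \<mu> (supp \<phi>))"
      "\<And>i. emeasure (restrict_space \<mu> (supp \<phi>)) (E i) \<noteq> \<infinity>" "incseq E"
    using sigma_finite_measure.sigma_finite_incseq[OF sf] by metis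
  have En: "E n \<in> sets \<mu> \<and> E n \<subseteq> supp \<phi>" for n
    using E(1) sets_restrict_space_iff[of "supp \<phi>" \<mu> "E n"] S by auto
  have "fin (E n)" for n
    using En[of n] E(3)[of n] S by (auto simp: fmeasurable_def emeasure_restrict_space less_top)
  moreover have "(\<Union>n. E n) = supp \<phi>" using E(2) by (simp add: space_restrict_space)
  ultimately show ?thesis using that E(4) by blast
qed

text \<open>The same sets \<open>L n k\<close> serve both sides: the \<open>k\<close>-th layer on
  the line is the centred open interval of length \<open>vol (L n k)\<close>. Cutting with
  \<open>E n\<close> makes all these measures finite.\<close>

lemma steps_tendsto:
  assumes "nonneg_measurable \<mu> \<phi>" and E: "\<And>n. fin (E n)" "incseq E" "(\<Union>n. E n) = supp \<phi>"
  defines "L n k \<equiv> {g. g \<in> E n \<and> real k * (1 / real (Suc n)) < \<phi> g}"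
  shows "fin (L n k)" "emeasure \<mu> (L n k) \<le> emeasure \<mu> (supp \<phi>)"
    "steps (\<lambda>g n k. g \<in> L n k) n g \<le> ennreal (\<phi> g)"
    "(\<lambda>n. steps (\<lambda>g n k. g \<in> L n k) n g) \<longlonglongrightarrow> ennreal (\<phi> g)"
    "steps (\<lambda>x n k. \<bar>x\<bar> < vol (L n k) / 2) n x \<le> rearrangement \<mu> \<phi> x"
    "(\<lambda>n. steps (\<lambda>x n k. \<bar>x\<bar> < vol (L n k) / 2) n x) \<longlonglongrightarrow> rearrangement \<mu> \<phi> x"
proof -
  have [measurable]: "\<phi> \<in> borel_measurable borel" and pos: "\<And>g. 0 \<le> \<phi> g"
    using assms(1) unfolding nonneg_measurable_def by (auto cong: measurable_cong_sets)
  have [measurable]: "E n \<in> sets borel" for n by (rule finD(1)[OF E(1)])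
  have Ls: "L n k \<in> sets borel" for n k unfolding L_def by measurable
  show fL: "fin (L n k)" for n k by (rule fin_subset[OF E(1) Ls]) (auto simp: L_def)
  have Ssets: "supp \<phi> \<in> sets borel" unfolding supp_def by measurable
  show "emeasure \<mu> (L n k) \<le> emeasure \<mu> (supp \<phi>)"
    using E(3) Ssets by (intro emeasure_mono) (auto simp: L_def)
  have up: "ennreal (real k * (1 / real (Suc n))) \<le> ennreal (\<phi> g)" if "g \<in> L n k" for n k g
    using that by (intro ennreal_leI) (auto simp: L_def)
  show "steps (\<lambda>g n k. g \<in> L n k) n g \<le> ennreal (\<phi> g)"
    unfolding steps_def by (rule step_sum_le) (use up in auto)
  show "(\<lambda>n. steps (\<lambda>g n k. g \<in> L n k) n g) \<longlonglongrightarrow> ennreal (\<phi> g)"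
    unfolding steps_def
  proof (rule step_sum_tendsto[OF up])
    fix s :: real assume s: "0 \<le> s" "ennreal s < ennreal (\<phi> g)"
    then have "s < \<phi> g" by (simp add: ennreal_less_iff)
    then have "g \<in> supp \<phi>" using s(1) unfolding supp_def by auto
    then obtain m where m: "g \<in> E m" using E(3) by blast
    show "\<forall>\<^sub>F n in sequentially. \<forall>k\<ge>1. real k * (1 / real (Suc n)) \<le> s \<longrightarrow> g \<in> L n k"
    proof (rule eventually_sequentiallyI[of m])
      fix n assume "m \<le> n"
      then have "g \<in> E n" using m E(2) unfolding incseq_def by blast
      then show "\<forall>k\<ge>1. real k * (1 / real (Suc n)) \<le> s \<longrightarrow> g \<in> L n k"
        using \<open>s < \<phi> g\<close> unfolding L_def by auto
    qed
  qed auto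
  have upr: "ennreal (real k * (1 / real (Suc n))) \<le> rearrangement \<mu> \<phi> x" if l: "\<bar>x\<bar> < vol (L n k) / 2" for n k x
  proof -
    have "ennreal (2 * \<bar>x\<bar>) < ennreal (vol (L n k))" using l by (intro ennreal_lessI) auto
    also have "\<dots> = emeasure \<mu> (L n k)" by (rule finD(3)[OF fL, symmetric])
    also have "\<dots> \<le> emeasure \<mu> {g\<in>space \<mu>. real k * (1 / real (Suc n)) < \<phi> g}"
      by (intro emeasure_mono) (auto simp: L_def)
    finally have "ennreal (real k * (1 / real (Suc n))) < rearrangement \<mu> \<phi> x"
      by (subst rearrangement_greater_iff) (auto cong: measurable_cong_sets)
    then show ?thesis by simp
  qed
  show "steps (\<lambda>x n k. \<bar>x\<bar> < vol (L n k) / 2) n x \<le> rearrangement \<mu> \<phi> x"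
    unfolding steps_def by (rule step_sum_le) (use upr in auto)
  show "(\<lambda>n. steps (\<lambda>x n k. \<bar>x\<bar> < vol (L n k) / 2) n x) \<longlonglongrightarrow> rearrangement \<mu> \<phi> x"
    unfolding steps_def
  proof (rule step_sum_tendsto[OF upr])
    fix s :: real assume s: "0 \<le> s" "ennreal s < rearrangement \<mu> \<phi> x"
    then have l: "ennreal (2 * \<bar>x\<bar>) < emeasure \<mu> {g\<in>space \<mu>. s < \<phi> g}"
      by (subst (asm) rearrangement_greater_iff) (auto cong: measurable_cong_sets)
    \<comment> \<open>As \<open>E n\<close> exhausts the support, the intervals of all layers up to
      height \<open>s\<close> eventually contain \<open>x\<close>.\<close>
    have "(\<lambda>n. emeasure \<mu> (E n \<inter> {g. s < \<phi> g})) \<longlonglongrightarrow> emeasure \<mu> (\<Union>n. E n \<inter> {g. s < \<phi> g})"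
      using E(2) by (intro Lim_emeasure_incseq) (auto simp: incseq_def)
    also have "(\<Union>n. E n \<inter> {g. s < \<phi> g}) = {g\<in>space \<mu>. s < \<phi> g}"
    proof -
      have "(\<Union>n. E n \<inter> {g. s < \<phi> g}) = supp \<phi> \<inter> {g. s < \<phi> g}" unfolding E(3)[symmetric] by auto
      also have "\<dots> = {g\<in>space \<mu>. s < \<phi> g}" using s(1) unfolding supp_def by auto
      finally show ?thesis .
    qed
    finally have "\<forall>\<^sub>F n in sequentially. ennreal (2 * \<bar>x\<bar>) < emeasure \<mu> (E n \<inter> {g. s < \<phi> g})"
      using l by (rule order_tendstoD(1))
    then show "\<forall>\<^sub>F n in sequentially. \<forall>k\<ge>1. real k * (1 / real (Suc n)) \<le> s \<longrightarrow> \<bar>x\<bar> < vol (L n k) / 2"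
    proof eventually_elim
      case (elim n)
      show ?case
      proof (intro allI impI)
        fix k :: nat assume k: "real k * (1 / real (Suc n)) \<le> s"
        have "emeasure \<mu> (E n \<inter> {g. s < \<phi> g}) \<le> emeasure \<mu> (L n k)"
          using k Ls by (intro emeasure_mono) (auto simp: L_def)
        with elim have "ennreal (2 * \<bar>x\<bar>) < ennreal (vol (L n k))"
          unfolding finD(3)[OF fL, symmetric] by (rule less_le_trans)
        then show "\<bar>x\<bar> < vol (L n k) / 2" by (simp add: ennreal_less_iff)
      qed
    qed
  qed auto
qed

text \<open>Convolving step functions gives weighted sums of overlaps on the group and, with the
  same weights and measures, of trapezoids on the line, so the inequalities for steps apply at every
  \<open>n\<close>. From here on the group enters only through these conclusions.\<close>

theorem convolution_approximation:
  assumes \<phi>: "nonneg_measurable \<mu> \<phi>\<^sub>1" "nonneg_measurable \<mu> \<phi>\<^sub>2"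
    and sum: "emeasure \<mu> (supp \<phi>\<^sub>1) + emeasure \<mu> (supp \<phi>\<^sub>2) \<le> min_open_subgroup \<mu>"
  obtains u v where
    "approximates \<mu> u (convolve \<mu> (\<lambda>g. ennreal (\<phi>\<^sub>1 g)) (\<lambda>g. ennreal (\<phi>\<^sub>2 g)))"
    "approximates lborel v (convolve lborel (rearrangement \<mu> \<phi>\<^sub>1) (rearrangement \<mu> \<phi>\<^sub>2))"
    "\<And>n t. 0 \<le> t \<Longrightarrow> (\<integral>\<^sup>+g. ennreal (u n g - t) \<partial>\<mu>) \<le> (\<integral>\<^sup>+x. ennreal (v n x - t) \<partial>lborel)"
    "\<And>n. (\<integral>\<^sup>+g. ennreal (u n g) \<partial>\<mu>) = (\<integral>\<^sup>+x. ennreal (v n x) \<partial>lborel)"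
    "\<And>n. (\<integral>\<^sup>+g. ennreal (u n g) \<partial>\<mu>) < \<infinity>"
    "\<And>n x y. \<bar>x\<bar> \<le> \<bar>y\<bar> \<Longrightarrow> v n y \<le> v n x"
proof -
  obtain E1 where E1: "\<And>n::nat. fin (E1 n)" "incseq E1" "(\<Union>n. E1 n) = supp \<phi>\<^sub>1"
    by (rule exhausting_sequence[OF \<phi>(1)]) (rule that)
  obtain E2 where E2: "\<And>n::nat. fin (E2 n)" "incseq E2" "(\<Union>n. E2 n) = supp \<phi>\<^sub>2"
    by (rule exhausting_sequence[OF \<phi>(2)]) (rule that)
  define L1 where "L1 n k = {g. g \<in> E1 n \<and> real k * (1 / real (Suc n)) < \<phi>\<^sub>1 g}" for n k
  define L2 where "L2 n k = {g. g \<in> E2 n \<and> real k * (1 / real (Suc n)) < \<phi>\<^sub>2 g}" for n k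
  note s1 = steps_tendsto[OF \<phi>(1) E1, folded L1_def]
  note s2 = steps_tendsto[OF \<phi>(2) E2, folded L2_def]
  note [measurable] = finD(1)[OF s1(1)] finD(1)[OF s2(1)]
  define w where "w n = (1 / real (Suc n))\<^sup>2" for n
  have w: "0 \<le> w n" for n unfolding w_def by simp
  define u where "u n g = (\<Sum>i=1..(Suc n)^2. \<Sum>j=1..(Suc n)^2. w n * overlap (L1 n i) (L2 n j) g)" for n g
  define v where "v n x = (\<Sum>i=1..(Suc n)^2. \<Sum>j=1..(Suc n)^2. w n * trapezoid (vol (L1 n i)) (vol (L2 n j)) x)" for n x
  have u0: "0 \<le> u n g" and v0: "0 \<le> v n x" for n g x
    unfolding u_def v_def using w by (auto intro!: sum_nonneg)
  have um: "u n \<in> borel_measurable \<mu>" for n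
    unfolding u_def using overlap_measurable[OF s1(1) s2(1)] by measurable
  have vm: "v n \<in> borel_measurable lborel" for n unfolding v_def by measurable
  let ?S1 = "steps (\<lambda>g n k. g \<in> L1 n k)" and ?S2 = "steps (\<lambda>g n k. g \<in> L2 n k)"
  let ?R1 = "steps (\<lambda>x n k. \<bar>x\<bar> < vol (L1 n k) / 2)" and ?R2 = "steps (\<lambda>x n k. \<bar>x\<bar> < vol (L2 n k) / 2)"
  have uc: "convolve \<mu> (?S1 n) (?S2 n) g = ennreal (u n g)" for n g
  proof -
    have "convolve \<mu> (?S1 n) (?S2 n) g = (\<Sum>i=1..(Suc n)^2. \<Sum>j=1..(Suc n)^2. ennreal (w n) * ennreal (overlap (L1 n i) (L2 n j) g))"
      unfolding w_def overlap_def
      by (subst convolve_steps) (auto simp: finD(3)[OF fin_overlap[OF s1(1) s2(1)]])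
    then show ?thesis unfolding u_def using w
      by (simp add: sum_ennreal[symmetric] sum_nonneg ennreal_mult)
  qed
  have vc: "convolve lborel (?R1 n) (?R2 n) x = ennreal (v n x)" for n x
  proof -
    have "convolve lborel (?R1 n) (?R2 n) x = (\<Sum>i=1..(Suc n)^2. \<Sum>j=1..(Suc n)^2.
        ennreal (w n) * ennreal (trapezoid (vol (L1 n i)) (vol (L2 n j)) x))"
      unfolding w_def emeasure_interval_overlap[OF measure_nonneg measure_nonneg, symmetric]
      by (subst convolve_steps) auto
    then show ?thesis unfolding v_def using w
      by (simp add: sum_ennreal[symmetric] sum_nonneg ennreal_mult)
  qed
  have c1: "ennreal (u n g) \<le> convolve \<mu> (\<lambda>g. ennreal (\<phi>\<^sub>1 g)) (\<lambda>g. ennreal (\<phi>\<^sub>2 g)) g"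
    "(\<lambda>n. ennreal (u n g)) \<longlonglongrightarrow> convolve \<mu> (\<lambda>g. ennreal (\<phi>\<^sub>1 g)) (\<lambda>g. ennreal (\<phi>\<^sub>2 g)) g" for n g
    unfolding uc[symmetric]
    by (rule convolve_tendsto[OF _ _ s1(3) s2(3) s1(4) s2(4)]; unfold steps_def; measurable)+
  have c2: "ennreal (v n x) \<le> convolve lborel (rearrangement \<mu> \<phi>\<^sub>1) (rearrangement \<mu> \<phi>\<^sub>2) x"
    "(\<lambda>n. ennreal (v n x)) \<longlonglongrightarrow> convolve lborel (rearrangement \<mu> \<phi>\<^sub>1) (rearrangement \<mu> \<phi>\<^sub>2) x" for n x
    unfolding vc[symmetric]
    by (rule convolve_tendsto[OF _ _ s1(5) s2(5) s1(6) s2(6)]; unfold steps_def; measurable)+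
  have pair: "emeasure \<mu> (L1 n i) + emeasure \<mu> (L2 n j) \<le> min_open_subgroup \<mu>" for n i j
    using add_mono[OF s1(2) s2(2)] sum by (rule order_trans)
  show ?thesis
  proof (rule that[of u v])
    show "approximates \<mu> u (convolve \<mu> (\<lambda>g. ennreal (\<phi>\<^sub>1 g)) (\<lambda>g. ennreal (\<phi>\<^sub>2 g)))"
      unfolding approximates_def using um u0 c1 by blast
    show "approximates lborel v (convolve lborel (rearrangement \<mu> \<phi>\<^sub>1) (rearrangement \<mu> \<phi>\<^sub>2))"
      unfolding approximates_def using vm v0 c2 by blast
    show "(\<integral>\<^sup>+g. ennreal (u n g - t) \<partial>\<mu>) \<le> (\<integral>\<^sup>+x. ennreal (v n x - t) \<partial>lborel)" if "0 \<le> t" for n t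
      unfolding u_def v_def by (rule step_convolution_excess[OF w _ _ s1(1) s2(1) pair that]) auto
    show "(\<integral>\<^sup>+g. ennreal (u n g) \<partial>\<mu>) = (\<integral>\<^sup>+x. ennreal (v n x) \<partial>lborel)" for n
      unfolding u_def v_def
      by (rule trans[OF step_convolution_mass(1)[OF w _ _ s1(1) s2(1)]
            step_convolution_mass(2)[OF w _ _ s1(1) s2(1), symmetric]]) auto
    show "(\<integral>\<^sup>+g. ennreal (u n g) \<partial>\<mu>) < \<infinity>" for n
      unfolding u_def by (subst step_convolution_mass[OF w _ _ s1(1) s2(1)]) auto
    show "v n y \<le> v n x" if "\<bar>x\<bar> \<le> \<bar>y\<bar>" for n x y
      unfolding v_def using w that by (intro sum_mono mult_left_mono trapezoid_mono)
  qed
qed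

end

section \<open>Convex order\<close>

lemma convex_on_three_points:
  fixes p :: "real \<Rightarrow> real"
  assumes p: "convex_on {0..} p" and x: "0 \<le> x" "x \<le> y" "y \<le> z"
  shows "(z - x) * p y \<le> (z - y) * p x + (y - x) * p z"
proof (cases "x = z")
  case False
  then have xz: "0 < z - x" using x by simp
  define l where "l = (y - x) / (z - x)"
  have l: "0 \<le> l" "l \<le> 1" "l * (z - x) = y - x" unfolding l_def using x xz by auto
  have "y = (1 - l) * x + l * z" using l(3) by (simp add: algebra_simps)
  then have "p y \<le> (1 - l) * p x + l * p z"
    using convex_onD[OF p l(1,2), of x z] x by simp
  then have "(z - x) * p y \<le> (z - x) * ((1 - l) * p x + l * p z)" using xz by (intro mult_left_mono) auto
  also have "\<dots> = (z - x - l * (z - x)) * p x + (l * (z - x)) * p z" by (simp add: algebra_simps)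
  also have "\<dots> = (z - y) * p x + (y - x) * p z" unfolding l(3) by simp
  finally show ?thesis .
qed (use x in auto)

lemma convex_nonneg_mono:
  fixes p :: "real \<Rightarrow> real"
  assumes p: "convex_on {0..} p" "p 0 = 0" "\<And>y. 0 \<le> y \<Longrightarrow> 0 \<le> p y" and x: "0 \<le> x" "x \<le> y"
  shows "p x \<le> p y"
proof (cases "y = 0")
  case False
  then have "0 < y" using x by simp
  have "y * p x \<le> x * p y" using convex_on_three_points[OF p(1) _ x] p(2) by simp
  also have "\<dots> \<le> y * p y" using x p(3)[of y] by (intro mult_right_mono) auto
  finally show ?thesis using \<open>0 < y\<close> by simp
qed (use x in auto)

text \<open>Convexity gives continuity only on the open half-line, so the value at 0, where
  \<open>p\<close> may jump, is treated separately.\<close>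

lemma convex_comp_measurable:
  fixes p :: "real \<Rightarrow> real"
  assumes p: "convex_on {0..} p" and [measurable]: "f \<in> borel_measurable M" and f: "\<And>x. 0 \<le> f x"
  shows "(\<lambda>x. p (f x)) \<in> borel_measurable M"
proof -
  have "convex_on {0<..} p" by (rule convex_on_subset[OF p]) auto
  then have "continuous_on {0<..} p" by (intro convex_on_continuous) auto
  then have [measurable]: "(\<lambda>y. indicator {0<..} y *\<^sub>R p y) \<in> borel_measurable borel"
    by (intro borel_measurable_continuous_on_indicator) auto
  have "(\<lambda>x. p (f x)) = (\<lambda>x. if f x = 0 then p 0 else indicator {0<..} (f x) *\<^sub>R p (f x))"
    using f by (auto simp: indicator_def less_le)
  also have "\<dots> \<in> borel_measurable M" by measurable
  finally show ?thesis .
qed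

text \<open>A convex function may jump at 0, but a nonnegative sequence bounded by 0 is constant.
  This is the reason for approximating from below throughout.\<close>

lemma convex_tendsto_below:
  fixes p :: "real \<Rightarrow> real"
  assumes p: "convex_on {0..} p" and s: "s \<longlonglongrightarrow> y" "\<And>n. 0 \<le> s n" "\<And>n. s n \<le> y"
  shows "(\<lambda>n. p (s n)) \<longlonglongrightarrow> p y"
proof (cases "y = 0")
  case True
  then have "s = (\<lambda>n. y)" using s(2,3) by (intro ext) (metis antisym)
  then show ?thesis by simp
next
  case False
  then have y: "0 < y" using s(2,3)[of 0] by simp
  have "convex_on {0<..} p" by (rule convex_on_subset[OF p]) auto
  then have "continuous_on {0<..} p" by (intro convex_on_continuous) auto
  then have "isCont p y" using y by (simp add: continuous_on_eq_continuous_at)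
  then show ?thesis using s(1) by (rule isCont_tendsto_compose)
qed

text \<open>
  The weights are the second differences of \<open>p\<close>, which makes the sum the piecewise linear
  interpolation of \<open>p\<close> at \<open>0, d, \<dots>, K * d\<close>.
\<close>

definition secant_slope :: "(real \<Rightarrow> real) \<Rightarrow> real \<Rightarrow> nat \<Rightarrow> real" where
  "secant_slope p d k = (if k = 0 then 0 else (p (real k * d) - p (real (k - 1) * d)) / d)"

definition secant_sum :: "(real \<Rightarrow> real) \<Rightarrow> real \<Rightarrow> nat \<Rightarrow> real \<Rightarrow> real" where
  "secant_sum p d K z = (\<Sum>k<K. (secant_slope p d (Suc k) - secant_slope p d k) * max 0 (z - real k * d))"

context
  fixes p :: "real \<Rightarrow> real" and d :: real
  assumes p: "convex_on {0..} p" "p 0 = 0" "\<And>y. 0 \<le> y \<Longrightarrow> 0 \<le> p y" and d: "0 < d"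
begin

lemma secant_slope_step: "secant_slope p d (Suc k) * d = p (real (Suc k) * d) - p (real k * d)"
  unfolding secant_slope_def using d by simp

lemma secant_slope_nonneg: "0 \<le> secant_slope p d k"
  unfolding secant_slope_def using d convex_nonneg_mono[OF p, of "real (k - 1) * d" "real k * d"] by auto

lemma secant_slope_mono: "secant_slope p d k \<le> secant_slope p d (Suc k)"
proof (cases k)
  case 0
  then show ?thesis using secant_slope_nonneg[of "Suc 0"] by (simp add: secant_slope_def[of _ _ 0])
next
  case (Suc j)
  have "(2 * d) * p (real (Suc j) * d) \<le> d * p (real j * d) + d * p (real (Suc (Suc j)) * d)"
    using convex_on_three_points[OF p(1), of "real j * d" "real (Suc j) * d" "real (Suc (Suc j)) * d"] d
    by (simp add: algebra_simps)
  then have "d * (2 * p (real (Suc j) * d)) \<le> d * (p (real j * d) + p (real (Suc (Suc j)) * d))"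
    by (simp add: algebra_simps)
  then have "2 * p (real (Suc j) * d) \<le> p (real j * d) + p (real (Suc (Suc j)) * d)" using d by simp
  then have "secant_slope p d (Suc j) * d \<le> secant_slope p d (Suc (Suc j)) * d"
    unfolding secant_slope_step by simp
  then show ?thesis using d Suc by simp
qed

text \<open>From the node \<open>K * d\<close> on, all hinges of the sum are active and telescope to
  the secant through the nodes \<open>K * d\<close> and \<open>(K + 1) * d\<close>.\<close>

lemma secant_sum_last:
  "real K * d \<le> z \<Longrightarrow> secant_sum p d (Suc K) z = p (real K * d) + secant_slope p d (Suc K) * (z - real K * d)"
proof (induction K)
  case 0
  then show ?case unfolding secant_sum_def using p(2) by (simp add: secant_slope_def max_absorb2)
next
  case (Suc K)
  have "real K * d \<le> real (Suc K) * d" using d by (intro mult_right_mono) auto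
  then have "secant_sum p d (Suc K) z = p (real K * d) + secant_slope p d (Suc K) * (z - real K * d)"
    using Suc by simp
  also have "secant_slope p d (Suc K) * (z - real K * d) = secant_slope p d (Suc K) * (z - real (Suc K) * d) + secant_slope p d (Suc K) * d"
    by (simp add: algebra_simps)
  finally have "secant_sum p d (Suc K) z = p (real (Suc K) * d) + secant_slope p d (Suc K) * (z - real (Suc K) * d)"
    unfolding secant_slope_step by simp
  moreover have "secant_sum p d (Suc (Suc K)) z = secant_sum p d (Suc K) z +
      (secant_slope p d (Suc (Suc K)) - secant_slope p d (Suc K)) * (z - real (Suc K) * d)"
    unfolding secant_sum_def sum.lessThan_Suc[of _ "Suc K"] using Suc.prems by (simp add: max_absorb2)
  ultimately show ?case by (simp add: algebra_simps)
qed

lemma secant_sum_before: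
  "z \<le> real K * d \<Longrightarrow> secant_sum p d (Suc K) z = secant_sum p d K z"
  unfolding secant_sum_def by (simp add: max_absorb1)

lemma secant_sum_ge: "0 \<le> z \<Longrightarrow> z \<le> real K * d \<Longrightarrow> p z \<le> secant_sum p d K z"
proof (induction K)
  case 0
  then show ?case using p(2) by (simp add: secant_sum_def)
next
  case (Suc K)
  show ?case
  proof (cases "z \<le> real K * d")
    case True
    then show ?thesis using Suc secant_sum_before by simp
  next
    case False
    have "d * p z \<le> (real (Suc K) * d - z) * p (real K * d) + (z - real K * d) * p (real (Suc K) * d)"
      using convex_on_three_points[OF p(1), of "real K * d" z "real (Suc K) * d"] False Suc.prems d
      by (simp add: algebra_simps)
    also have "\<dots> = d * p (real K * d) + (z - real K * d) * (p (real (Suc K) * d) - p (real K * d))"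
      by (simp add: algebra_simps)
    also have "\<dots> = d * secant_sum p d (Suc K) z"
      unfolding secant_slope_step[symmetric] secant_sum_last[OF less_imp_le[OF False[unfolded not_le]]]
      by (simp add: algebra_simps)
    finally show ?thesis using d by simp
  qed
qed

text \<open>To the right of its interval a secant lies below the convex function, and moving the
  argument by one mesh width reaches that region even from inside the interval.\<close>

lemma secant_sum_le: "0 \<le> z \<Longrightarrow> secant_sum p d K z \<le> p (z + d)"
proof (induction K)
  case 0
  then show ?case using p(3)[of "z + d"] d by (simp add: secant_sum_def)
next
  case (Suc K)
  show ?case
  proof (cases "z \<le> real K * d")
    case True
    then show ?thesis using Suc secant_sum_before by simp
  next
    case False
    define D where "D = p (real (Suc K) * d) - p (real K * d)"
    have z: "0 \<le> z - real K * d" using False by simp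
    have "(z + d - real K * d) * p (real (Suc K) * d) \<le> (z + d - real (Suc K) * d) * p (real K * d) + d * p (z + d)"
      using convex_on_three_points[OF p(1), of "real K * d" "real (Suc K) * d" "z + d"] False d
      by (simp add: algebra_simps)
    then have "(z - real K * d) * D + d * D + d * p (real K * d) \<le> d * p (z + d)"
      unfolding D_def by (simp add: algebra_simps)
    moreover have "0 \<le> d * D" using secant_slope_step[of K] secant_slope_nonneg[of "Suc K"] d unfolding D_def
      by (metis mult_nonneg_nonneg less_imp_le)
    ultimately have "d * p (real K * d) + (z - real K * d) * D \<le> d * p (z + d)" by simp
    also have "d * p (real K * d) + (z - real K * d) * D = d * secant_sum p d (Suc K) z"
      unfolding D_def secant_slope_step[symmetric] secant_sum_last[OF less_imp_le[OF False[unfolded not_le]]]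
      by (simp add: algebra_simps)
    finally show ?thesis using d by simp
  qed
qed

end

section \<open>From truncations to convex and concave functions\<close>

lemma secant_sum_nn_integral:
  assumes "\<And>k. 0 \<le> w k" and [measurable]: "f \<in> borel_measurable M"
  shows "(\<integral>\<^sup>+x. ennreal (\<Sum>k<K. w k * max 0 (f x - real (Suc k) * d)) \<partial>M) =
    (\<Sum>k<K. ennreal (w k) * (\<integral>\<^sup>+x. ennreal (f x - real (Suc k) * d) \<partial>M))"
proof -
  have "ennreal (max 0 y) = ennreal y" for y by (cases "0 \<le> y") (auto simp: max_absorb1 max_absorb2 ennreal_neg)
  then have "ennreal (\<Sum>k<K. w k * max 0 (f x - real (Suc k) * d)) = (\<Sum>k<K. ennreal (w k) * ennreal (f x - real (Suc k) * d))" for x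
    using assms(1) by (subst sum_ennreal[symmetric]) (auto simp: ennreal_mult simp del: of_nat_Suc)
  then show ?thesis by (simp add: nn_integral_sum nn_integral_cmult del: of_nat_Suc)
qed

lemma convex_order:
  fixes f :: "'x \<Rightarrow> real" and g :: "'y \<Rightarrow> real"
  assumes [measurable]: "f \<in> borel_measurable M" "g \<in> borel_measurable N"
    and f0: "\<And>x. 0 \<le> f x" and g0: "\<And>x. 0 \<le> g x"
    and le: "\<And>t. 0 \<le> t \<Longrightarrow> (\<integral>\<^sup>+x. ennreal (f x - t) \<partial>M) \<le> (\<integral>\<^sup>+x. ennreal (g x - t) \<partial>N)"
    and p: "convex_on {0..} p" "p 0 = 0" "\<And>y. 0 \<le> y \<Longrightarrow> 0 \<le> p y"
  shows "(\<integral>\<^sup>+x. ennreal (p (f x)) \<partial>M) \<le> (\<integral>\<^sup>+x. ennreal (p (g x)) \<partial>N)"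
proof -
  define d where "d n = 1 / real (Suc n)" for n
  have d: "0 < d n" for n unfolding d_def by simp
  \<comment> \<open>The interpolation lies above \<open>p\<close>. Shifted to the right by the mesh
    width it lies below \<open>p\<close>, as the estimate on the side of \<open>g\<close> requires,
    and it is still a nonnegative combination of truncations to which \<open>le\<close>
    applies.\<close>
  define J where "J n y = (\<Sum>k<(Suc n)^2. (secant_slope p (d n) (Suc k) - secant_slope p (d n) k) * max 0 (y - real (Suc k) * d n))" for n y
  have Jc: "J n y = secant_sum p (d n) ((Suc n)^2) (y - d n)" for n y
    unfolding J_def secant_sum_def by (simp add: algebra_simps)
  have w: "0 \<le> secant_slope p (d n) (Suc k) - secant_slope p (d n) k" for n k
    using secant_slope_mono[OF p d, of n k] by simp
  have J0: "0 \<le> J n y" for n y unfolding J_def using w by (auto intro!: sum_nonneg)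
  have Jle: "J n y \<le> p y" if "0 \<le> y" for n y
  proof (cases "d n \<le> y")
    case True
    then show ?thesis using secant_sum_le[OF p d, of "y - d n" n] unfolding Jc by simp
  next
    case False
    have "max 0 (y - real (Suc k) * d n) = 0" for k
    proof -
      have "d n \<le> real (Suc k) * d n" using d[of n] by simp
      then show ?thesis using False by (intro max_absorb1) linarith
    qed
    then show ?thesis using p(3)[OF that] unfolding J_def by simp
  qed
  have Jlim: "(\<lambda>n. J n y) \<longlonglongrightarrow> p y" if y: "0 \<le> y" for y
  proof (rule tendsto_sandwich)
    have "(\<lambda>n. max 0 (y - d n)) \<longlonglongrightarrow> max 0 (y - 0)"
      unfolding d_def by (intro tendsto_intros LIMSEQ_Suc[OF lim_1_over_n])
    then show "(\<lambda>n. p (max 0 (y - d n))) \<longlonglongrightarrow> p y"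
      using y d by (intro convex_tendsto_below[OF p(1)]) (auto simp: max_absorb2 less_imp_le)
    show "\<forall>\<^sub>F n in sequentially. p (max 0 (y - d n)) \<le> J n y"
    proof (rule eventually_sequentiallyI[of "nat \<lceil>y\<rceil>"])
      fix n assume n: "nat \<lceil>y\<rceil> \<le> n"
      show "p (max 0 (y - d n)) \<le> J n y"
      proof (cases "d n \<le> y")
        case True
        have "y - d n \<le> real n" using n d[of n] by linarith
        also have "real n \<le> real (Suc n)" by simp
        also have "\<dots> = real ((Suc n)^2) * d n" unfolding d_def by (simp add: power2_eq_square field_simps)
        finally show ?thesis using secant_sum_ge[OF p d, of "y - d n" "(Suc n)^2" n] True unfolding Jc by (simp add: max_absorb2)
      next
        case False
        then show ?thesis using J0[of n y] p(2) by (simp add: max_absorb1)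
      qed
    qed
    show "\<forall>\<^sub>F n in sequentially. J n y \<le> p y" using Jle[OF y] by simp
  qed auto
  have [measurable]: "J n \<in> borel_measurable borel" for n unfolding J_def by measurable
  have "(\<integral>\<^sup>+x. ennreal (p (f x)) \<partial>M) = (\<integral>\<^sup>+x. liminf (\<lambda>n. ennreal (J n (f x))) \<partial>M)"
    using Jlim f0 by (intro nn_integral_cong lim_imp_Liminf[symmetric] tendsto_ennrealI) auto
  also have "\<dots> \<le> liminf (\<lambda>n. \<integral>\<^sup>+x. ennreal (J n (f x)) \<partial>M)" by (rule nn_integral_liminf) measurable
  also have "\<dots> \<le> liminf (\<lambda>n. \<integral>\<^sup>+x. ennreal (p (g x)) \<partial>N)"
  proof (intro Liminf_mono always_eventually allI)
    fix n
    have "(\<integral>\<^sup>+x. ennreal (J n (f x)) \<partial>M) \<le> (\<integral>\<^sup>+x. ennreal (J n (g x)) \<partial>N)"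
      unfolding J_def using d[of n]
      by (subst (1 2) secant_sum_nn_integral[OF w]) (auto intro!: sum_mono mult_left_mono le)
    also have "\<dots> \<le> (\<integral>\<^sup>+x. ennreal (p (g x)) \<partial>N)" by (intro nn_integral_mono ennreal_leI Jle g0)
    finally show "(\<integral>\<^sup>+x. ennreal (J n (f x)) \<partial>M) \<le> (\<integral>\<^sup>+x. ennreal (p (g x)) \<partial>N)" .
  qed
  also have "\<dots> = (\<integral>\<^sup>+x. ennreal (p (g x)) \<partial>N)" by (simp add: Liminf_const)
  finally show ?thesis .
qed

text \<open>The function \<open>K * y - h y\<close> is convex and nonnegative, so its integral is
  larger for \<open>g\<close>. The linear part has the same finite integral on both sides and
  cancels.\<close>

lemma concave_order:
  fixes f :: "'x \<Rightarrow> real" and g :: "'y \<Rightarrow> real"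
  assumes [measurable]: "f \<in> borel_measurable M" "g \<in> borel_measurable N"
    and f0: "\<And>x. 0 \<le> f x" and g0: "\<And>x. 0 \<le> g x"
    and le: "\<And>t. 0 \<le> t \<Longrightarrow> (\<integral>\<^sup>+x. ennreal (f x - t) \<partial>M) \<le> (\<integral>\<^sup>+x. ennreal (g x - t) \<partial>N)"
    and mass: "(\<integral>\<^sup>+x. ennreal (f x) \<partial>M) = (\<integral>\<^sup>+x. ennreal (g x) \<partial>N)" "(\<integral>\<^sup>+x. ennreal (f x) \<partial>M) < \<infinity>"
    and h: "convex_on {0..} (\<lambda>y. - h y)" "h 0 = 0" "\<And>y. 0 \<le> y \<Longrightarrow> 0 \<le> h y" "\<And>y. 0 \<le> y \<Longrightarrow> h y \<le> K * y"
  shows "(\<integral>\<^sup>+x. ennreal (h (g x)) \<partial>N) \<le> (\<integral>\<^sup>+x. ennreal (h (f x)) \<partial>M)"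
proof -
  have K: "0 \<le> K" using h(3)[of 1] h(4)[of 1] by simp
  have mm: "(\<lambda>x. - h (f x)) \<in> borel_measurable M" "(\<lambda>x. - h (g x)) \<in> borel_measurable N"
    by (rule convex_comp_measurable[OF h(1)]; use f0 g0 in simp)+
  have [measurable]: "(\<lambda>x. h (f x)) \<in> borel_measurable M" "(\<lambda>x. h (g x)) \<in> borel_measurable N"
    using borel_measurable_uminus[OF mm(1)] borel_measurable_uminus[OF mm(2)] by simp_all
  have q: "convex_on {0..} (\<lambda>y. K * y + - h y)"
    by (intro convex_on_add h(1)) (auto simp: convex_on_def algebra_simps)
  have qle: "(\<integral>\<^sup>+x. ennreal (K * f x + - h (f x)) \<partial>M) \<le> (\<integral>\<^sup>+x. ennreal (K * g x + - h (g x)) \<partial>N)"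
    by (rule convex_order[where p="\<lambda>y. K * y + - h y", OF _ _ f0 g0 le q]) (use h in auto)
  have split: "ennreal K * ennreal y = ennreal (h y) + ennreal (K * y + - h y)" if "0 \<le> y" for y
    using h(3,4)[OF that] that K by (simp flip: ennreal_plus ennreal_mult)
  have F: "ennreal K * (\<integral>\<^sup>+x. ennreal (f x) \<partial>M) =
      (\<integral>\<^sup>+x. ennreal (h (f x)) \<partial>M) + (\<integral>\<^sup>+x. ennreal (K * f x + - h (f x)) \<partial>M)"
    by (simp add: nn_integral_cmult[symmetric] split[OF f0] nn_integral_add)
  have G: "ennreal K * (\<integral>\<^sup>+x. ennreal (g x) \<partial>N) =
      (\<integral>\<^sup>+x. ennreal (h (g x)) \<partial>N) + (\<integral>\<^sup>+x. ennreal (K * g x + - h (g x)) \<partial>N)"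
    by (simp add: nn_integral_cmult[symmetric] split[OF g0] nn_integral_add)
  have fin: "(\<integral>\<^sup>+x. ennreal (h (g x)) \<partial>N) + (\<integral>\<^sup>+x. ennreal (K * g x + - h (g x)) \<partial>N) < \<infinity>"
    unfolding G[symmetric] mass(1)[symmetric] using mass(2) by (simp add: ennreal_mult_less_top)
  have "(\<integral>\<^sup>+x. ennreal (h (g x)) \<partial>N) + (\<integral>\<^sup>+x. ennreal (K * f x + - h (f x)) \<partial>M) \<le>
      (\<integral>\<^sup>+x. ennreal (h (f x)) \<partial>M) + (\<integral>\<^sup>+x. ennreal (K * f x + - h (f x)) \<partial>M)"
    unfolding F[symmetric] mass(1) G by (intro add_left_mono qle)
  moreover have "(\<integral>\<^sup>+x. ennreal (K * f x + - h (f x)) \<partial>M) \<noteq> \<infinity>"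
    using qle fin by (auto simp: top_unique)
  ultimately show ?thesis
    unfolding add.commute[of _ "\<integral>\<^sup>+x. ennreal (K * f x + - h (f x)) \<partial>M"] ennreal_add_left_cancel_le
    by simp
qed

section \<open>Comparison of the integrals\<close>

lemma approximates_finite:
  assumes "approximates M u c"
  shows "c \<in> borel_measurable M" "(\<lambda>x. enn2real (c x)) \<in> borel_measurable M"
    "c x < \<infinity> \<Longrightarrow> (\<lambda>n. u n x) \<longlonglongrightarrow> enn2real (c x)" "c x < \<infinity> \<Longrightarrow> u n x \<le> enn2real (c x)"
    "0 \<le> u n x" "u n \<in> borel_measurable M"
proof -
  have [measurable]: "\<And>n. u n \<in> borel_measurable M" and pos: "\<And>n x. 0 \<le> u n x"
    and le: "\<And>n x. ennreal (u n x) \<le> c x" and lim: "\<And>x. (\<lambda>n. ennreal (u n x)) \<longlonglongrightarrow> c x"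
    using assms unfolding approximates_def by blast+
  show "u n \<in> borel_measurable M" "0 \<le> u n x" by (measurable, rule pos)
  have "c = (\<lambda>x. liminf (\<lambda>n. ennreal (u n x)))" using lim by (intro ext lim_imp_Liminf[symmetric]) auto
  also have "\<dots> \<in> borel_measurable M" by measurable
  finally show [measurable]: "c \<in> borel_measurable M" .
  show "(\<lambda>x. enn2real (c x)) \<in> borel_measurable M" by measurable
  assume fin: "c x < \<infinity>"
  then have e: "c x = ennreal (enn2real (c x))" by simp
  show "u n x \<le> enn2real (c x)"
    using le[of n x] by (subst (asm) e) (simp add: ennreal_le_iff)
  show "(\<lambda>n. u n x) \<longlonglongrightarrow> enn2real (c x)"
    using lim[of x] pos by (subst (asm) e) (subst (asm) tendsto_ennreal_iff; simp)
qed

text \<open>Fatou's lemma; along approximations from below, convex and concave functions converge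
  even at 0.\<close>

lemma nn_integral_limit_below:
  assumes a: "approximates M u c" and fin: "AE x in M. c x < \<infinity>"
    and p: "convex_on {0..} p \<or> convex_on {0..} (\<lambda>y. - p y)"
  shows "(\<integral>\<^sup>+x. ennreal (p (enn2real (c x))) \<partial>M) \<le> liminf (\<lambda>n. \<integral>\<^sup>+x. ennreal (p (u n x)) \<partial>M)"
proof -
  note A = approximates_finite[OF a]
  have [measurable]: "(\<lambda>x. p (u n x)) \<in> borel_measurable M" for n
    using p
  proof
    assume "convex_on {0..} (\<lambda>y. - p y)"
    from borel_measurable_uminus[OF convex_comp_measurable[OF this A(6) A(5)]] show ?thesis by simp
  qed (rule convex_comp_measurable[OF _ A(6) A(5)])
  have lim: "(\<lambda>n. p (u n x)) \<longlonglongrightarrow> p (enn2real (c x))" if "c x < \<infinity>" for x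
    using p
  proof
    assume "convex_on {0..} (\<lambda>y. - p y)"
    from tendsto_minus[OF convex_tendsto_below[OF this A(3)[OF that] A(5) A(4)[OF that]]]
    show ?thesis by simp
  qed (rule convex_tendsto_below[OF _ A(3)[OF that] A(5) A(4)[OF that]])
  have "(\<integral>\<^sup>+x. ennreal (p (enn2real (c x))) \<partial>M) = (\<integral>\<^sup>+x. liminf (\<lambda>n. ennreal (p (u n x))) \<partial>M)"
    using fin by (intro nn_integral_cong_AE)
      (auto elim!: eventually_mono intro!: lim_imp_Liminf[symmetric] tendsto_ennrealI lim)
  also have "\<dots> \<le> liminf (\<lambda>n. \<integral>\<^sup>+x. ennreal (p (u n x)) \<partial>M)" by (rule nn_integral_liminf) measurable
  finally show ?thesis .
qed

lemma nn_integral_approx_le: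
  assumes a: "approximates M u c" and fin: "AE x in M. c x < \<infinity>"
    and mono: "\<And>x y. 0 \<le> x \<Longrightarrow> x \<le> y \<Longrightarrow> p x \<le> p y"
  shows "(\<integral>\<^sup>+x. ennreal (p (u n x)) \<partial>M) \<le> (\<integral>\<^sup>+x. ennreal (p (enn2real (c x))) \<partial>M)"
  using fin approximates_finite(4,5)[OF a]
  by (intro nn_integral_mono_AE) (auto elim!: eventually_mono intro!: ennreal_leI mono)

lemma concave_nonneg_mono:
  fixes h :: "real \<Rightarrow> real"
  assumes h: "convex_on {0..} (\<lambda>y. - h y)" "\<And>y. 0 \<le> y \<Longrightarrow> 0 \<le> h y" and x: "0 \<le> x" "x \<le> y"
  shows "h x \<le> h y"
proof (rule ccontr)
  assume "\<not> ?thesis"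
  then have lt: "h y < h x" by simp
  then have xy: "x < y" using x by (cases "x = y") auto
  \<comment> \<open>The line through the two points reaches 0 at \<open>y + r\<close>. Concavity
    would force a negative value at \<open>z\<close>, which lies a further distance
    \<open>y - x\<close> beyond.\<close>
  define r where "r = (y - x) * h y / (h x - h y)"
  define z where "z = y + r + (y - x)"
  have r: "r * (h x - h y) = (y - x) * h y" unfolding r_def using lt by simp
  have "0 \<le> r" unfolding r_def using lt xy h(2)[of y] x by (intro divide_nonneg_pos mult_nonneg_nonneg) auto
  then have z: "y \<le> z" "0 \<le> z" unfolding z_def using xy x by auto
  have "(z - x) * - h y \<le> (z - y) * - h x + (y - x) * - h z"
    using convex_on_three_points[OF h(1) x(1,2) z(1)] .
  then have "(z - y) * (h x - h y) \<le> (y - x) * h y - (y - x) * h z" by (simp add: algebra_simps)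
  also have "\<dots> \<le> (y - x) * h y" using xy h(2)[OF z(2)] by simp
  also have "(z - y) * (h x - h y) = (y - x) * h y + (y - x) * (h x - h y)"
    unfolding z_def r[symmetric] by (simp add: algebra_simps)
  finally show False using xy lt by (simp add: mult_le_0_iff)
qed

locale convolution_comparison =
  fixes M :: "'x measure" and c :: "'x \<Rightarrow> ennreal" and c' :: "real \<Rightarrow> ennreal"
    and u :: "nat \<Rightarrow> 'x \<Rightarrow> real" and v :: "nat \<Rightarrow> real \<Rightarrow> real"
  assumes u: "approximates M u c" and v: "approximates lborel v c'"
    and excess: "\<And>n t. 0 \<le> t \<Longrightarrow> (\<integral>\<^sup>+g. ennreal (u n g - t) \<partial>M) \<le> (\<integral>\<^sup>+x. ennreal (v n x - t) \<partial>lborel)"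
    and mass: "\<And>n. (\<integral>\<^sup>+g. ennreal (u n g) \<partial>M) = (\<integral>\<^sup>+x. ennreal (v n x) \<partial>lborel)"
      "\<And>n. (\<integral>\<^sup>+g. ennreal (u n g) \<partial>M) < \<infinity>"
    and v_mono: "\<And>n x y. \<bar>x\<bar> \<le> \<bar>y\<bar> \<Longrightarrow> v n y \<le> v n x"
    and c: "AE g in M. c g < \<infinity>" and c': "AE x in lborel. c' x < \<infinity>"
begin

definition C :: "'x \<Rightarrow> real" where "C g = enn2real (c g)"
definition C' :: "real \<Rightarrow> real" where "C' x = enn2real (c' x)"

lemma C_nonneg [simp]: "0 \<le> C g" "0 \<le> C' x" unfolding C_def C'_def by simp_all

lemma C_measurable [measurable]: "C \<in> borel_measurable M" "C' \<in> borel_measurable lborel"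
  unfolding C_def C'_def using approximates_finite(2)[OF u] approximates_finite(2)[OF v] by auto

text \<open>On the left Fatou's lemma passes to the limit; on the right the approximations stay
  below \<open>C'\<close>, and \<open>p\<close> is increasing because it is convex and nonnegative
  with \<open>p 0 = 0\<close>.\<close>

lemma convex_le:
  assumes p: "convex_on {0..} p" "p 0 = 0" "\<And>y. 0 \<le> y \<Longrightarrow> 0 \<le> p y"
  shows "(\<integral>\<^sup>+g. ennreal (p (C g)) \<partial>M) \<le> (\<integral>\<^sup>+x. ennreal (p (C' x)) \<partial>lborel)"
proof -
  note U = approximates_finite[OF u] and V = approximates_finite[OF v]
  have "(\<integral>\<^sup>+g. ennreal (p (C g)) \<partial>M) \<le> liminf (\<lambda>n. \<integral>\<^sup>+g. ennreal (p (u n g)) \<partial>M)"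
    unfolding C_def using p by (intro nn_integral_limit_below[OF u c]) auto
  also have "\<dots> \<le> liminf (\<lambda>n. \<integral>\<^sup>+x. ennreal (p (C' x)) \<partial>lborel)"
  proof (intro Liminf_mono always_eventually allI)
    fix n
    have "(\<integral>\<^sup>+g. ennreal (p (u n g)) \<partial>M) \<le> (\<integral>\<^sup>+x. ennreal (p (v n x)) \<partial>lborel)"
      by (rule convex_order[OF U(6) V(6) U(5) V(5) excess p])
    also have "\<dots> \<le> (\<integral>\<^sup>+x. ennreal (p (C' x)) \<partial>lborel)"
      unfolding C'_def by (rule nn_integral_approx_le[OF v c' convex_nonneg_mono[OF p]])
    finally show "(\<integral>\<^sup>+g. ennreal (p (u n g)) \<partial>M) \<le> (\<integral>\<^sup>+x. ennreal (p (C' x)) \<partial>lborel)" .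
  qed
  finally show ?thesis by (simp add: Liminf_const)
qed

text \<open>The two sides exchange roles: Fatou's lemma acts on the line, and monotonicity of a
  nonnegative concave function bounds the approximations on \<open>M\<close>.\<close>

lemma concave_ge:
  assumes h: "convex_on {0..} (\<lambda>y. - h y)" "h 0 = 0" "\<And>y. 0 \<le> y \<Longrightarrow> 0 \<le> h y" "\<And>y. 0 \<le> y \<Longrightarrow> h y \<le> K * y"
  shows "(\<integral>\<^sup>+x. ennreal (h (C' x)) \<partial>lborel) \<le> (\<integral>\<^sup>+g. ennreal (h (C g)) \<partial>M)"
proof -
  note U = approximates_finite[OF u] and V = approximates_finite[OF v]
  have "(\<integral>\<^sup>+x. ennreal (h (C' x)) \<partial>lborel) \<le> liminf (\<lambda>n. \<integral>\<^sup>+x. ennreal (h (v n x)) \<partial>lborel)"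
    unfolding C'_def using h by (intro nn_integral_limit_below[OF v c']) auto
  also have "\<dots> \<le> liminf (\<lambda>n. \<integral>\<^sup>+g. ennreal (h (C g)) \<partial>M)"
  proof (intro Liminf_mono always_eventually allI)
    fix n
    have "(\<integral>\<^sup>+x. ennreal (h (v n x)) \<partial>lborel) \<le> (\<integral>\<^sup>+g. ennreal (h (u n g)) \<partial>M)"
      by (rule concave_order[OF U(6) V(6) U(5) V(5) excess mass h])
    also have "\<dots> \<le> (\<integral>\<^sup>+g. ennreal (h (C g)) \<partial>M)"
      unfolding C_def by (rule nn_integral_approx_le[OF u c concave_nonneg_mono[OF h(1,3)]])
    finally show "(\<integral>\<^sup>+x. ennreal (h (v n x)) \<partial>lborel) \<le> (\<integral>\<^sup>+g. ennreal (h (C g)) \<partial>M)" .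
  qed
  finally show ?thesis by (simp add: Liminf_const)
qed

text \<open>Symmetric monotonicity passes to the limit of the \<open>v n\<close>. Finiteness at
  \<open>x\<close> matters because \<open>enn2real\<close> sends infinity to 0.\<close>

lemma C'_mono:
  assumes "\<bar>x\<bar> \<le> \<bar>y\<bar>" "c' x < \<infinity>" shows "C' y \<le> C' x"
proof -
  have "c' y \<le> c' x"
  proof (rule LIMSEQ_le)
    show "(\<lambda>n. ennreal (v n y)) \<longlonglongrightarrow> c' y" "(\<lambda>n. ennreal (v n x)) \<longlonglongrightarrow> c' x"
      using v unfolding approximates_def by auto
    show "\<exists>N. \<forall>n\<ge>N. ennreal (v n y) \<le> ennreal (v n x)" using v_mono[OF assms(1)] by (auto intro: ennreal_leI)
  qed
  then show ?thesis unfolding C'_def using assms(2) by (intro enn2real_mono) auto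
qed

text \<open>
  The delicate case is the one where \<open>c\<close> exceeds the minimum point \<open>y1\<close> of \<open>f\<close> on a set of infinite
  measure. Then \<open>c'\<close>, being symmetric decreasing, cannot take a value where \<open>f\<close> is negative.
\<close>

lemma neg_part_vanishes:
  assumes f: "convex_on {0..} f" "0 < y1" "f y1 < 0" "y1 < y3" "f y1 < f y3"
    and min: "\<And>y. 0 \<le> y \<Longrightarrow> f y1 \<le> f y"
    and P': "(\<integral>\<^sup>+x. ennreal (f (C' x)) \<partial>lborel) < \<infinity>" and N: "(\<integral>\<^sup>+g. ennreal (- f (C g)) \<partial>M) < \<infinity>"
    and inf: "emeasure M {g\<in>space M. y1 < C g} = \<infinity>"
  shows "(\<integral>\<^sup>+x. ennreal (- f (C' x)) \<partial>lborel) = 0"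
proof -
  have fm: "(\<lambda>g. f (C g)) \<in> borel_measurable M" "(\<lambda>x. f (C' x)) \<in> borel_measurable lborel"
    by (rule convex_comp_measurable[OF f(1)]; simp)+
  note [measurable] = fm fm(2)[unfolded measurable_lborel1]
  have "0 \<le> f (C' x)" if x: "c' x < \<infinity>" for x
  proof (rule ccontr)
    assume "\<not> 0 \<le> f (C' x)"
    \<comment> \<open>A level at least \<open>y1\<close> and at least \<open>C' x\<close> at which
      \<open>f\<close> is still negative.\<close>
    moreover define T0 where "T0 = max (C' x) y1"
    ultimately have T0: "0 < T0" "f T0 < 0" using f by (auto simp: max_def)
    have "convex_on {0<..} f" by (rule convex_on_subset[OF f(1)]) auto
    then have "continuous_on {0<..} f" by (intro convex_on_continuous) auto
    then have "isCont f T0" using T0 by (simp add: continuous_on_eq_continuous_at)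
    then have "(f \<longlongrightarrow> f T0) (at_right T0)" unfolding isCont_def by (rule tendsto_within_subset) auto
    then have "\<forall>\<^sub>F y in at_right T0. f y < 0" using T0(2) by (rule order_tendstoD(2))
    then obtain b where b: "T0 < b" "\<And>y. T0 < y \<Longrightarrow> y < b \<Longrightarrow> f y < 0"
      by (auto simp: eventually_at_right_field)
    \<comment> \<open>Two levels slightly above \<open>T0\<close>. Between \<open>y1\<close> and
      \<open>T\<close> the function \<open>f\<close> stays below \<open>f T < 0\<close>, so
      \<open>C\<close> exceeds \<open>T\<close> on a set of infinite measure; the gap from
      \<open>T'\<close> to \<open>T\<close> turns this into an infinite integral.\<close>
    define T T' where "T = (2 * b + T0) / 3" and "T' = (b + 2 * T0) / 3"
    have T: "T0 < T'" "T' < T" "f T < 0" unfolding T_def T'_def using b(1) by (auto intro!: b(2))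
    have Ty: "y1 < T" using T unfolding T0_def by linarith
    define e where "e = - f T"
    have e: "0 < e" unfolding e_def using T by simp
    have fle: "f y \<le> f T" if y: "y1 < y" "y \<le> T" for y
    proof -
      have "(T - y1) * f y \<le> (T - y) * f y1 + (y - y1) * f T"
        using convex_on_three_points[OF f(1), of y1 y T] f(2) y by simp
      also have "\<dots> \<le> (T - y) * f T + (y - y1) * f T"
        using y Ty f(2) min[of T] by (intro add_right_mono mult_left_mono) auto
      also have "\<dots> = (T - y1) * f T" by (simp add: algebra_simps)
      finally show ?thesis using Ty by simp
    qed
    have "ennreal e * emeasure M {g\<in>space M. y1 < C g \<and> C g \<le> T} =
        (\<integral>\<^sup>+g. ennreal e * indicator {g\<in>space M. y1 < C g \<and> C g \<le> T} g \<partial>M)"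
      by (rule nn_integral_cmult_indicator[symmetric]) measurable
    also have "\<dots> \<le> (\<integral>\<^sup>+g. ennreal (- f (C g)) \<partial>M)"
      using fle by (intro nn_integral_mono) (auto simp: indicator_def e_def intro!: ennreal_leI)
    finally have "emeasure M {g\<in>space M. y1 < C g \<and> C g \<le> T} < \<infinity>"
      using N e by (auto simp: ennreal_mult_less_top top_unique less_top[symmetric] ennreal_mult_eq_top_iff)
    moreover have "emeasure M {g\<in>space M. y1 < C g} \<le>
        emeasure M {g\<in>space M. y1 < C g \<and> C g \<le> T} + emeasure M {g\<in>space M. T < C g}"
      by (rule order_trans[OF emeasure_mono emeasure_subadditive]) auto
    ultimately have big: "emeasure M {g\<in>space M. T < C g} = \<infinity>"
      unfolding inf by (auto simp: top_unique)
    have "ennreal (T - T') * emeasure M {g\<in>space M. T < C g} =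
        (\<integral>\<^sup>+g. ennreal (T - T') * indicator {g\<in>space M. T < C g} g \<partial>M)"
      by (rule nn_integral_cmult_indicator[symmetric]) measurable
    also have "\<dots> \<le> (\<integral>\<^sup>+g. ennreal (max 0 (C g - T')) \<partial>M)"
      by (intro nn_integral_mono) (auto simp: indicator_def intro!: ennreal_leI)
    also have "\<dots> \<le> (\<integral>\<^sup>+x. ennreal (max 0 (C' x - T')) \<partial>lborel)"
    proof (rule convex_le[of "\<lambda>y. max 0 (y - T')"])
      show "convex_on {0..} (\<lambda>y. max 0 (y - T'))"
      proof (rule convex_onI)
        fix t a b :: real assume t: "0 < t" "t < 1"
        have e: "(1 - t) *\<^sub>R a + t *\<^sub>R b - T' = (1 - t) * (a - T') + t * (b - T')" by (simp add: algebra_simps)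
        have "(1 - t) * (a - T') \<le> (1 - t) * max 0 (a - T')" "t * (b - T') \<le> t * max 0 (b - T')"
          using t by (auto intro!: mult_left_mono)
        moreover have "0 \<le> (1 - t) * max 0 (a - T')" "0 \<le> t * max 0 (b - T')" using t by auto
        ultimately show "max 0 ((1 - t) *\<^sub>R a + t *\<^sub>R b - T') \<le> (1 - t) * max 0 (a - T') + t * max 0 (b - T')"
          unfolding e by (intro max.boundedI) linarith+
      qed simp
      show "max 0 (0 - T') = 0" using T T0 by simp
    qed simp
    also have "\<dots> < \<infinity>"
    proof -
      \<comment> \<open>\<open>B\<close> is the inverse slope of the secant of \<open>f\<close> from
        \<open>y1\<close> to \<open>y3\<close>. By convexity \<open>f\<close> grows at least at this
        rate beyond \<open>y3\<close>, and the constant \<open>A\<close> also covers the values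
        between \<open>y1\<close> and \<open>y3\<close>.\<close>
      define A B where "A = y3 - y1 - (y3 - y1) / (f y3 - f y1) * f y1" and "B = (y3 - y1) / (f y3 - f y1)"
      have B: "0 < B" unfolding B_def using f by simp
      have A: "0 \<le> A" unfolding A_def B_def[symmetric] using f B mult_pos_neg[OF B f(3)] by simp
      have bound: "y - T' \<le> A + B * max 0 (f y)" if y: "y1 \<le> y" for y
      proof (cases "y \<le> y3")
        case True
        have "y1 < T'" using T unfolding T0_def by linarith
        moreover have "B * f y1 \<le> 0" using B f(3) by (simp add: mult_le_0_iff)
        moreover have "0 \<le> B * max 0 (f y)" using B by simp
        ultimately show ?thesis using True unfolding A_def B_def[symmetric] by linarith
      next
        case False
        have "(y - y1) * f y3 \<le> (y - y3) * f y1 + (y3 - y1) * f y"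
          using convex_on_three_points[OF f(1), of y1 y3 y] f False by simp
        then have "(y - y1) * (f y3 - f y1) \<le> (y3 - y1) * (f y - f y1)" by (simp add: algebra_simps)
        then have "y - y1 \<le> B * (f y - f y1)" unfolding B_def using f by (simp add: field_simps)
        also have "\<dots> \<le> B * max 0 (f y) - B * f y1"
          using mult_left_mono[of "f y" "max 0 (f y)" B] B by (simp add: right_diff_distrib)
        finally show ?thesis using T f(4) unfolding A_def B_def[symmetric] T0_def by linarith
      qed
      \<comment> \<open>Outside the interval from \<open>- |x|\<close> to \<open>|x|\<close> the
        symmetric decreasing \<open>C'\<close> is at most \<open>T0 < T'\<close>, so the constant
        \<open>A\<close> is integrated over a bounded set only.\<close>
      have "(\<integral>\<^sup>+z. ennreal (max 0 (C' z - T')) \<partial>lborel) \<le>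
          (\<integral>\<^sup>+z. ennreal A * indicator {- \<bar>x\<bar>..\<bar>x\<bar>} z + ennreal B * ennreal (f (C' z)) \<partial>lborel)"
      proof (intro nn_integral_mono)
        fix z
        show "ennreal (max 0 (C' z - T')) \<le> ennreal A * indicator {- \<bar>x\<bar>..\<bar>x\<bar>} z + ennreal B * ennreal (f (C' z))"
        proof (cases "T' < C' z")
          case True
          have "\<bar>z\<bar> \<le> \<bar>x\<bar>"
          proof (rule ccontr)
            assume "\<not> ?thesis"
            then have "C' z \<le> C' x" using x by (intro C'_mono) auto
            then show False using True T unfolding T0_def by linarith
          qed
          then have z: "z \<in> {- \<bar>x\<bar>..\<bar>x\<bar>}" by auto
          have y1z: "y1 \<le> C' z" using True T unfolding T0_def by linarith
          have mx: "ennreal (max 0 (f (C' z))) = ennreal (f (C' z))"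
            by (cases "0 \<le> f (C' z)") (auto simp: max_absorb1 max_absorb2 ennreal_neg)
          have "ennreal (max 0 (C' z - T')) \<le> ennreal (A + B * max 0 (f (C' z)))"
            using bound[OF y1z] True A B by (intro ennreal_leI) auto
          also have "\<dots> = ennreal A + ennreal B * ennreal (f (C' z))"
            using A B by (simp add: ennreal_plus ennreal_mult mx)
          finally show ?thesis using z by simp
        qed (simp add: max_absorb1)
      qed
      also have "\<dots> = ennreal A * emeasure lborel {- \<bar>x\<bar>..\<bar>x\<bar>} + ennreal B * (\<integral>\<^sup>+z. ennreal (f (C' z)) \<partial>lborel)"
        by (subst nn_integral_add) (auto simp: nn_integral_cmult nn_integral_cmult_indicator)
      also have "\<dots> < \<infinity>" using P' by (auto simp: ennreal_mult_less_top)
      finally show ?thesis .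
    qed
    finally show False using big T by (simp add: ennreal_mult_top)
  qed
  then have "AE x in lborel. ennreal (- f (C' x)) = 0" using c' by (auto elim!: eventually_mono simp: ennreal_neg)
  then show ?thesis by (subst nn_integral_0_iff_AE) auto
qed

end

section \<open>Decomposition and truncation of convex functions\<close>

lemma convex_on_pointwise_max:
  fixes f g :: "real \<Rightarrow> real"
  assumes f: "convex_on {0..} f" and g: "convex_on {0..} g"
  shows "convex_on {0..} (\<lambda>y. max (f y) (g y))"
proof (rule convex_onI)
  fix t x y :: real assume t: "0 < t" "t < 1" and xy: "x \<in> {0..}" "y \<in> {0..}"
  have "f ((1 - t) *\<^sub>R x + t *\<^sub>R y) \<le> (1 - t) * f x + t * f y"
    using convex_onD[OF f, of t x y] t xy by simp
  also have "\<dots> \<le> (1 - t) * max (f x) (g x) + t * max (f y) (g y)"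
    using t by (intro add_mono mult_left_mono) auto
  finally have 1: "f ((1 - t) *\<^sub>R x + t *\<^sub>R y) \<le> (1 - t) * max (f x) (g x) + t * max (f y) (g y)" .
  have "g ((1 - t) *\<^sub>R x + t *\<^sub>R y) \<le> (1 - t) * g x + t * g y"
    using convex_onD[OF g, of t x y] t xy by simp
  also have "\<dots> \<le> (1 - t) * max (f x) (g x) + t * max (f y) (g y)"
    using t by (intro add_mono mult_left_mono) auto
  finally show "max (f ((1 - t) *\<^sub>R x + t *\<^sub>R y)) (g ((1 - t) *\<^sub>R x + t *\<^sub>R y))
      \<le> (1 - t) * max (f x) (g x) + t * max (f y) (g y)"
    using 1 by simp
qed simp

lemma convex_on_linear: "convex_on {0..} (\<lambda>y::real. k * y)"
  by (auto simp: convex_on_def algebra_simps)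

text \<open>Cutting at a minimum point separates an increasing convex part, accessible to
  \<open>convex_le\<close>, from a decreasing one whose negative is accessible to
  \<open>concave_ge\<close>.\<close>

lemma convex_increasing_part:
  fixes f :: "real \<Rightarrow> real"
  assumes f: "convex_on {0..} f" and y1: "0 \<le> y1" and min: "\<And>y. 0 \<le> y \<Longrightarrow> f y1 \<le> f y"
  shows "convex_on {0..} (\<lambda>y. f (max y y1) - f y1)" "convex_on {0..} (\<lambda>y. f (min y y1))"
    "\<And>x y. y1 \<le> x \<Longrightarrow> x \<le> y \<Longrightarrow> f x \<le> f y" "\<And>x y. 0 \<le> x \<Longrightarrow> x \<le> y \<Longrightarrow> y \<le> y1 \<Longrightarrow> f y \<le> f x"
proof -
  show inc: "f x \<le> f y" if x: "y1 \<le> x" "x \<le> y" for x y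
  proof (cases "y1 = y")
    case False
    then have "0 < y - y1" using x by simp
    have "(y - y1) * f x \<le> (y - x) * f y1 + (x - y1) * f y"
      by (rule convex_on_three_points[OF f y1 x])
    also have "\<dots> \<le> (y - x) * f y + (x - y1) * f y"
      using x y1 min[of y] by (intro add_right_mono mult_left_mono) auto
    also have "\<dots> = (y - y1) * f y" by (simp add: algebra_simps)
    finally show ?thesis using \<open>0 < y - y1\<close> by simp
  qed (use x in auto)
  show dec: "f y \<le> f x" if x: "0 \<le> x" "x \<le> y" "y \<le> y1" for x y
  proof (cases "x = y1")
    case False
    then have "0 < y1 - x" using x by simp
    have "(y1 - x) * f y \<le> (y1 - y) * f x + (y - x) * f y1"
      by (rule convex_on_three_points[OF f x])
    also have "\<dots> \<le> (y1 - y) * f x + (y - x) * f x"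
      using x min[of x] by (intro add_left_mono mult_left_mono) auto
    also have "\<dots> = (y1 - x) * f x" by (simp add: algebra_simps)
    finally show ?thesis using \<open>0 < y1 - x\<close> by simp
  qed (use x in auto)
  have comb: "f ((1 - t) * a + t * b) \<le> (1 - t) * f a + t * f b" if "0 < t" "t < 1" "0 \<le> a" "0 \<le> b" for t a b
    using convex_onD[OF f, of t a b] that by simp
  show "convex_on {0..} (\<lambda>y. f (max y y1) - f y1)"
  proof (rule convex_onI)
    fix t x y :: real assume t: "0 < t" "t < 1" and xy: "x \<in> {0..}" "y \<in> {0..}"
    have "(1 - t) * x \<le> (1 - t) * max x y1" "t * y \<le> t * max y y1" "(1 - t) * y1 \<le> (1 - t) * max x y1" "t * y1 \<le> t * max y y1"
      using t by (auto intro!: mult_left_mono)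
    then have "max ((1 - t) * x + t * y) y1 \<le> (1 - t) * max x y1 + t * max y y1"
      by (intro max.boundedI) (auto simp: algebra_simps)
    then have "f (max ((1 - t) * x + t * y) y1) \<le> f ((1 - t) * max x y1 + t * max y y1)" by (intro inc) auto
    also have "\<dots> \<le> (1 - t) * f (max x y1) + t * f (max y y1)" using t xy y1 by (intro comb) auto
    finally show "f (max ((1 - t) *\<^sub>R x + t *\<^sub>R y) y1) - f y1 \<le> (1 - t) * (f (max x y1) - f y1) + t * (f (max y y1) - f y1)"
      by (simp add: algebra_simps)
  qed simp
  show "convex_on {0..} (\<lambda>y. f (min y y1))"
  proof (rule convex_onI)
    fix t x y :: real assume t: "0 < t" "t < 1" and xy: "x \<in> {0..}" "y \<in> {0..}"
    have "(1 - t) * min x y1 \<le> (1 - t) * x" "t * min y y1 \<le> t * y" "(1 - t) * min x y1 \<le> (1 - t) * y1" "t * min y y1 \<le> t * y1"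
      using t by (auto intro!: mult_left_mono)
    then have "(1 - t) * min x y1 + t * min y y1 \<le> min ((1 - t) * x + t * y) y1"
      by (intro min.boundedI) (auto simp: algebra_simps)
    then have "f (min ((1 - t) * x + t * y) y1) \<le> f ((1 - t) * min x y1 + t * min y y1)"
      using t xy y1 by (intro dec) auto
    also have "\<dots> \<le> (1 - t) * f (min x y1) + t * f (min y y1)" using t xy y1 by (intro comb) auto
    finally show "f (min ((1 - t) *\<^sub>R x + t *\<^sub>R y) y1) \<le> (1 - t) * f (min x y1) + t * f (min y y1)" by simp
  qed simp
qed

lemma ennreal_max_zero: "ennreal (max 0 y) = ennreal y"
  by (cases "0 \<le> y") (auto simp: max_absorb1 max_absorb2 ennreal_neg)

context convolution_comparison
begin

lemma pos_part_le:
  assumes f: "convex_on {0..} f" "f 0 = 0"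
  shows "(\<integral>\<^sup>+g. ennreal (f (C g)) \<partial>M) \<le> (\<integral>\<^sup>+x. ennreal (f (C' x)) \<partial>lborel)"
proof -
  have "convex_on {0..} (\<lambda>y. max 0 (f y))"
    using convex_on_pointwise_max[OF convex_on_linear[of 0] f(1)] by simp
  from convex_le[OF this] show ?thesis using f(2) by (simp add: ennreal_max_zero)
qed

text \<open>The additive form remains meaningful when integrals are infinite. With
  \<open>f = p - h\<close> the comparisons of \<open>p\<close> and \<open>h\<close> are added and
  the common terms cancel if the integral of \<open>p (C' x)\<close> is finite. Otherwise, unless
  the negative part on \<open>M\<close> is infinite, \<open>C\<close> exceeds \<open>y1\<close> on a
  set of infinite measure, and the negative part on the line vanishes.\<close>

lemma comparison_valley:
  assumes f: "convex_on {0..} f" "f 0 = 0" and K: "\<And>y. 0 \<le> y \<Longrightarrow> - (K * y) \<le> f y"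
    and y1: "0 < y1" "f y1 < 0" "\<And>y. 0 \<le> y \<Longrightarrow> f y1 \<le> f y" and y3: "y1 < y3" "f y1 < f y3"
    and P': "(\<integral>\<^sup>+x. ennreal (f (C' x)) \<partial>lborel) < \<infinity>"
  shows "(\<integral>\<^sup>+g. ennreal (f (C g)) \<partial>M) + (\<integral>\<^sup>+x. ennreal (- f (C' x)) \<partial>lborel) \<le>
    (\<integral>\<^sup>+x. ennreal (f (C' x)) \<partial>lborel) + (\<integral>\<^sup>+g. ennreal (- f (C g)) \<partial>M)"
    (is "?P + ?N' \<le> ?P' + ?N")
proof -
  define h where "h y = - f (min y y1)" for y
  define p where "p y = f (max y y1) - f y1" for y
  define H where "H = - f y1"
  note inc = convex_increasing_part[OF f(1) less_imp_le[OF y1(1)] y1(3)]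
  have hc: "convex_on {0..} (\<lambda>y. - h y)" unfolding h_def using inc(2) by simp
  have h0: "h 0 = 0" unfolding h_def using f(2) y1 by (simp add: min_absorb1)
  have hn: "0 \<le> h y" if "0 \<le> y" for y
    unfolding h_def using inc(4)[of 0 "min y y1"] that y1 f(2) by (auto simp: min_def)
  have "0 < K * y1" using K[OF less_imp_le[OF y1(1)]] y1(2) by simp
  then have K0: "0 \<le> K" using y1(1) by (simp add: zero_less_mult_iff)
  have hK: "h y \<le> K * y" if "0 \<le> y" for y
  proof -
    have "h y \<le> K * min y y1" unfolding h_def using K[of "min y y1"] that y1 by simp
    also have "\<dots> \<le> K * y" using K0 by (intro mult_left_mono) auto
    finally show ?thesis .
  qed
  have p0: "p 0 = 0" unfolding p_def using y1 by (simp add: max_absorb2)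
  have pn: "0 \<le> p y" if "0 \<le> y" for y unfolding p_def using y1(1) y1(3)[of "max y y1"] by simp
  have pC: "(\<integral>\<^sup>+g. ennreal (p (C g)) \<partial>M) \<le> (\<integral>\<^sup>+x. ennreal (p (C' x)) \<partial>lborel)" (is "?p \<le> ?p'")
    by (rule convex_le[OF inc(1)[folded p_def] p0 pn])
  have hC: "(\<integral>\<^sup>+x. ennreal (h (C' x)) \<partial>lborel) \<le> (\<integral>\<^sup>+g. ennreal (h (C g)) \<partial>M)" (is "?h' \<le> ?h")
    by (rule concave_ge[OF hc h0 hn hK])
  have fph: "f y = p y - h y" for y unfolding p_def h_def by (auto simp: min_def max_def)
  have split: "ennreal (f y) + ennreal (h y) = ennreal (- f y) + ennreal (p y)" if "0 \<le> y" for y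
  proof (cases "0 \<le> f y")
    case True
    then show ?thesis using fph[of y] hn[OF that] pn[OF that] by (simp add: ennreal_neg flip: ennreal_plus)
  next
    case False
    then show ?thesis using fph[of y] hn[OF that] pn[OF that] by (simp add: ennreal_neg flip: ennreal_plus)
  qed
  have fm: "(\<lambda>g. f (C g)) \<in> borel_measurable M" "(\<lambda>x. f (C' x)) \<in> borel_measurable borel"
    "(\<lambda>g. p (C g)) \<in> borel_measurable M" "(\<lambda>x. p (C' x)) \<in> borel_measurable borel"
    "(\<lambda>g. - h (C g)) \<in> borel_measurable M" "(\<lambda>x. - h (C' x)) \<in> borel_measurable borel"
    using convex_comp_measurable[OF f(1) C_measurable(1)] convex_comp_measurable[OF f(1) C_measurable(2)]
      convex_comp_measurable[OF inc(1)[folded p_def] C_measurable(1)] convex_comp_measurable[OF inc(1)[folded p_def] C_measurable(2)]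
      convex_comp_measurable[OF hc C_measurable(1)] convex_comp_measurable[OF hc C_measurable(2)]
    by simp_all
  have [measurable]: "(\<lambda>g. h (C g)) \<in> borel_measurable M" "(\<lambda>x. h (C' x)) \<in> borel_measurable borel"
    using borel_measurable_uminus[OF fm(5)] borel_measurable_uminus[OF fm(6)] by simp_all
  note [measurable] = fm(1-4)
  have e: "?P + ?h = ?N + ?p"
    by (subst (1 2) nn_integral_add[symmetric]) (auto simp: split)
  have e': "?P' + ?h' = ?N' + ?p'"
    by (subst (1 2) nn_integral_add[symmetric]) (auto simp: split)
  have PP': "?P \<le> ?P'" by (rule pos_part_le[OF f])
  show ?thesis
  proof (cases "?N = \<infinity>")
    case True
    then show ?thesis by simp
  next
    case N: False
    show ?thesis
    proof (cases "?p' = \<infinity>")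
      case False
      then have "?p \<noteq> \<infinity>" using pC by (auto simp: top_unique)
      then have "?h \<noteq> \<infinity>" using e N by (metis ennreal_add_eq_top infinity_ennreal_def)
      have "(?p' + ?h) + (?P + ?N') = (?N' + ?p') + (?P + ?h)" by (simp add: ac_simps)
      also have "\<dots> = (?P' + ?h') + (?N + ?p)" unfolding e e' ..
      also have "\<dots> \<le> (?P' + ?h) + (?N + ?p')" using pC hC by (intro add_mono) auto
      also have "\<dots> = (?p' + ?h) + (?P' + ?N)" by (simp add: ac_simps)
      finally show ?thesis using False \<open>?h \<noteq> \<infinity>\<close> unfolding ennreal_add_left_cancel_le by simp
    next
      case True
      then have "?h' = \<infinity>" using e' P' by auto
      then have hinf: "?h = \<infinity>" using hC by (simp add: top_unique)
      have "?h \<le> (\<integral>\<^sup>+g. ennreal (- f (C g)) + ennreal H * indicator {g\<in>space M. y1 < C g} g \<partial>M)"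
      proof (intro nn_integral_mono)
        fix g assume "g \<in> space M"
        show "ennreal (h (C g)) \<le> ennreal (- f (C g)) + ennreal H * indicator {g\<in>space M. y1 < C g} g"
          using \<open>g \<in> space M\<close> unfolding h_def H_def by (cases "y1 < C g") (auto simp: min_def)
      qed
      also have "\<dots> = ?N + ennreal H * emeasure M {g\<in>space M. y1 < C g}"
        by (subst nn_integral_add) (auto simp: nn_integral_cmult_indicator)
      finally have "emeasure M {g\<in>space M. y1 < C g} = \<infinity>"
        unfolding hinf using N by (auto simp: top_unique ennreal_mult_eq_top_iff)
      then have "?N' = 0"
        using N P' by (intro neg_part_vanishes[OF f(1) y1(1,2) y3 y1(3)]) (auto simp: less_top)
      then show ?thesis using PP' by (simp add: add_increasing2)
    qed
  qed
qed

text \<open>If \<open>f\<close> is neither nonnegative nor nonincreasing, it has a negative minimum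
  at a positive point. The linear lower bound serves two purposes: it makes \<open>f\<close>
  continuous at 0, so that the minimum is attained, and it provides the bound \<open>K * y\<close>
  for the concave comparison.\<close>

lemma comparison_lower_linear:
  assumes f: "convex_on {0..} f" "f 0 = 0" and K: "\<And>y. 0 \<le> y \<Longrightarrow> - (K * y) \<le> f y"
    and P': "(\<integral>\<^sup>+x. ennreal (f (C' x)) \<partial>lborel) < \<infinity>"
  shows "(\<integral>\<^sup>+g. ennreal (f (C g)) \<partial>M) + (\<integral>\<^sup>+x. ennreal (- f (C' x)) \<partial>lborel) \<le>
    (\<integral>\<^sup>+x. ennreal (f (C' x)) \<partial>lborel) + (\<integral>\<^sup>+g. ennreal (- f (C g)) \<partial>M)"
proof -
  consider "\<And>y. 0 \<le> y \<Longrightarrow> 0 \<le> f y" | "\<And>x y. 0 \<le> x \<Longrightarrow> x \<le> y \<Longrightarrow> f y \<le> f x"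
    | x y z where "0 \<le> x" "x \<le> y" "f x < f y" "0 \<le> z" "f z < 0"
    by (metis not_le)
  then show ?thesis
  proof cases
    case 1
    then have "(\<integral>\<^sup>+x. ennreal (- f (C' x)) \<partial>lborel) = 0" by (simp add: ennreal_neg)
    then show ?thesis using pos_part_le[OF f] by (simp add: add_increasing2)
  next
    case 2
    have neg: "f y \<le> 0" if "0 \<le> y" for y using 2[of 0 y] that f(2) by simp
    have "(\<integral>\<^sup>+x. ennreal (- f (C' x)) \<partial>lborel) \<le> (\<integral>\<^sup>+g. ennreal (- f (C g)) \<partial>M)"
      by (rule concave_ge[where h="\<lambda>y. - f y" and K=K]) (use f K neg in \<open>auto simp: minus_le_iff\<close>)
    then show ?thesis by (simp add: neg ennreal_neg)
  next
    case 3
    define Y where "Y = max y z"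
    have Y: "0 \<le> Y" "y \<le> Y" "z \<le> Y" unfolding Y_def using 3 by auto
    have "continuous_on {0..Y} f"
      unfolding continuous_on_eq_continuous_within
    proof
      fix a assume a: "a \<in> {0..Y}"
      show "continuous (at a within {0..Y}) f"
      proof (cases "a = 0")
        case False
        have "convex_on {0<..} f" by (rule convex_on_subset[OF f(1)]) auto
        then have "continuous_on {0<..} f" by (intro convex_on_continuous) auto
        then have "isCont f a" using False a by (simp add: continuous_on_eq_continuous_at)
        then show ?thesis by (rule continuous_at_imp_continuous_at_within)
      next
        case True
        have "(f \<longlongrightarrow> 0) (at 0 within {0..Y})"
        proof (rule tendsto_sandwich)
          show "((\<lambda>y. - (K * y)) \<longlongrightarrow> 0) (at 0 within {0..Y})" by (auto intro!: tendsto_eq_intros)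
          show "((\<lambda>y. y * f 1) \<longlongrightarrow> 0) (at 0 within {0..Y})" by (auto intro!: tendsto_eq_intros)
          show "\<forall>\<^sub>F y in at 0 within {0..Y}. - (K * y) \<le> f y"
            using K by (auto simp: eventually_at intro!: exI[of _ 1])
          have "f y \<le> y * f 1" if "0 \<le> y" "y < 1" for y
            using convex_on_three_points[OF f(1), of 0 y 1] that f(2) by simp
          then show "\<forall>\<^sub>F y in at 0 within {0..Y}. f y \<le> y * f 1"
            by (auto simp: eventually_at dist_real_def intro!: exI[of _ 1])
        qed
        then show ?thesis using True f(2) by (simp add: continuous_within)
      qed
    qed
    then obtain y1 where y1: "0 \<le> y1" "y1 \<le> Y" "\<And>a. 0 \<le> a \<Longrightarrow> a \<le> Y \<Longrightarrow> f y1 \<le> f a"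
      using continuous_attains_inf[of "{0..Y}" f] Y by (auto simp: Ball_def)
    have beyond: "f y \<le> f a" if a: "y \<le> a" for a
    proof (rule ccontr)
      assume "\<not> ?thesis"
      then have "f a < f y" by simp
      have xa: "x < y" "x < a" using 3 a by (auto simp: less_le)
      have "(a - x) * f y \<le> (a - y) * f x + (y - x) * f a"
        by (rule convex_on_three_points[OF f(1) 3(1,2) a])
      also have "\<dots> < (a - y) * f y + (y - x) * f y"
        using 3 xa \<open>f a < f y\<close> a by (intro add_le_less_mono mult_left_mono mult_strict_left_mono) auto
      also have "\<dots> = (a - x) * f y" by (simp add: algebra_simps)
      finally show False by simp
    qed
    have min: "f y1 \<le> f a" if "0 \<le> a" for a
    proof (cases "a \<le> Y")
      case False
      then have "f y \<le> f a" using Y by (intro beyond) auto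
      moreover have "f y1 \<le> f y" using y1(3)[of y] 3 Y by auto
      ultimately show ?thesis by simp
    qed (use y1(3) that in auto)
    have neg: "f y1 < 0" using min[OF 3(4)] 3(5) by simp
    then have pos: "0 < y1" using y1(1) f(2) by (cases "y1 = 0") auto
    have "f y1 < f y" using min[OF 3(1)] 3(3) by simp
    moreover have "y1 < y"
    proof (rule ccontr)
      assume "\<not> ?thesis"
      then have "f y \<le> f x"
        using 3 y1 by (intro convex_increasing_part(4)[OF f(1) y1(1) min]) auto
      then show False using 3(3) by simp
    qed
    ultimately show ?thesis by (intro comparison_valley[OF f K pos neg min _ _ P'])
  qed
qed

text \<open>Near 0 the function \<open>f\<close> may lie below every linear function. Taking the
  maximum with \<open>- (k * y)\<close> leaves the positive part unchanged and recovers the negative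
  part as \<open>k\<close> grows; Fatou's lemma is needed on the line, and plain monotonicity
  suffices on \<open>M\<close>.\<close>

lemma comparison:
  assumes f: "convex_on {0..} f" "f 0 = 0" and P': "(\<integral>\<^sup>+x. ennreal (f (C' x)) \<partial>lborel) < \<infinity>"
  shows "(\<integral>\<^sup>+g. ennreal (f (C g)) \<partial>M) + (\<integral>\<^sup>+x. ennreal (- f (C' x)) \<partial>lborel) \<le>
    (\<integral>\<^sup>+x. ennreal (f (C' x)) \<partial>lborel) + (\<integral>\<^sup>+g. ennreal (- f (C g)) \<partial>M)"
    (is "?P + ?N' \<le> ?P' + ?N")
proof -
  define F where "F k y = max (f y) (- (real k * y))" for k :: nat and y
  have F: "convex_on {0..} (F k)" "F k 0 = 0" for k
    unfolding F_def using convex_on_pointwise_max[OF f(1) convex_on_linear[of "- real k"]] f(2) by simp_all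
  have pos: "ennreal (F k y) = ennreal (f y)" if "0 \<le> y" for k y
  proof -
    have "0 \<le> real k * y" using that by simp
    then show ?thesis unfolding F_def by (cases "0 \<le> f y") (auto simp: max_def ennreal_neg)
  qed
  have neg: "ennreal (- F k y) \<le> ennreal (- f y)" for k y unfolding F_def by (intro ennreal_leI) auto
  have le: "?P + (\<integral>\<^sup>+x. ennreal (- F k (C' x)) \<partial>lborel) \<le> ?P' + ?N" for k
  proof -
    have "(\<integral>\<^sup>+g. ennreal (F k (C g)) \<partial>M) + (\<integral>\<^sup>+x. ennreal (- F k (C' x)) \<partial>lborel) \<le>
      (\<integral>\<^sup>+x. ennreal (F k (C' x)) \<partial>lborel) + (\<integral>\<^sup>+g. ennreal (- F k (C g)) \<partial>M)"
      by (rule comparison_lower_linear[OF F, of "real k"]) (use P' in \<open>auto simp: pos\<close>, simp add: F_def)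
    also have "\<dots> \<le> (\<integral>\<^sup>+x. ennreal (F k (C' x)) \<partial>lborel) + ?N"
      by (intro add_left_mono nn_integral_mono neg)
    finally show ?thesis by (simp add: pos)
  qed
  have Fm: "(\<lambda>x. F k (C' x)) \<in> borel_measurable borel" for k
    using convex_comp_measurable[OF F(1) C_measurable(2)] by simp
  note [measurable] = Fm
  have lim: "(\<lambda>k. ennreal (- F k y)) \<longlonglongrightarrow> ennreal (- f y)" if "0 \<le> y" for y
  proof (intro tendsto_eventually)
    show "\<forall>\<^sub>F k in sequentially. ennreal (- F k y) = ennreal (- f y)"
    proof (cases "y = 0")
      case True
      then show ?thesis using F(2) f(2) by simp
    next
      case False
      then have y: "0 < y" using that by simp
      show ?thesis
      proof (rule eventually_sequentiallyI[of "nat \<lceil>- f y / y\<rceil>"])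
        fix k assume "nat \<lceil>- f y / y\<rceil> \<le> k"
        then have "- f y / y \<le> real k" by linarith
        then have "- f y \<le> real k * y" using y by (simp add: field_simps)
        then show "ennreal (- F k y) = ennreal (- f y)" unfolding F_def by (simp add: max_absorb1)
      qed
    qed
  qed
  have "?N' = (\<integral>\<^sup>+x. liminf (\<lambda>k. ennreal (- F k (C' x))) \<partial>lborel)"
    by (intro nn_integral_cong lim_imp_Liminf[symmetric] lim) auto
  also have "\<dots> \<le> liminf (\<lambda>k. \<integral>\<^sup>+x. ennreal (- F k (C' x)) \<partial>lborel)"
    by (rule nn_integral_liminf) measurable
  finally have "?P + ?N' \<le> ?P + liminf (\<lambda>k. \<integral>\<^sup>+x. ennreal (- F k (C' x)) \<partial>lborel)" by (rule add_left_mono)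
  also have "\<dots> \<le> ?P' + ?N"
  proof (rule ccontr)
    let ?L = "liminf (\<lambda>k. \<integral>\<^sup>+x. ennreal (- F k (C' x)) \<partial>lborel)"
    have P: "?P < \<infinity>" using pos_part_le[OF f] P' by (rule le_less_trans)
    have "(\<integral>\<^sup>+x. ennreal (- F k (C' x)) \<partial>lborel) \<le> (?P' + ?N) - ?P" for k
      using le[of k] P by (subst ennreal_le_minus_iff) (auto simp: add.commute)
    then have "?L \<le> liminf (\<lambda>k::nat. (?P' + ?N) - ?P)" by (intro Liminf_mono always_eventually) auto
    then have "?L \<le> (?P' + ?N) - ?P" by (simp add: Liminf_const)
    then have "?P + ?L \<le> ?P + ((?P' + ?N) - ?P)" by (rule add_left_mono)
    also have "\<dots> = ?P' + ?N"
      by (intro add_diff_inverse_ennreal order_trans[OF _ le[of 0]]) simp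
    finally have "?P + ?L \<le> ?P' + ?N" .
    moreover assume "\<not> ?P + ?L \<le> ?P' + ?N"
    ultimately show False by simp
  qed
  finally show ?thesis .
qed

end

text \<open>If \<open>P'\<close> is infinite, then \<open>N'\<close> is finite and the right-hand
  difference is infinite; if \<open>P'\<close> is finite, the additive inequality can be rearranged,
  an infinite \<open>N\<close> making the left-hand difference minus infinity.\<close>

lemma enn2ereal_diff_le:
  assumes "P \<le> P'" "P < \<infinity> \<or> N < \<infinity>" "P' < \<infinity> \<or> N' < \<infinity>" "P' < \<infinity> \<Longrightarrow> P + N' \<le> P' + N"
  shows "enn2ereal P - enn2ereal N \<le> enn2ereal P' - enn2ereal N'"
proof (cases "P' = \<infinity>")
  case True
  then obtain n where "N' = ennreal n" "0 \<le> n" using assms(3) by (cases N') auto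
  then show ?thesis using True by (simp add: enn2ereal_ennreal top_ereal_def)
next
  case False
  then obtain p' where p': "P' = ennreal p'" "0 \<le> p'" by (cases P') auto
  then obtain p where p: "P = ennreal p" "0 \<le> p" using assms(1) by (cases P) (auto simp: top_unique)
  show ?thesis
  proof (cases "N = \<infinity>")
    case True
    then show ?thesis using p by (simp add: enn2ereal_ennreal top_ereal_def)
  next
    case False
    then obtain n where n: "N = ennreal n" "0 \<le> n" by (cases N) auto
    have le: "P + N' \<le> P' + N" using assms(4) p' by simp
    then obtain n' where n': "N' = ennreal n'" "0 \<le> n'" using p' n
      by (cases N') (auto simp: top_unique simp flip: ennreal_plus)
    have "p + n' \<le> p' + n" using le p p' n n' by (simp add: ennreal_le_iff flip: ennreal_plus)
    then show ?thesis using p p' n n' by (simp add: enn2ereal_ennreal)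
  qed
qed

theorem theorem1p2:
  fixes \<mu> :: "'a::{topological_group_add, t2_space} measure"
    and \<phi>\<^sub>1 \<phi>\<^sub>2 :: "'a \<Rightarrow> real"
    and f :: "real \<Rightarrow> real"
  defines "c \<equiv> convolve \<mu> (\<lambda>g. ennreal (\<phi>\<^sub>1 g)) (\<lambda>g. ennreal (\<phi>\<^sub>2 g))"
    and "c' \<equiv> convolve lborel (rearrangement \<mu> \<phi>\<^sub>1) (rearrangement \<mu> \<phi>\<^sub>2)"
  assumes "locally_compact_space (euclidean :: 'a topology)"
    and "haar_measure \<mu>"
    and unimodular: "right_invariant \<mu>"
    and "nonneg_measurable \<mu> \<phi>\<^sub>1"
    and "nonneg_measurable \<mu> \<phi>\<^sub>2"
    and "emeasure \<mu> (supp \<phi>\<^sub>1) + emeasure \<mu> (supp \<phi>\<^sub>2) \<le> min_open_subgroup \<mu>"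
    and "AE g in \<mu>. c g < \<infinity>"
    and "AE x in lborel. c' x < \<infinity>"
    and "convex_on {0..} f"
    and "f 0 = 0"
    and "integral_definable \<mu> (comp_ennreal f c)"
    and "integral_definable lborel (comp_ennreal f c')"
  shows "ext_integral \<mu> (comp_ennreal f c) \<le> ext_integral lborel (comp_ennreal f c')"
proof -
  interpret unimodular_haar \<mu> by standard fact+
  show ?thesis
  proof (rule convolution_approximation[OF \<open>nonneg_measurable \<mu> \<phi>\<^sub>1\<close> \<open>nonneg_measurable \<mu> \<phi>\<^sub>2\<close>
          \<open>emeasure \<mu> (supp \<phi>\<^sub>1) + emeasure \<mu> (supp \<phi>\<^sub>2) \<le> min_open_subgroup \<mu>\<close>, folded c_def c'_def])
    fix u :: "nat \<Rightarrow> 'a \<Rightarrow> real" and v :: "nat \<Rightarrow> real \<Rightarrow> real"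
    assume uv: "approximates \<mu> u c" "approximates lborel v c'"
      "\<And>n t. 0 \<le> t \<Longrightarrow> (\<integral>\<^sup>+g. ennreal (u n g - t) \<partial>\<mu>) \<le> (\<integral>\<^sup>+x. ennreal (v n x - t) \<partial>lborel)"
      "\<And>n. (\<integral>\<^sup>+g. ennreal (u n g) \<partial>\<mu>) = (\<integral>\<^sup>+x. ennreal (v n x) \<partial>lborel)"
      "\<And>n. (\<integral>\<^sup>+g. ennreal (u n g) \<partial>\<mu>) < \<infinity>"
      "\<And>n x y. \<bar>x\<bar> \<le> \<bar>y\<bar> \<Longrightarrow> v n y \<le> v n x"
    interpret L: convolution_comparison \<mu> c c' u v
      by unfold_locales (use uv \<open>AE g in \<mu>. c g < \<infinity>\<close> \<open>AE x in lborel. c' x < \<infinity>\<close> in auto)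
    have e: "comp_ennreal f c = (\<lambda>g. f (L.C g))" "comp_ennreal f c' = (\<lambda>x. f (L.C' x))"
      unfolding comp_ennreal_def L.C_def L.C'_def by simp_all
    show ?thesis
      unfolding ext_integral_def e
    proof (rule enn2ereal_diff_le)
      show "(\<integral>\<^sup>+g. ennreal (f (L.C g)) \<partial>\<mu>) \<le> (\<integral>\<^sup>+x. ennreal (f (L.C' x)) \<partial>lborel)"
        by (rule L.pos_part_le) fact+
    qed (use \<open>integral_definable \<mu> (comp_ennreal f c)\<close> \<open>integral_definable lborel (comp_ennreal f c')\<close>
        L.comparison[OF \<open>convex_on {0..} f\<close> \<open>f 0 = 0\<close>] in \<open>auto simp: integral_definable_def e\<close>)
  qed
qed

end
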